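(* Let $d\ge 3$ and let $a:\mathbb{R}^d\to\mathbb{R}$ be a function such that: $a(-x)=a(x)$ for all $x\in\mathbb{R}^d$; $a\ge 0$ and $a$ is continuous and bounded; $\int_{\mathbb{R}^d}a(y)\,\mathrm{d}y=1$; the Fourier transform $\hat a$ belongs to $L^1(\mathbb{R}^d)$; and $\int_{\mathbb{R}^d}|x|^2a(x)\,\mathrm{d}x<\infty$. Let $X$ be the pure jump Markov process (compound Poisson process) in $\mathbb{R}^d$ with generator $$(Lf)(x)=\int_{\mathbb{R}^d}a(x-y)[f(y)-f(x)]\,\mathrm{d}y,$$ and let $\mathcal{G}(x,\mathrm{d}y)$ be its Green measure. Let $S$ be a driftless subordinator independent of $X$ whose associated kernel $k(t)=\sigma((t,\infty))$ is admissible (in the sense given in the context), let $E$ be its inverse, and let $N(t):=\int_0^t k(s)\,\mathrm{d}s$. Let $f:\mathbb{R}^d\to\mathbb{R}$ be bounded, continuous and integrable, and let $v(t,x)$ be the solution, with initial data $f$, of the fractional evolution equation $$\mathbb{D}_t^{(k)}v(t,x)=Lv(t,x),\qquad v(0,x)=f(x),$$ given by $v(t,x)=\mathbb{E}[f(X(E(t)))]$ with $X(0)=x$. Then for every $x\in\mathbb{R}^d$, $$\lim_{t\to\infty}\frac{1}{N(t)}\int_0^t v(s,x)\,\mathrm{d}s=\int_{\mathbb{R}^d}f(y)\,\mathcal{G}(x,\mathrm{d}y).$$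
   Context: Subordinator. $S=\{S(t),\,t\ge 0\}$ is a subordinator without drift starting at zero (an increasing Lévy process), with Laplace exponent $\Phi$: $\mathbb{E}(e^{-\lambda S(t)})=e^{-t\Phi(\lambda)}$, $\lambda\ge 0$, where $\Phi(\lambda)=\int_{(0,\infty)}(1-e^{-\lambda\tau})\,\mathrm{d}\sigma(\tau)$ and the Lévy measure $\sigma$ satisfies $\int_{(0,\infty)}(1\wedge\tau)\,\mathrm{d}\sigma(\tau)<\infty$ and $\sigma((0,\infty))=\infty$. The associated kernel is $k:(0,\infty)\to(0,\infty)$, $k(t):=\sigma((t,\infty))$, with Laplace transform $\mathcal{K}(\lambda):=\int_0^\infty e^{-\lambda t}k(t)\,\mathrm{d}t$, so that $\Phi(\lambda)=\lambda\mathcal{K}(\lambda)$ for $\lambda>0$. Admissible kernel. The kernel $k\in L^1_{\mathrm{loc}}(\mathbb{R}_+)$ is called admissible if all of the following hold: (i) $\Phi$ is a complete Bernstein function, understood as: the Lévy measure $\sigma$ is absolutely continuous with respect to Lebesgue measure; (ii) $\mathcal{K}(\lambda)\to\infty$ as $\lambda\to 0$ and $\mathcal{K}(\lambda)\to 0$ as $\lambda\to\infty$; $\Phi(\lambda)\to 0$ as $\lambda\to 0$ and $\Phi(\lambda)\to\infty$ as $\lambda\to\infty$; (iii) for some $s_0>0$, $\liminf_{\lambda\to 0+}\frac{1}{\mathcal{K}(\lambda)}\int_0^{s_0/\lambda}k(t)\,\mathrm{d}t>0$; (iv) $\left(\int_0^t k(s)\,\mathrm{d}s\right)\left(\int_0^r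 k(s)\,\mathrm{d}s\right)^{-1}\to 1$ as $t,r\to\infty$ with $t/r\to 1$. Inverse subordinator. $E(t):=\inf\{s\ge 0 : S(s)\ge t\}$, $t\ge 0$. For $t>0$, $G_t(\tau)$, $\tau\ge 0$, denotes the density of $E(t)$. Generalized fractional derivative. $\big(\mathbb{D}_t^{(k)}u\big)(t)=\frac{d}{dt}\int_0^t k(t-\tau)u(\tau)\,\mathrm{d}\tau-k(t)u(0)$, $t>0$. Kolmogorov equation and subordination. $u(t,x):=\mathbb{E}[f(X(t))]$ with $X(0)=x$ is the solution of $\frac{\partial}{\partial t}u(t,x)=Lu(t,x)$, $u(0,x)=f(x)$. The solution $v$ of the fractional equation is given by the subordination formula $v(t,x)=\mathbb{E}[f(X(E(t)))]=\int_0^\infty u(\tau,x)G_t(\tau)\,\mathrm{d}\tau$ for $t>0$. Green measure. If $P_t(x,\mathrm{d}y)$ is the transition probability of $X$, i.e. the distribution of $X(t)$ given $X(0)=x$, then $\mathcal{G}(x,\mathrm{d}y):=\int_0^\infty P_t(x,\mathrm{d}y)\,\mathrm{d}t$. It is known that, if $d\ge 3$, if $a:\mathbb{R}^d\to\mathbb{R}$ is symmetric ($a(-x)=a(x)$ for all $x\in\mathbb{R}^d$), nonnegative, continuous and bounded, with $\int_{\mathbb{R}^d}a(y)\,\mathrm{d}y=1$, $\hat a\in L^1(\mathbb{R}^d)$ and $\int_{\mathbb{R}^d}|x|^2a(x)\,\mathrm{d}x<\infty$, and if $f:\mathbb{R}^d\to\mathbb{R}$ is bounded, continuous and integrable, then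 $\int_0^\infty u(t,x)\,\mathrm{d}t=\int_{\mathbb{R}^d}f(y)\,\mathcal{G}(x,\mathrm{d}y)$. *)

theory Defs
  imports "HOL-Probability.Probability"
begin

text \<open>A L\'evy measure on \<open>(0, \<infinity>)\<close> is represented by a Borel measure \<open>\<sigma>\<close> on the real line that
  gives no mass to the complement of \<open>(0, \<infinity>)\<close>.\<close>

definition infinite_levy_measure :: "real measure \<Rightarrow> bool" where
  "infinite_levy_measure \<sigma> \<longleftrightarrow>
     sets \<sigma> = sets borel \<and>
     emeasure \<sigma> {..0} = 0 \<and>
     (\<integral>\<^sup>+\<tau>\<in>{0<..}. ennreal (min 1 \<tau>) \<partial>\<sigma>) < \<infinity> \<and>
     emeasure \<sigma> {0<..} = \<infinity>"

definition laplace_exponent :: "real measure \<Rightarrow> real \<Rightarrow> real" where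
  "laplace_exponent \<sigma> l = (LINT \<tau>:{0<..}|\<sigma>. 1 - exp (- l * \<tau>))"

locale subordinator = prob_space M
  for M :: "'w measure" and S :: "real \<Rightarrow> 'w \<Rightarrow> real" and \<sigma> :: "real measure" +
  assumes levy_measure: "infinite_levy_measure \<sigma>"
    and measurable_S: "\<And>t. 0 \<le> t \<Longrightarrow> S t \<in> borel_measurable M"
    and start_zero: "\<And>\<omega>. \<omega> \<in> space M \<Longrightarrow> S 0 \<omega> = 0"
    and increasing: "\<And>\<omega>. \<omega> \<in> space M \<Longrightarrow> mono_on {0..} (\<lambda>t. S t \<omega>)"
    and right_continuous: "\<And>\<omega> t. \<omega> \<in> space M \<Longrightarrow> 0 \<le> t \<Longrightarrow> continuous (at_right t) (\<lambda>s. S s \<omega>)"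
    and stationary_increments: "\<And>s t. 0 \<le> s \<Longrightarrow> 0 \<le> t \<Longrightarrow>
      distr M borel (\<lambda>\<omega>. S (s + t) \<omega> - S s \<omega>) = distr M borel (S t)"
    and independent_increments: "\<And>n (t :: nat \<Rightarrow> real). 0 \<le> t 0 \<Longrightarrow> (\<forall>i<n. t i \<le> t (Suc i)) \<Longrightarrow>
      indep_vars (\<lambda>_. borel) (\<lambda>i \<omega>. S (t (Suc i)) \<omega> - S (t i) \<omega>) {..<n}"
    and laplace_transform: "\<And>t l. 0 \<le> t \<Longrightarrow> 0 \<le> l \<Longrightarrow>
      expectation (\<lambda>\<omega>. exp (- l * S t \<omega>)) = exp (- t * laplace_exponent \<sigma> l)"

text \<open>The set below is nonempty for almost every \<open>\<omega>\<close>; the value \<open>0\<close> on the exceptional null set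
  is a convention that keeps the inverse real-valued, nonnegative and measurable.\<close>

definition inverse_subordinator :: "(real \<Rightarrow> 'w \<Rightarrow> real) \<Rightarrow> real \<Rightarrow> 'w \<Rightarrow> real" where
  "inverse_subordinator S t \<omega> =
     (if \<exists>s\<ge>0. S s \<omega> \<ge> t then Inf {s. 0 \<le> s \<and> S s \<omega> \<ge> t} else 0)"

text \<open>Only the values of the kernel on \<open>(0, \<infinity>)\<close> are meaningful.\<close>

definition kernel :: "real measure \<Rightarrow> real \<Rightarrow> real" where
  "kernel \<sigma> t = measure \<sigma> {t<..}"

definition kernel_laplace :: "real measure \<Rightarrow> real \<Rightarrow> real" where
  "kernel_laplace \<sigma> l = (LBINT t:{0<..}. exp (- l * t) * kernel \<sigma> t)"

definition kernel_primitive :: "real measure \<Rightarrow> real \<Rightarrow> real" where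
  "kernel_primitive \<sigma> t = (LBINT s:{0<..t}. kernel \<sigma> s)"

text \<open>That \<open>\<Phi>\<close> is a complete Bernstein function is understood here as absolute continuity of
  \<open>\<sigma>\<close> with respect to Lebesgue measure.  The filter in the last conjunct expresses
  \<open>t, r \<rightarrow> \<infinity>\<close> with \<open>t / r \<rightarrow> 1\<close>.\<close>

definition admissible_kernel :: "real measure \<Rightarrow> bool" where
  "admissible_kernel \<sigma> \<longleftrightarrow>
     (\<forall>t>0. 0 < kernel \<sigma> t) \<and>
     (\<forall>T>0. set_integrable lborel {0<..T} (kernel \<sigma>)) \<and>
     absolutely_continuous lborel \<sigma> \<and>
     filterlim (kernel_laplace \<sigma>) at_top (at_right 0) \<and>
     (kernel_laplace \<sigma> \<longlongrightarrow> 0) at_top \<and>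
     (laplace_exponent \<sigma> \<longlongrightarrow> 0) (at_right 0) \<and>
     filterlim (laplace_exponent \<sigma>) at_top at_top \<and>
     (\<exists>s\<^sub>0>0. Liminf (at_right 0)
        (\<lambda>l. ereal (1 / kernel_laplace \<sigma> l * kernel_primitive \<sigma> (s\<^sub>0 / l))) > 0) \<and>
     ((\<lambda>(t, r). kernel_primitive \<sigma> t * inverse (kernel_primitive \<sigma> r)) \<longlongrightarrow> 1)
        (inf (at_top \<times>\<^sub>F at_top) (filtercomap (\<lambda>(t, r). t / r) (nhds 1)))"

definition generated_algebra ::
    "'w measure \<Rightarrow> real set \<Rightarrow> (real \<Rightarrow> 'w \<Rightarrow> 'b::topological_space) \<Rightarrow> 'w measure" where
  "generated_algebra M T X =
     sigma (space M) {X r -` A \<inter> space M | r A. r \<in> T \<and> A \<in> sets borel}"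

text \<open>A Markov process is a family \<open>M x\<close> of probability laws on one measurable space, indexed by
  the starting point \<open>x\<close>, together with the coordinate process \<open>X\<close>.\<close>

definition transition_prob ::
    "('a::euclidean_space \<Rightarrow> 'w measure) \<Rightarrow> (real \<Rightarrow> 'w \<Rightarrow> 'a) \<Rightarrow> real \<Rightarrow> 'a \<Rightarrow> 'a measure" where
  "transition_prob M X t x = distr (M x) borel (X t)"

definition markov_process ::
    "('a::euclidean_space \<Rightarrow> 'w measure) \<Rightarrow> (real \<Rightarrow> 'w \<Rightarrow> 'a) \<Rightarrow> bool" where
  "markov_process M X \<longleftrightarrow>
     (\<forall>x. prob_space (M x)) \<and>
     (\<forall>x y. sets (M x) = sets (M y)) \<and>
     (\<forall>x. \<forall>t\<ge>0. X t \<in> borel_measurable (M x)) \<and>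
     (\<forall>x. AE \<omega> in M x. X 0 \<omega> = x) \<and>
     (\<forall>t\<ge>0. transition_prob M X t \<in> borel \<rightarrow>\<^sub>M prob_algebra borel) \<and>
     (\<forall>x. \<forall>s\<ge>0. \<forall>t\<ge>0. \<forall>A\<in>sets borel.
        AE \<omega> in M x.
          real_cond_exp (M x) (generated_algebra (M x) {0..s} X)
            (indicator (X (s + t) -` A \<inter> space (M x))) \<omega>
          = measure (transition_prob M X t (X s \<omega>)) A)"

text \<open>Right-continuous step functions with finitely many jumps on bounded time intervals: on a
  one-sided neighbourhood of every point the path is constant.\<close>

definition pure_jump_path :: "(real \<Rightarrow> 'a) \<Rightarrow> bool" where
  "pure_jump_path p \<longleftrightarrow>
     (\<forall>t\<ge>0. \<forall>\<^sub>F s in at_right t. p s = p t) \<and>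
     (\<forall>t>0. \<exists>y. \<forall>\<^sub>F s in at_left t. p s = y)"

text \<open>The generator is taken on the bounded continuous functions with the supremum norm, where
  the operator \<open>L\<close> of the theorem is everywhere defined.\<close>

definition has_generator ::
    "('a::euclidean_space \<Rightarrow> 'w measure) \<Rightarrow> (real \<Rightarrow> 'w \<Rightarrow> 'a) \<Rightarrow>
     (('a \<Rightarrow> real) \<Rightarrow> 'a \<Rightarrow> real) \<Rightarrow> bool" where
  "has_generator M X L \<longleftrightarrow>
     (\<forall>g. continuous_on UNIV g \<and> bounded (range g) \<longrightarrow>
        uniform_limit UNIV
          (\<lambda>t x. ((\<integral>\<omega>. g (X t \<omega>) \<partial>M x) - g x) / t) (L g) (at_right 0))"

definition jump_operator ::
    "('a::euclidean_space \<Rightarrow> real) \<Rightarrow> ('a \<Rightarrow> real) \<Rightarrow> 'a \<Rightarrow> real" where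
  "jump_operator a g x = (LBINT y. a (x - y) * (g y - g x))"

definition pure_jump_markov_process ::
    "('a::euclidean_space \<Rightarrow> 'w measure) \<Rightarrow> (real \<Rightarrow> 'w \<Rightarrow> 'a) \<Rightarrow> ('a \<Rightarrow> real) \<Rightarrow> bool" where
  "pure_jump_markov_process M X a \<longleftrightarrow>
     markov_process M X \<and>
     (\<forall>x. \<forall>\<omega>\<in>space (M x). pure_jump_path (\<lambda>t. X t \<omega>)) \<and>
     has_generator M X (jump_operator a)"

definition green_measure ::
    "('a::euclidean_space \<Rightarrow> 'w measure) \<Rightarrow> (real \<Rightarrow> 'w \<Rightarrow> 'a) \<Rightarrow> 'a \<Rightarrow> 'a measure" where
  "green_measure M X x =
     measure_of UNIV (sets borel)
       (\<lambda>A. \<integral>\<^sup>+t\<in>{0..}. emeasure (transition_prob M X t x) A \<partial>lborel)"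

text \<open>Other normalisations of the Fourier transform do not change its integrability.\<close>

definition fourier_transform :: "('a::euclidean_space \<Rightarrow> real) \<Rightarrow> 'a \<Rightarrow> complex" where
  "fourier_transform a \<xi> = (\<integral>y. cis (- (\<xi> \<bullet> y)) * complex_of_real (a y) \<partial>lborel)"

definition independent_processes ::
    "'w measure \<Rightarrow> (real \<Rightarrow> 'w \<Rightarrow> 'b::topological_space) \<Rightarrow>
     (real \<Rightarrow> 'w \<Rightarrow> 'c::topological_space) \<Rightarrow> bool" where
  "independent_processes M X Y \<longleftrightarrow>
     prob_space.indep_set M (sets (generated_algebra M {0..} X)) (sets (generated_algebra M {0..} Y))"

definition subordinated_solution ::
    "('a::euclidean_space \<Rightarrow> 'w measure) \<Rightarrow> (real \<Rightarrow> 'w \<Rightarrow> 'a) \<Rightarrow> (real \<Rightarrow> 'w \<Rightarrow> real) \<Rightarrow>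
     ('a \<Rightarrow> real) \<Rightarrow> real \<Rightarrow> 'a \<Rightarrow> real" where
  "subordinated_solution M X S f t x =
     (\<integral>\<omega>. f (X (inverse_subordinator S t \<omega>) \<omega>) \<partial>M x)"

end

theory Submission
  imports Defs
begin

text \<open>
  Write \<open>u(r) = E[f(X\<^sub>r)]\<close>, so that \<open>v(s) = E[u(E\<^sub>s)]\<close> by independence.  Since \<open>E\<^sub>s \<le> \<tau>\<close> iff
  \<open>s \<le> S\<^sub>\<tau>\<close>, the expected occupation measure of \<open>E\<close> on \<open>[0, t]\<close> has the distribution function
  \<open>\<tau> \<mapsto> E[min (S\<^sub>\<tau>) t]\<close>, and a Laplace transform in \<open>t\<close> shows that its density is
  \<open>h\<^sub>t(r) = E[N(t - S\<^sub>r)]\<close>, with \<open>N = 0\<close> on the negative half-line.  Hence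
  \<open>\<integral>\<^sub>0\<^sup>t v(s) ds = \<integral>\<^sub>0\<^sup>\<infinity> u(r) h\<^sub>t(r) dr\<close>.  As \<open>0 \<le> h\<^sub>t / N(t) \<le> 1\<close>, and \<open>h\<^sub>t / N(t) \<rightarrow> 1\<close> by
  condition (iv) of admissibility, dominated convergence yields the limit \<open>\<integral>\<^sub>0\<^sup>\<infinity> u(r) dr\<close>, which
  is the integral of \<open>f\<close> against the Green measure.

  The integrability of \<open>u\<close> is where \<open>d \<ge> 3\<close> enters.  The functions \<open>z \<mapsto> cos (\<xi> \<bullet> (z - y))\<close> are
  eigenfunctions of the generator, so that \<open>X\<^sub>t\<close> has the characteristic function
  \<open>exp (- t (1 - A(\<xi>)))\<close> up to a shift, where \<open>A\<close> is the cosine transform of \<open>a\<close>.  Splitting off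
  the atom \<open>e^{-t}\<close> and inverting the Fourier transform with a Gaussian mollifier bounds
  \<open>E[|f(X\<^sub>t)|]\<close> by \<open>e^{-t} sup |f| + C \<parallel>f\<parallel>\<^sub>1 \<integral> e^{-t} (exp (t |A|) - 1) d\<xi>\<close>.  The time integral of the
  last term is \<open>\<integral> |A| / (1 - |A|) d\<xi>\<close>, which is finite because \<open>1 - |A(\<xi>)| \<ge> c min 1 |\<xi>|\<^sup>2\<close>.
\<close>

section \<open>Gaussian integrals and the cosine transform of the jump density\<close>

text \<open>The atom keeps the characteristic function of \<open>X_t\<close> near
  \<open>e^{-t}\<close> at high frequencies, so it cannot be inverted directly. What remains after
  subtracting \<open>e^{-t}\<close> is of the order of \<open>A\<close>, which is integrable as the
  real part of the Fourier transform of \<open>a\<close>. Since \<open>A\<close> may be negative,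
  the remainder is bounded through \<open>|A|\<close>, and the gap to be kept open is
  \<open>1 - |A|\<close>: \<open>A\<close> must be kept away from \<open>-1\<close> as well as from
  \<open>1\<close>. Symmetry of \<open>a\<close> makes real cosines sufficient; the free phase
  \<open>y\<close> is the point at which inversion probes the law.

  The formula for \<open>h_t\<close> rests on \<open>\<Phi>(l) = l K(l)\<close>, with
  \<open>K\<close> the Laplace transform of the kernel: thanks to it, the Laplace transforms in
  \<open>s\<close> of \<open>P(S_\<tau> \<ge> s)\<close> and of the integral of
  \<open>E[k(s - S_r)]\<close> over \<open>r\<close> in \<open>[0, \<tau>]\<close> are both
  \<open>(1 - exp (- \<tau> \<Phi>(l))) / l\<close>. Condition (iv) is applied path by path: for a
  fixed path and a fixed \<open>r\<close> the shift \<open>S_r\<close> is a constant, so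
  \<open>(t - S_r) / t\<close> tends to 1.\<close>

lemma has_bochner_integral_lborel_affine:
  fixes f :: "'a::euclidean_space \<Rightarrow> 'b::{banach, second_countable_topology}"
  assumes "has_bochner_integral lborel f I" and c: "\<bar>c\<bar> = 1"
  shows "has_bochner_integral lborel (\<lambda>y. f (t + c *\<^sub>R y)) I"
proof -
  have "c \<noteq> 0" using c by auto
  from lborel_affine[OF this, of t] c
  have eq: "lborel = distr lborel borel (\<lambda>y::'a. t + c *\<^sub>R y)"
    by (simp add: density_1)
  have f: "f \<in> borel_measurable borel"
    using borel_measurable_has_bochner_integral[OF assms(1)] by simp
  have T: "(\<lambda>y::'a. t + c *\<^sub>R y) \<in> lborel \<rightarrow>\<^sub>M borel"
    by measurable
  have "has_bochner_integral (distr lborel borel (\<lambda>y::'a. t + c *\<^sub>R y)) f I"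
    using assms eq by simp
  then show ?thesis
    by (simp add: has_bochner_integral_iff integrable_distr_eq[OF T f] integral_distr[OF T f])
qed

text \<open>Lebesgue measure on a Euclidean space is the image of the product of one-dimensional
  Lebesgue measures under the map from coordinates to vectors, so Fubini applies. This reduces the
  Gaussian transform to one dimension.\<close>

lemma integral_lborel_prod_Basis:
  fixes f :: "'a::euclidean_space \<Rightarrow> real \<Rightarrow> complex"
  assumes "\<And>b. b \<in> Basis \<Longrightarrow> integrable lborel (f b)"
  shows "has_bochner_integral lborel (\<lambda>x::'a. \<Prod>b\<in>Basis. f b (x \<bullet> b))
           (\<Prod>b\<in>Basis. \<integral>t. f b t \<partial>lborel)"
proof -
  interpret product_sigma_finite "\<lambda>_::'a. lborel :: real measure"
    by standard
  have meas: "(\<lambda>x. \<Prod>b\<in>Basis. f b (x \<bullet> b)) \<in> borel_measurable (borel :: 'a measure)"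
  proof (rule borel_measurable_prod)
    fix b :: 'a assume "b \<in> Basis"
    then have "f b \<in> borel_measurable borel"
      using assms[of b] by auto
    from measurable_compose[OF _ this, of "\<lambda>x. x \<bullet> b" borel]
    show "(\<lambda>x. f b (x \<bullet> b)) \<in> borel_measurable borel"
      by simp
  qed
  have T: "(\<lambda>g. \<Sum>b\<in>Basis. g b *\<^sub>R b) \<in> (\<Pi>\<^sub>M b\<in>Basis. lborel) \<rightarrow>\<^sub>M (borel :: 'a measure)"
    by measurable
  have "integrable (\<Pi>\<^sub>M b\<in>Basis. lborel) (\<lambda>g. \<Prod>b\<in>Basis. f b (g b))"
    using assms by (intro product_integrable_prod) auto
  moreover have "(\<integral>g. (\<Prod>b\<in>Basis. f b (g b)) \<partial>(\<Pi>\<^sub>M b\<in>Basis. lborel)) = (\<Prod>b\<in>Basis. \<integral>t. f b t \<partial>lborel)"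
    using assms by (intro product_integral_prod) auto
  ultimately show ?thesis
    unfolding has_bochner_integral_iff
    by (subst (1 2) lborel_eq) (simp add: integrable_distr_eq[OF T meas] integral_distr[OF T meas] cong: prod.cong)
qed

lemma fourier_std_normal:
  "has_bochner_integral lborel (\<lambda>x. cis (t * x) * complex_of_real (exp (- (x\<^sup>2) / 2)))
     (complex_of_real (sqrt (2 * pi) * exp (- (t\<^sup>2) / 2)))"
proof -
  have int: "integrable lborel (\<lambda>x. cis (t * x) * complex_of_real (exp (- (x\<^sup>2) / 2)))"
  proof (rule Bochner_Integration.integrable_bound)
    show "integrable lborel (\<lambda>x. sqrt (2 * pi) * std_normal_density x)"
      by (intro integrable_mult_right) simp
    show "(\<lambda>x. cis (t * x) * complex_of_real (exp (- (x\<^sup>2) / 2))) \<in> borel_measurable lborel"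
      by (simp, intro borel_measurable_continuous_onI continuous_intros) auto
  qed (auto simp: norm_mult std_normal_density_def)
  have "complex_of_real (exp (- (t\<^sup>2) / 2)) = (CLINT x|std_normal_distribution. iexp (t * x))"
    using fun_cong[OF char_std_normal_distribution, of t] by (simp add: char_def)
  also have "\<dots> = (\<integral>x. std_normal_density x *\<^sub>R iexp (t * x) \<partial>lborel)"
    by (subst integral_density) auto
  also have "\<dots> = (\<integral>x. complex_of_real (1 / sqrt (2 * pi)) *
      (cis (t * x) * complex_of_real (exp (- (x\<^sup>2) / 2))) \<partial>lborel)"
    by (intro Bochner_Integration.integral_cong)
       (auto simp: std_normal_density_def scaleR_conv_of_real cis_conv_exp)
  also have "\<dots> = complex_of_real (1 / sqrt (2 * pi)) *
      (\<integral>x. cis (t * x) * complex_of_real (exp (- (x\<^sup>2) / 2)) \<partial>lborel)"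
    by simp
  finally show ?thesis
    using int by (simp add: has_bochner_integral_iff field_simps)
qed

text \<open>Both the character \<open>cis (\<xi> \<bullet> z)\<close> and the Gaussian factor over
  the coordinates, and each factor is the one-dimensional transform. The cosine statement is the
  real part.\<close>

lemma fourier_gaussian:
  fixes z :: "'a::euclidean_space"
  shows "has_bochner_integral lborel (\<lambda>\<xi>. cos (\<xi> \<bullet> z) * exp (- (norm \<xi>)\<^sup>2 / 2))
     (sqrt (2 * pi) ^ DIM('a) * exp (- (norm z)\<^sup>2 / 2))"
proof -
  have cis_sum: "cis (\<Sum>b\<in>B. g b) = (\<Prod>b\<in>B. cis (g b))" if "finite B" for B :: "'a set" and g
    using that by induction (auto simp flip: cis_mult)
  have 1: "has_bochner_integral lborel
      (\<lambda>\<xi>::'a. \<Prod>b\<in>Basis. cis ((z \<bullet> b) * (\<xi> \<bullet> b)) * complex_of_real (exp (- ((\<xi> \<bullet> b)\<^sup>2) / 2)))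
      (\<Prod>b\<in>Basis. complex_of_real (sqrt (2 * pi) * exp (- ((z \<bullet> b)\<^sup>2) / 2)))"
    using integral_lborel_prod_Basis[of "\<lambda>b x. cis ((z \<bullet> b) * x) * complex_of_real (exp (- (x\<^sup>2) / 2))"]
      fourier_std_normal by (simp add: has_bochner_integral_iff)
  have nrm: "(norm y)\<^sup>2 = (\<Sum>b\<in>Basis. (y \<bullet> b)\<^sup>2)" for y :: 'a
    unfolding power2_norm_eq_inner by (subst euclidean_inner) (simp add: power2_eq_square)
  have exp_norm: "exp (- (norm y)\<^sup>2 / 2) = (\<Prod>b\<in>Basis. exp (- ((y \<bullet> b)\<^sup>2) / 2))" for y :: 'a
    by (simp add: nrm sum_divide_distrib sum_negf flip: exp_sum)
  have "cis (\<xi> \<bullet> z) = (\<Prod>b\<in>Basis. cis ((z \<bullet> b) * (\<xi> \<bullet> b)))" for \<xi>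
    by (subst euclidean_inner) (simp add: cis_sum mult.commute)
  then have "has_bochner_integral lborel
      (\<lambda>\<xi>::'a. cis (\<xi> \<bullet> z) * complex_of_real (exp (- (norm \<xi>)\<^sup>2 / 2)))
      (complex_of_real (sqrt (2 * pi) ^ DIM('a) * exp (- (norm z)\<^sup>2 / 2)))"
    using 1 unfolding exp_norm by (simp add: prod.distrib)
  from has_bochner_integral_Re[OF this] show ?thesis
    by (simp add: cis.sel)
qed

lemma fourier_gaussian_scaled:
  fixes z :: "'a::euclidean_space"
  assumes "0 < e"
  shows "has_bochner_integral lborel (\<lambda>\<xi>. cos (\<xi> \<bullet> z) * exp (- (norm (e *\<^sub>R \<xi>))\<^sup>2 / 2))
     (sqrt (2 * pi) ^ DIM('a) / e ^ DIM('a) * exp (- (norm (z /\<^sub>R e))\<^sup>2 / 2))"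
proof -
  let ?g = "\<lambda>\<xi>. cos (\<xi> \<bullet> (z /\<^sub>R e)) * exp (- (norm \<xi>)\<^sup>2 / 2)"
  have "lborel = density (distr lborel borel (\<lambda>x::'a. 0 + e *\<^sub>R x)) (\<lambda>_. ennreal (\<bar>e\<bar> ^ DIM('a)))"
    using assms by (intro lborel_affine) auto
  then have lb: "lborel = density (distr lborel borel (\<lambda>x::'a. e *\<^sub>R x)) (\<lambda>_. ennreal (e ^ DIM('a)))"
    using assms by simp
  have g: "?g \<in> borel_measurable borel"
    by measurable
  have eq: "cos (\<xi> \<bullet> z) * exp (- (norm (e *\<^sub>R \<xi>))\<^sup>2 / 2) = ?g (e *\<^sub>R \<xi>)" for \<xi>
    using assms by (simp add: field_simps)
  have epos: "e ^ DIM('a) > 0"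
    using assms by simp
  have "has_bochner_integral lborel ?g
     (sqrt (2 * pi) ^ DIM('a) * exp (- (norm (z /\<^sub>R e))\<^sup>2 / 2))"
    by (rule fourier_gaussian)
  then have "has_bochner_integral (density (distr lborel borel (\<lambda>x::'a. e *\<^sub>R x)) (\<lambda>_. ennreal (e ^ DIM('a)))) ?g
     (sqrt (2 * pi) ^ DIM('a) * exp (- (norm (z /\<^sub>R e))\<^sup>2 / 2))"
    using lb by simp
  then have "has_bochner_integral lborel (\<lambda>\<xi>. e ^ DIM('a) * ?g (e *\<^sub>R \<xi>))
     (sqrt (2 * pi) ^ DIM('a) * exp (- (norm (z /\<^sub>R e))\<^sup>2 / 2))"
    using epos by (simp add: has_bochner_integral_iff integrable_density integral_density integrable_distr_eq integral_distr)
  then have "has_bochner_integral lborel (\<lambda>\<xi>. (1 / e ^ DIM('a)) * (e ^ DIM('a) * ?g (e *\<^sub>R \<xi>)))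
     ((1 / e ^ DIM('a)) * (sqrt (2 * pi) ^ DIM('a) * exp (- (norm (z /\<^sub>R e))\<^sup>2 / 2)))"
    by (rule has_bochner_integral_mult_right)
  then show ?thesis
    unfolding eq using assms by simp
qed

text \<open>The dyadic layer of radius \<open>2^{-k}\<close> contributes at most a multiple of \<open>2^{(2 - d) k}\<close>.\<close>

lemma nn_integral_inverse_norm_square:
  assumes "DIM('a::euclidean_space) \<ge> 3"
  shows "(\<integral>\<^sup>+x\<in>cball (0::'a) 1. ennreal (1 / (norm x)\<^sup>2) \<partial>lborel) < \<infinity>"
proof -
  let ?V = "unit_ball_vol (DIM('a))"
  let ?g = "\<lambda>k (x::'a). ennreal (4 ^ Suc k) * indicator (cball 0 ((1/2) ^ k)) x"
  have le: "ennreal (1 / (norm x)\<^sup>2) * indicator (cball 0 1) x \<le> (\<Sum>k. ?g k x)" for x :: 'a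
  proof (cases "x \<noteq> 0 \<and> norm x \<le> 1")
    case True
    then have "0 < norm x" by simp
    obtain m where m: "(1/2) ^ m < norm x"
      using real_arch_pow_inv[OF \<open>0 < norm x\<close>, of "1/2"] by auto
    \<comment> \<open>Minimality puts \<open>x\<close> inside the ball of radius
      \<open>(1/2) ^ j\<close> and outside the one of radius \<open>(1/2) ^ Suc j\<close>, whence
      \<open>1 / (norm x)\<^sup>2\<close> is at most \<open>4 ^ Suc j\<close>. Summing over full
      balls instead of annuli only enlarges the bound.\<close>
    define k where "k = (LEAST m. (1/2) ^ m < norm x)"
    have k: "(1/2) ^ k < norm x"
      unfolding k_def using m by (rule LeastI)
    have "k \<noteq> 0"
      using k True by (intro notI) simp
    then obtain j where j: "k = Suc j"
      using not0_implies_Suc by blast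
    have "\<not> (1/2) ^ j < norm x"
      using not_less_Least[of j "\<lambda>m. (1/2) ^ m < norm x"] j by (simp add: k_def)
    then have xj: "norm x \<le> (1/2) ^ j"
      by simp
    have "((1/2) ^ k)\<^sup>2 \<le> (norm x)\<^sup>2"
      using k by (intro power_mono) auto
    then have "1 / (norm x)\<^sup>2 \<le> 1 / ((1/2) ^ k)\<^sup>2"
      using True by (intro divide_left_mono) auto
    also have "\<dots> = 4 ^ Suc j"
      by (simp add: j power2_eq_square power_divide flip: power_mult_distrib)
    finally have "ennreal (1 / (norm x)\<^sup>2) * indicator (cball 0 1) x \<le> ?g j x"
      using xj True by (auto simp: indicator_def intro!: ennreal_leI)
    also have "\<dots> \<le> (\<Sum>k. ?g k x)"
      using sum_le_suminf[of "\<lambda>k. ?g k x" "{j}"] by (simp del: sum_mult_indicator)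
    finally show ?thesis .
  next
    case False
    then have "ennreal (1 / (norm x)\<^sup>2) * indicator (cball 0 1) x = 0"
      by (auto simp: indicator_def)
    then show ?thesis by (simp only: zero_le)
  qed
  \<comment> \<open>Of three factors \<open>(1/2) ^ k\<close> supplied by the volume, two cancel
    \<open>4 ^ k\<close>; the third makes the series geometric.\<close>
  have half: "4 ^ Suc k * (?V * ((1/2) ^ k) ^ DIM('a)) \<le> 4 * ?V * (1/2) ^ k" for k
  proof -
    have "((1/2::real) ^ k) ^ DIM('a) \<le> ((1/2) ^ k) ^ 3"
      using assms by (intro power_decreasing) (auto simp: power_le_one)
    also have "\<dots> = (1/2) ^ k * (1/4) ^ k"
      by (simp add: power3_eq_cube mult.assoc flip: power_mult_distrib)
    finally have "4 ^ Suc k * (?V * ((1/2) ^ k) ^ DIM('a)) \<le> 4 ^ Suc k * (?V * ((1/2) ^ k * (1/4) ^ k))"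
      by (intro mult_left_mono) auto
    also have "\<dots> = 4 * ?V * (1/2) ^ k"
      by (simp add: power_divide)
    finally show ?thesis .
  qed
  have "(\<integral>\<^sup>+x\<in>cball (0::'a) 1. ennreal (1 / (norm x)\<^sup>2) \<partial>lborel) \<le> (\<integral>\<^sup>+x. (\<Sum>k. ?g k x) \<partial>lborel)"
    by (intro nn_integral_mono le)
  also have "\<dots> = (\<Sum>k. \<integral>\<^sup>+x. ?g k x \<partial>lborel)"
    by (intro nn_integral_suminf borel_measurable_times_ennreal borel_measurable_indicator) auto
  also have "\<dots> = (\<Sum>k. ennreal (4 ^ Suc k * (?V * ((1/2) ^ k) ^ DIM('a))))"
    by (intro suminf_cong) (simp add: nn_integral_cmult_indicator emeasure_cball ennreal_mult del: power_Suc)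
  also have "\<dots> \<le> (\<Sum>k. ennreal (4 * ?V * (1/2) ^ k))"
    by (intro suminf_le ennreal_leI half) auto
  also have "\<dots> = ennreal (\<Sum>k. 4 * ?V * (1/2) ^ k)"
    by (intro suminf_ennreal2 summable_mult summable_geometric) auto
  finally show ?thesis
    by (auto simp: le_less_trans)
qed

section \<open>The spectral gap \<open>1 - |A|\<close> and the integrability of
  \<open>|A| / (1 - |A|)\<close>\<close>

text \<open>Write \<open>1 - cos x\<close> as \<open>2 * (sin (x / 2))\<^sup>2\<close> and use the
  cubic Taylor bound \<open>sin y \<ge> y - y ^ 3 / 6 \<ge> 5 * y / 6\<close> on the unit interval.
  This gives the factor 25/72, rounded down to 1/4.\<close>

lemma one_minus_cos_ge:
  assumes "\<bar>x\<bar> \<le> (1::real)"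
  shows "x\<^sup>2 / 4 \<le> 1 - cos x"
proof -
  have "cos x = 1 - 2 * (sin (x / 2))\<^sup>2"
    using cos_double_sin[of "x / 2"] by simp
  moreover have "\<bar>x / 2\<bar> * (5/6) \<le> \<bar>sin (x / 2)\<bar>"
  proof -
    have *: "y * (5/6) \<le> sin y" if "0 \<le> y" "y \<le> 1" for y :: real
    proof -
      have "\<bar>sin y - (\<Sum>i<3. sin_coeff i * y ^ i)\<bar> \<le> inverse (fact 3) * \<bar>y\<bar> ^ 3"
        by (rule Maclaurin_sin_bound)
      then have "\<bar>sin y - y\<bar> \<le> y ^ 3 / 6"
        using that by (simp add: numeral_eq_Suc sin_coeff_def field_simps)
      moreover have "y ^ 3 \<le> y"
        using power_decreasing[of 1 3 y] that by simp
      ultimately show ?thesis by linarith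
    qed
    have "\<bar>sin (x / 2)\<bar> = \<bar>sin \<bar>x / 2\<bar>\<bar>"
      by (cases "x \<ge> 0") auto
    then show ?thesis
      using *[of "\<bar>x / 2\<bar>"] assms by simp
  qed
  then have *: "(\<bar>x / 2\<bar> * (5/6))\<^sup>2 \<le> \<bar>sin (x / 2)\<bar>\<^sup>2"
    by (intro power_mono) auto
  moreover from * have "x\<^sup>2 * (25/144) \<le> (sin (x / 2))\<^sup>2"
    by (simp add: power_mult_distrib power_divide)
  ultimately show ?thesis
    using zero_le_power2[of "sin (x / 2)"] by linarith
qed


text \<open>The real part of the Fourier transform; for symmetric \<open>a\<close> it is the whole
  of it.\<close>

definition cos_transform :: "('a::euclidean_space \<Rightarrow> real) \<Rightarrow> 'a \<Rightarrow> real" where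
  "cos_transform a \<xi> = (LBINT y. a y * cos (\<xi> \<bullet> y))"

lemma borel_measurable_cos_transform [measurable]:
  assumes [measurable]: "a \<in> borel_measurable borel"
  shows "cos_transform a \<in> borel_measurable borel"
  unfolding cos_transform_def[abs_def] by measurable

text \<open>The lower bound is obtained on a ball where \<open>a\<close> is bounded below, by pairing \<open>y\<close> with
  \<open>y + v\<close>, where \<open>\<xi> \<bullet> v = \<beta>\<close> is small: the cosines of \<open>\<theta>\<close> and \<open>\<theta> + \<beta>\<close> cannot both be
  close to \<open>1\<close>, nor both close to \<open>-1\<close>.\<close>

lemma one_minus_abs_cos_transform_ge:
  fixes a :: "'a::euclidean_space \<Rightarrow> real"
  assumes nn: "\<And>x. 0 \<le> a x" and cont: "continuous_on UNIV a"
    and one: "has_bochner_integral lborel a 1"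
  obtains c where "0 < c" "\<And>\<xi>. c * min 1 ((norm \<xi>)\<^sup>2) \<le> 1 - \<bar>cos_transform a \<xi>\<bar>"
proof -
  have inta: "integrable lborel a" and a1: "(LBINT y. a y) = 1"
    using one by (auto simp: has_bochner_integral_iff)
  have "\<exists>y. a y \<noteq> 0"
  proof (rule ccontr)
    assume "\<not> ?thesis"
    then have "a = (\<lambda>_. 0)" by auto
    then show False using a1 by simp
  qed
  then obtain y0 where y0: "a y0 > 0"
    using nn by (metis less_eq_real_def)
  have "isCont a y0"
    using cont by (simp add: continuous_on_eq_continuous_at)
  then obtain r where r: "r > 0" "\<And>y. dist y y0 < r \<Longrightarrow> dist (a y) (a y0) < a y0 / 2"
    using y0 unfolding continuous_at_eps_delta by (metis half_gt_zero)
  define \<eta> where "\<eta> = a y0 / 2"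
  have \<eta>: "\<eta> > 0" "\<And>y. y \<in> ball y0 r \<Longrightarrow> \<eta> \<le> a y"
    using y0 r(2) unfolding \<eta>_def by (auto simp: dist_real_def dist_commute abs_less_iff) (smt (verit) field_sum_of_halves)
  define V where "V = measure lborel (ball y0 (r / 2))"
  have V: "V > 0"
    unfolding V_def using r by (simp add: content_ball)
  \<comment> \<open>The factors are the lower bound \<open>\<eta>\<close> of \<open>a\<close> on the
    ball, the volume \<open>V\<close> of the half-radius ball over which the pairing is averaged,
    and 1/16 from \<open>one_minus_cos_ge\<close> at \<open>\<beta> / 2\<close>. The minimum
    compares \<open>\<beta>\<^sup>2\<close> with \<open>(norm \<xi>)\<^sup>2\<close>.\<close>
  define c where "c = \<eta> * V * min 1 (r\<^sup>2 / 4) / 16"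
  have c: "c > 0"
    unfolding c_def using \<eta> V r by simp
  \<comment> \<open>The two signs \<open>s\<close> together yield the bound for the absolute
    value.\<close>
  have main: "c * min 1 ((norm \<xi>)\<^sup>2) \<le> 1 - s * cos_transform a \<xi>"
    if s: "s = 1 \<or> s = -1" and \<xi>: "\<xi> \<noteq> 0" for s \<xi>
  proof -
    \<comment> \<open>The cap 1 keeps \<open>\<beta> / 2\<close> in the range of the quadratic
      cosine bound. The cap \<open>r * norm \<xi> / 2\<close> gives \<open>v\<close> length at most
      \<open>r / 2\<close>, so that the translate of the half-radius ball by \<open>v\<close> stays
      inside the ball of radius \<open>r\<close>.\<close>
    define \<beta> where "\<beta> = min 1 (r * norm \<xi> / 2)"
    define v where "v = (\<beta> / (norm \<xi>)\<^sup>2) *\<^sub>R \<xi>"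
    define g where "g y = 1 - s * cos (\<xi> \<bullet> y)" for y
    have \<beta>: "0 < \<beta>" "\<beta> \<le> 1" "\<beta> \<le> r * norm \<xi> / 2"
      unfolding \<beta>_def using r \<xi> by auto
    have xv: "\<xi> \<bullet> v = \<beta>"
      using \<xi> by (simp add: v_def power2_norm_eq_inner)
    have "norm v = \<beta> / norm \<xi>"
      using \<beta> \<xi> by (simp add: v_def power2_eq_square)
    then have nv: "norm v \<le> r / 2"
      using \<beta>(3) \<xi> by (simp add: divide_le_eq)
    have g0: "0 \<le> g y" "g y \<le> 2" for y
      using s cos_le_one[of "\<xi> \<bullet> y"] cos_ge_minus_one[of "\<xi> \<bullet> y"] by (auto simp: g_def)
    have gm [measurable]: "g \<in> borel_measurable borel"
      unfolding g_def[abs_def] by measurable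
    have pair: "2 * (1 - cos (\<beta> / 2)) \<le> g y + g (y + v)" for y
    proof -
      define \<theta> where "\<theta> = \<xi> \<bullet> y"
      have sum: "cos \<theta> + cos (\<theta> + \<beta>) = 2 * cos (\<theta> + \<beta> / 2) * cos (\<beta> / 2)"
        using cos_plus_cos[of "\<theta> + \<beta>" \<theta>] by (simp add: add_divide_distrib algebra_simps)
      have cb: "0 \<le> cos (\<beta> / 2)"
        using \<beta> pi_gt3 by (intro cos_ge_zero) auto
      have "s * cos (\<theta> + \<beta> / 2) \<le> 1"
        using s cos_le_one[of "\<theta> + \<beta> / 2"] cos_ge_minus_one[of "\<theta> + \<beta> / 2"] by auto
      then have "(s * cos (\<theta> + \<beta> / 2)) * cos (\<beta> / 2) \<le> 1 * cos (\<beta> / 2)"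
        using cb by (rule mult_right_mono)
      moreover have "g y + g (y + v) = 2 - s * (cos \<theta> + cos (\<theta> + \<beta>))"
        by (simp add: g_def \<theta>_def inner_add_right xv algebra_simps)
      ultimately show ?thesis
        unfolding sum by (simp add: algebra_simps)
    qed
    let ?B = "ball y0 r" and ?b = "ball y0 (r / 2)"
    have intI: "integrable lborel (\<lambda>y. indicator A y * g (y + w))"
      if "A \<in> sets borel" "emeasure lborel A < \<infinity>" for A and w :: 'a
    proof (rule Bochner_Integration.integrable_bound)
      show "integrable lborel (\<lambda>y. 2 * indicator A y :: real)"
        using that by (intro integrable_mult_right integrable_real_indicator) auto
      show "(\<lambda>y. indicator A y * g (y + w)) \<in> borel_measurable lborel"
        using that by measurable
    qed (use g0 in \<open>auto simp: indicator_def\<close>)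
    have intB: "integrable lborel (\<lambda>y. indicator ?B y * g y)"
      using intI[of ?B 0] r by (simp add: emeasure_ball)
    have intb: "integrable lborel (\<lambda>y. indicator ?b y * g (y + w))" for w
      using intI[of ?b w] r by (simp add: emeasure_ball)
    define I where "I = (LBINT y. indicator ?B y * g y)"
    have intBv: "integrable lborel (\<lambda>y. indicator ?B (y + v) * g (y + v))"
      and Iv: "I = (LBINT y. indicator ?B (y + v) * g (y + v))"
      using has_bochner_integral_lborel_affine[OF has_bochner_integral_integrable[OF intB], of 1 v]
      by (simp_all add: I_def has_bochner_integral_iff add.commute)
    have "V * (2 * (1 - cos (\<beta> / 2))) = (LBINT y. indicator ?b y * (2 * (1 - cos (\<beta> / 2))))"
      by (simp add: V_def)
    also have "\<dots> \<le> (LBINT y. indicator ?b y * g (y + 0) + indicator ?b y * g (y + v))"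
    proof (intro integral_mono Bochner_Integration.integrable_add intb)
      show "integrable lborel (\<lambda>y. indicator ?b y * (2 * (1 - cos (\<beta> / 2))))"
        using r by (intro integrable_mult_left integrable_real_indicator) (auto simp: emeasure_ball)
      show "indicator ?b y * (2 * (1 - cos (\<beta> / 2))) \<le> indicator ?b y * g (y + 0) + indicator ?b y * g (y + v)" for y
        using pair[of y] by (simp add: indicator_def)
    qed
    also have "\<dots> = (LBINT y. indicator ?b y * g (y + 0)) + (LBINT y. indicator ?b y * g (y + v))"
      by (intro Bochner_Integration.integral_add intb)
    also have "\<dots> \<le> I + I"
    proof (rule add_mono)
      show "(LBINT y. indicator ?b y * g (y + 0)) \<le> I"
        unfolding I_def using intb[of 0] intB g0 r by (intro integral_mono) (auto simp: indicator_def)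
      have "y + v \<in> ?B" if "y \<in> ?b" for y
        using that nv norm_triangle_ineq4[of "y0 - y" v]
        by (simp add: dist_norm diff_diff_eq)
      then show "(LBINT y. indicator ?b y * g (y + v)) \<le> I"
        unfolding Iv using intb[of v] intBv g0 by (intro integral_mono) (auto simp: indicator_def)
    qed
    finally have VI: "V * (1 - cos (\<beta> / 2)) \<le> I"
      by (simp add: algebra_simps)
    have inta_cos: "integrable lborel (\<lambda>y. a y * cos (\<xi> \<bullet> y))"
      using inta by (rule Bochner_Integration.integrable_bound)
        (use inta in \<open>auto simp: abs_mult mult_left_le\<close>)
    have "\<eta> * I = (LBINT y. \<eta> * (indicator ?B y * g y))"
      by (simp add: I_def)
    also have "\<dots> \<le> (LBINT y. a y - s * (a y * cos (\<xi> \<bullet> y)))"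
    proof (intro integral_mono integrable_mult_right intB Bochner_Integration.integrable_diff inta inta_cos)
      fix y show "\<eta> * (indicator ?B y * g y) \<le> a y - s * (a y * cos (\<xi> \<bullet> y))"
      proof -
        have "\<eta> * indicator ?B y \<le> a y"
          using \<eta> nn by (auto simp: indicator_def)
        then have "(\<eta> * indicator ?B y) * g y \<le> a y * g y"
          using g0 by (intro mult_right_mono) auto
        then show ?thesis
          by (simp add: g_def algebra_simps)
      qed
    qed
    also have "\<dots> = 1 - s * cos_transform a \<xi>"
      using inta inta_cos a1 by (simp add: cos_transform_def)
    finally have 1: "\<eta> * I \<le> 1 - s * cos_transform a \<xi>" .
    have "min 1 (r\<^sup>2 / 4) * min 1 ((norm \<xi>)\<^sup>2) \<le> \<beta>\<^sup>2"
    proof (cases "r * norm \<xi> / 2 \<le> 1")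
      case True
      then have "\<beta>\<^sup>2 = (r\<^sup>2 / 4) * (norm \<xi>)\<^sup>2"
        by (simp add: \<beta>_def power_mult_distrib power_divide)
      then show ?thesis
        using r by (simp only:) (intro mult_mono; simp)
    next
      case False
      then have "\<beta> = 1" by (simp add: \<beta>_def)
      then show ?thesis
        using r by (simp add: mult_le_one)
    qed
    then have "c * min 1 ((norm \<xi>)\<^sup>2) \<le> \<eta> * V * (\<beta>\<^sup>2 / 16)"
      using \<eta> V by (simp add: c_def)
    also have "\<dots> \<le> \<eta> * V * (1 - cos (\<beta> / 2))"
      using one_minus_cos_ge[of "\<beta> / 2"] \<beta> \<eta> V by (intro mult_left_mono) (auto simp: power_divide)
    also have "\<dots> \<le> \<eta> * I"
      using VI \<eta> by simp
    finally show ?thesis using 1 by simp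
  qed
  have "c * min 1 ((norm \<xi>)\<^sup>2) \<le> 1 - \<bar>cos_transform a \<xi>\<bar>" for \<xi>
  proof (cases "\<xi> = 0")
    case True
    then show ?thesis by (simp add: cos_transform_def a1)
  next
    case False
    then show ?thesis
      using main[of 1 \<xi>] main[of "-1" \<xi>] by (auto simp: abs_if)
  qed
  with c that show thesis by blast
qed

text \<open>Inside the unit ball the gap is at least \<open>c * (norm \<xi>)\<^sup>2\<close>, and
  the inverse square is integrable there in dimension at least 3. Outside, the gap is at least
  \<open>c\<close> and the numerator is integrable.\<close>

lemma nn_integral_abs_cos_transform:
  fixes a :: "'a::euclidean_space \<Rightarrow> real"
  assumes dim: "DIM('a) \<ge> 3"
    and nn: "\<And>x. 0 \<le> a x" and cont: "continuous_on UNIV a"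
    and one: "has_bochner_integral lborel a 1"
    and int: "integrable lborel (cos_transform a)"
  shows "(\<integral>\<^sup>+\<xi>. ennreal (\<bar>cos_transform a \<xi>\<bar> / (1 - \<bar>cos_transform a \<xi>\<bar>)) \<partial>lborel) < \<infinity>"
proof -
  obtain c where c: "0 < c" "\<And>\<xi>. c * min 1 ((norm \<xi>)\<^sup>2) \<le> 1 - \<bar>cos_transform a \<xi>\<bar>"
    using one_minus_abs_cos_transform_ge[OF nn cont one] by blast
  have [measurable]: "a \<in> borel_measurable borel"
    using cont by (rule borel_measurable_continuous_onI)
  have le: "ennreal (\<bar>cos_transform a \<xi>\<bar> / (1 - \<bar>cos_transform a \<xi>\<bar>)) \<le>
      ennreal (1 / c) * (ennreal \<bar>cos_transform a \<xi>\<bar> + ennreal (1 / (norm \<xi>)\<^sup>2) * indicator (cball 0 1) \<xi>)"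
    (is "_ \<le> ?R \<xi>") for \<xi>
  proof -
    let ?A = "\<bar>cos_transform a \<xi>\<bar>"
    show ?thesis
    proof (cases "\<xi> = 0")
      case True
      \<comment> \<open>At the origin the quotient is \<open>1 / 0\<close>, which has the value
        0.\<close>
      then have "?A = 1"
        using one by (simp add: cos_transform_def has_bochner_integral_iff)
      then show ?thesis by simp
    next
      case False
      show ?thesis
      proof (cases "norm \<xi> \<le> 1")
        case True
        then have m: "min 1 ((norm \<xi>)\<^sup>2) = (norm \<xi>)\<^sup>2"
          by (simp add: power_le_one)
        then have A: "c * (norm \<xi>)\<^sup>2 \<le> 1 - ?A"
          using c(2)[of \<xi>] by simp
        moreover have p: "0 < c * (norm \<xi>)\<^sup>2"
          using c False by simp
        ultimately have "?A / (1 - ?A) \<le> 1 / (c * (norm \<xi>)\<^sup>2)"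
          by (intro frac_le) auto
        also have "\<dots> \<le> (1 / c) * (?A + 1 / (norm \<xi>)\<^sup>2)"
          using c by (simp add: field_simps)
        finally have "ennreal (?A / (1 - ?A)) \<le> ennreal ((1 / c) * (?A + 1 / (norm \<xi>)\<^sup>2))"
          by (rule ennreal_leI)
        also have "\<dots> = ?R \<xi>"
          using True c by (subst ennreal_mult) (auto simp: indicator_def intro!: arg_cong2[where f="(*)"] ennreal_plus)
        finally show ?thesis .
      next
        case False
        then have m: "min 1 ((norm \<xi>)\<^sup>2) = 1"
          by (simp add: min_def)
        then have "c \<le> 1 - ?A"
          using c(2)[of \<xi>] by simp
        then have "?A / (1 - ?A) \<le> ?A / c"
          using c by (intro divide_left_mono) auto
        then have "ennreal (?A / (1 - ?A)) \<le> ennreal ((1 / c) * ?A)"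
          by (intro ennreal_leI) simp
        also have "\<dots> = ?R \<xi>"
          using False c by (subst ennreal_mult) auto
        finally show ?thesis .
      qed
    qed
  qed
  have m: "(\<lambda>\<xi>::'a. ennreal (1 / (norm \<xi>)\<^sup>2) * indicator (cball 0 1) \<xi>) \<in> borel_measurable borel"
    by (intro borel_measurable_times_ennreal borel_measurable_indicator) auto
  have "(\<integral>\<^sup>+\<xi>. ennreal (\<bar>cos_transform a \<xi>\<bar> / (1 - \<bar>cos_transform a \<xi>\<bar>)) \<partial>lborel)
      \<le> (\<integral>\<^sup>+\<xi>. ?R \<xi> \<partial>lborel)"
    by (intro nn_integral_mono le)
  also have "\<dots> = ennreal (1 / c) * ((\<integral>\<^sup>+\<xi>. ennreal \<bar>cos_transform a \<xi>\<bar> \<partial>lborel) +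
      (\<integral>\<^sup>+\<xi>\<in>cball (0::'a) 1. ennreal (1 / (norm \<xi>)\<^sup>2) \<partial>lborel))"
    using m by (simp add: nn_integral_cmult nn_integral_add)
  also have "\<dots> < \<infinity>"
    using nn_integral_inverse_norm_square[OF dim] int
    by (auto simp: integrable_iff_bounded ennreal_mult_less_top)
  finally show ?thesis .
qed

text \<open>Up to the factor \<open>(2 * pi) ^ DIM('a)\<close>, this dominates the density of the
  law of \<open>X_t\<close> without its atom: that part has Fourier transform
  \<open>exp (- t) * (exp (t * A) - 1)\<close> up to a phase. With values in \<open>ennreal\<close>,
  finiteness matters only after integration in \<open>t\<close>.\<close>

definition spectral_mass :: "('a::euclidean_space \<Rightarrow> real) \<Rightarrow> real \<Rightarrow> ennreal" where
  "spectral_mass a t = (\<integral>\<^sup>+\<xi>. ennreal (exp (- t) * (exp (t * \<bar>cos_transform a \<xi>\<bar>) - 1)) \<partial>lborel)"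

text \<open>By Tonelli the time integral can be taken first. With \<open>b = |A(\<xi>)| < 1\<close>
  the integrand is \<open>exp (- (1 - b) * t) - exp (- t)\<close>, and its integral is
  \<open>1 / (1 - b) - 1 = b / (1 - b)\<close>. The point \<open>\<xi> = 0\<close>, where
  \<open>b = 1\<close>, is Lebesgue null.\<close>

lemma nn_integral_spectral_mass:
  fixes a :: "'a::euclidean_space \<Rightarrow> real"
  assumes dim: "DIM('a) \<ge> 3"
    and nn: "\<And>x. 0 \<le> a x" and cont: "continuous_on UNIV a"
    and one: "has_bochner_integral lborel a 1"
    and int: "integrable lborel (cos_transform a)"
  shows "(\<integral>\<^sup>+t\<in>{0..}. spectral_mass a t \<partial>lborel) < \<infinity>"
proof -
  obtain c where c: "0 < c" "\<And>\<xi>. c * min 1 ((norm \<xi>)\<^sup>2) \<le> 1 - \<bar>cos_transform a \<xi>\<bar>"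
    using one_minus_abs_cos_transform_ge[OF nn cont one] by blast
  have [measurable]: "a \<in> borel_measurable borel"
    using cont by (rule borel_measurable_continuous_onI)
  let ?h = "\<lambda>t \<xi>. ennreal (exp (- t) * (exp (t * \<bar>cos_transform a \<xi>\<bar>) - 1)) * indicator {0..} t"
  have inner: "(\<integral>\<^sup>+t. ?h t \<xi> \<partial>lborel) = ennreal (\<bar>cos_transform a \<xi>\<bar> / (1 - \<bar>cos_transform a \<xi>\<bar>))"
    if "\<xi> \<noteq> 0" for \<xi>
  proof -
    define b where "b = \<bar>cos_transform a \<xi>\<bar>"
    have "0 < c * min 1 ((norm \<xi>)\<^sup>2)"
      using c that by simp
    then have b: "0 \<le> b" "b < 1"
      using c(2)[of \<xi>] by (auto simp: b_def)
    have deriv: "DERIV (\<lambda>t. exp (- t) - exp (- (d * t)) / d) t :> exp (- (d * t)) - exp (- t)"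
      if "d \<noteq> 0" for d t :: real
      using that by (auto intro!: derivative_eq_intros)
    let ?F = "\<lambda>t. exp (- t) - exp (- ((1 - b) * t)) / (1 - b)"
    have "(\<integral>\<^sup>+t. ennreal (exp (- t) * (exp (t * b) - 1)) * indicator {0..} t \<partial>lborel) = ennreal (0 - ?F 0)"
    proof (rule nn_integral_FTC_atLeast)
      show "DERIV ?F t :> exp (- t) * (exp (t * b) - 1)" if "0 \<le> t" for t
      proof -
        have "exp (- t) * exp (t * b) = exp (- ((1 - b) * t))"
          by (simp add: algebra_simps flip: exp_add)
        then show ?thesis
          using deriv[of "1 - b" t] b by (simp add: right_diff_distrib)
      qed
      show "0 \<le> exp (- t) * (exp (t * b) - 1)" if "0 \<le> t" for t
        using b that by simp
      have "((\<lambda>t. exp (- ((1 - b) * t))) \<longlongrightarrow> 0) at_top"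
        using b by (intro filterlim_compose[OF exp_at_bot] filterlim_compose[OF filterlim_uminus_at_bot_at_top]
          filterlim_tendsto_pos_mult_at_top[OF tendsto_const _ filterlim_ident]) auto
      moreover have "((\<lambda>t::real. exp (- t)) \<longlongrightarrow> 0) at_top"
        by (intro filterlim_compose[OF exp_at_bot] filterlim_uminus_at_bot_at_top)
      ultimately have "(?F \<longlongrightarrow> 0 - 0 / (1 - b)) at_top"
        using b by (intro tendsto_intros) auto
      then show "(?F \<longlongrightarrow> 0) at_top" by simp
    qed measurable
    also have "0 - ?F 0 = b / (1 - b)"
      using b by (simp add: field_simps)
    finally show ?thesis by (simp add: b_def)
  qed
  have "(\<integral>\<^sup>+t\<in>{0..}. spectral_mass a t \<partial>lborel) = (\<integral>\<^sup>+t. \<integral>\<^sup>+\<xi>. ?h t \<xi> \<partial>lborel \<partial>lborel)"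
    unfolding spectral_mass_def by (intro nn_integral_cong nn_integral_multc[symmetric]) measurable
  also have "\<dots> = (\<integral>\<^sup>+\<xi>. \<integral>\<^sup>+t. ?h t \<xi> \<partial>lborel \<partial>lborel)"
    by (rule lborel_pair.Fubini') measurable
  also have "\<dots> = (\<integral>\<^sup>+\<xi>. ennreal (\<bar>cos_transform a \<xi>\<bar> / (1 - \<bar>cos_transform a \<xi>\<bar>)) \<partial>lborel)"
    using AE_lborel_singleton[of "0::'a"] by (intro nn_integral_cong_AE, eventually_elim) (rule inner)
  also have "\<dots> < \<infinity>"
    by (rule nn_integral_abs_cos_transform[OF assms])
  finally show ?thesis .
qed

section \<open>Gaussian mollification of the law of the process\<close>

text \<open>The density of the centred normal law with covariance \<open>e\<^sup>2\<close> times the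
  identity.\<close>

definition gauss_kernel :: "real \<Rightarrow> 'a::euclidean_space \<Rightarrow> real" where
  "gauss_kernel e z = exp (- (norm (z /\<^sub>R e))\<^sup>2 / 2) / (sqrt (2 * pi) ^ DIM('a) * e ^ DIM('a))"

lemma gauss_kernel_nonneg: "0 < e \<Longrightarrow> 0 \<le> gauss_kernel e z"
  by (simp add: gauss_kernel_def)

lemma borel_measurable_gauss_kernel [measurable]: "gauss_kernel e \<in> borel_measurable borel"
  unfolding gauss_kernel_def[abs_def] by measurable

lemma gauss_kernel_eq_integral:
  fixes z :: "'a::euclidean_space"
  assumes "0 < e"
  shows "has_bochner_integral lborel (\<lambda>\<xi>. cos (\<xi> \<bullet> z) * exp (- (norm (e *\<^sub>R \<xi>))\<^sup>2 / 2))
     ((2 * pi) ^ DIM('a) * gauss_kernel e z)"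
proof -
  have "(2 * pi) ^ DIM('a) = (sqrt (2 * pi) * sqrt (2 * pi)) ^ DIM('a)"
    by simp
  also have "\<dots> = sqrt (2 * pi) ^ DIM('a) * sqrt (2 * pi) ^ DIM('a)"
    by (rule power_mult_distrib)
  finally have sq: "(2 * pi) ^ DIM('a) = sqrt (2 * pi) ^ DIM('a) * sqrt (2 * pi) ^ DIM('a)" .
  have "(2 * pi) ^ DIM('a) * gauss_kernel e z =
      sqrt (2 * pi) ^ DIM('a) / e ^ DIM('a) * exp (- (norm (z /\<^sub>R e))\<^sup>2 / 2)"
    unfolding sq gauss_kernel_def by (simp del: real_sqrt_mult power_mult_distrib)
  then show ?thesis
    using fourier_gaussian_scaled[OF assms, of z] by simp
qed

lemma nn_integral_gauss_kernel:
  "(\<integral>\<^sup>+w. ennreal (gauss_kernel 1 (w::'a::euclidean_space)) \<partial>lborel) = 1"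
proof -
  have "has_bochner_integral lborel (\<lambda>\<xi>::'a. 1 / sqrt (2 * pi) ^ DIM('a) * (cos (\<xi> \<bullet> 0) * exp (- (norm \<xi>)\<^sup>2 / 2)))
     (1 / sqrt (2 * pi) ^ DIM('a) * (sqrt (2 * pi) ^ DIM('a) * exp (- (norm (0::'a))\<^sup>2 / 2)))"
    by (intro has_bochner_integral_mult_right fourier_gaussian)
  then have "has_bochner_integral lborel (gauss_kernel 1 :: 'a \<Rightarrow> real) 1"
    by (simp add: gauss_kernel_def[abs_def])
  then show ?thesis
    using nn_integral_eq_integral[of lborel "gauss_kernel 1 :: 'a \<Rightarrow> real"]
    by (simp add: has_bochner_integral_iff gauss_kernel_nonneg)
qed

text \<open>The substitution \<open>y = z + e *\<^sub>R w\<close> moves the width from the kernel to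
  the argument of \<open>f\<close>, so that letting \<open>e\<close> tend to 0 becomes a matter of
  the continuity of \<open>f\<close>.\<close>

lemma nn_integral_gauss_kernel_shift:
  fixes f :: "'a::euclidean_space \<Rightarrow> ennreal"
  assumes e: "0 < e" and [measurable]: "f \<in> borel_measurable borel"
  shows "(\<integral>\<^sup>+y. ennreal (gauss_kernel e (z - y)) * f y \<partial>lborel) =
         (\<integral>\<^sup>+w. ennreal (gauss_kernel 1 w) * f (z + e *\<^sub>R w) \<partial>lborel)"
proof -
  have "lborel = density (distr lborel borel (\<lambda>x::'a. z + e *\<^sub>R x)) (\<lambda>_. ennreal (\<bar>e\<bar> ^ DIM('a)))"
    using e by (intro lborel_affine) auto
  then have lb: "lborel = density (distr lborel borel (\<lambda>x::'a. z + e *\<^sub>R x)) (\<lambda>_. ennreal (e ^ DIM('a)))"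
    using e by simp
  have "(\<integral>\<^sup>+y. ennreal (gauss_kernel e (z - y)) * f y \<partial>lborel) =
      (\<integral>\<^sup>+y. ennreal (gauss_kernel e (z - y)) * f y \<partial>density (distr lborel borel (\<lambda>x::'a. z + e *\<^sub>R x)) (\<lambda>_. ennreal (e ^ DIM('a))))"
    using lb by simp
  also have "\<dots> = (\<integral>\<^sup>+w. ennreal (e ^ DIM('a)) * (ennreal (gauss_kernel e (- (e *\<^sub>R w))) * f (z + e *\<^sub>R w)) \<partial>lborel)"
    by (simp add: nn_integral_density nn_integral_distr)
  also have "\<dots> = (\<integral>\<^sup>+w. ennreal (gauss_kernel 1 w) * f (z + e *\<^sub>R w) \<partial>lborel)"
  proof (intro nn_integral_cong)
    fix w :: 'a
    have "e ^ DIM('a) * gauss_kernel e (- (e *\<^sub>R w)) = gauss_kernel 1 w"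
      using e by (simp add: gauss_kernel_def)
    then have "ennreal (e ^ DIM('a)) * ennreal (gauss_kernel e (- (e *\<^sub>R w))) = ennreal (gauss_kernel 1 w)"
      using e by (simp add: gauss_kernel_nonneg flip: ennreal_mult)
    then show "ennreal (e ^ DIM('a)) * (ennreal (gauss_kernel e (- (e *\<^sub>R w))) * f (z + e *\<^sub>R w)) =
        ennreal (gauss_kernel 1 w) * f (z + e *\<^sub>R w)"
      by (simp add: mult.assoc[symmetric])
  qed
  finally show ?thesis .
qed

text \<open>A mollified density bound by Fourier inversion.  The part \<open>e^{-t}\<close> of the characteristic
  function, which is not integrable, belongs to the atom of the law at the starting point.\<close>

lemma gauss_kernel_expectation_le:
  fixes a :: "'a::euclidean_space \<Rightarrow> real"
  assumes P: "prob_space P" "sets P = sets borel" and e: "0 < e" and t: "0 \<le> t"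
    and [measurable]: "a \<in> borel_measurable borel"
    and char: "\<And>\<xi> y. (\<integral>z. cos (\<xi> \<bullet> (z - y)) \<partial>P) = exp (- t * (1 - cos_transform a \<xi>)) * cos (\<xi> \<bullet> (x - y))"
  shows "(\<integral>\<^sup>+z. ennreal (gauss_kernel e (z - y)) \<partial>P) \<le>
    ennreal (exp (- t)) * ennreal (gauss_kernel e (x - y)) + ennreal (1 / (2 * pi) ^ DIM('a)) * spectral_mass a t"
proof -
  interpret P: prob_space P by (rule P)
  interpret pair_sigma_finite P "lborel :: 'a measure" ..
  note [measurable_cong] = P(2)
  let ?c = "1 / (2 * pi) ^ DIM('a)"
  let ?E = "\<lambda>\<xi>::'a. exp (- (norm (e *\<^sub>R \<xi>))\<^sup>2 / 2)"
  have intE: "integrable lborel ?E"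
    using gauss_kernel_eq_integral[OF e, of "0::'a"] by (simp add: has_bochner_integral_iff)
  have repr: "gauss_kernel e z = ?c * (\<integral>\<xi>. cos (\<xi> \<bullet> z) * ?E \<xi> \<partial>lborel)" for z :: 'a
    using gauss_kernel_eq_integral[OF e, of z] by (simp add: has_bochner_integral_iff)
  have int_cosE: "integrable lborel (\<lambda>\<xi>. cos (\<xi> \<bullet> z) * ?E \<xi>)" for z :: 'a
    using gauss_kernel_eq_integral[OF e, of z] by (simp add: has_bochner_integral_iff)
  have int_pair: "integrable (P \<Otimes>\<^sub>M lborel) (\<lambda>(z, \<xi>). cos (\<xi> \<bullet> (z - y)) * ?E \<xi>)"
  proof (rule Bochner_Integration.integrable_bound)
    show "integrable (P \<Otimes>\<^sub>M lborel) (\<lambda>p. 1 * ?E (snd p))"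
    proof (rule Fubini_integrable)
      show "integrable P (\<lambda>x. LINT y|lborel. norm (1 * ?E (snd (x, y))))" by simp
      show "AE x in P. integrable lborel (\<lambda>y. 1 * ?E (snd (x, y)))" using intE by simp
    qed measurable
    show "AE p in P \<Otimes>\<^sub>M lborel. norm (case p of (z, \<xi>) \<Rightarrow> cos (\<xi> \<bullet> (z - y)) * ?E \<xi>) \<le> norm (1 * ?E (snd p))"
      by (auto simp: abs_mult mult_left_le_one_le)
  qed measurable
  have gk_le: "gauss_kernel e z \<le> gauss_kernel e (0::'a)" for z :: 'a
    using e by (simp add: gauss_kernel_def divide_right_mono)
  have int_gk: "integrable P (\<lambda>z. gauss_kernel e (z - y))"
    by (rule P.integrable_const_bound[of _ "gauss_kernel e (0::'a)"])
       (auto simp: gk_le gauss_kernel_nonneg[OF e])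
  have "(\<integral>z. gauss_kernel e (z - y) \<partial>P) = ?c * (\<integral>z. \<integral>\<xi>. cos (\<xi> \<bullet> (z - y)) * ?E \<xi> \<partial>lborel \<partial>P)"
    unfolding repr by simp
  also have "(\<integral>z. \<integral>\<xi>. cos (\<xi> \<bullet> (z - y)) * ?E \<xi> \<partial>lborel \<partial>P) = (\<integral>\<xi>. \<integral>z. cos (\<xi> \<bullet> (z - y)) * ?E \<xi> \<partial>P \<partial>lborel)"
    using int_pair by (rule Fubini_integral[symmetric])
  also have "\<dots> = (\<integral>\<xi>. exp (- t * (1 - cos_transform a \<xi>)) * cos (\<xi> \<bullet> (x - y)) * ?E \<xi> \<partial>lborel)"
    by (simp add: char)
  finally have 1: "(\<integral>z. gauss_kernel e (z - y) \<partial>P) =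
      ?c * (\<integral>\<xi>. exp (- t * (1 - cos_transform a \<xi>)) * cos (\<xi> \<bullet> (x - y)) * ?E \<xi> \<partial>lborel)" .
  have int_full: "integrable lborel (\<lambda>\<xi>. exp (- t * (1 - cos_transform a \<xi>)) * cos (\<xi> \<bullet> (x - y)) * ?E \<xi>)"
    using integrable_snd[OF int_pair] by (simp add: char)
  \<comment> \<open>This is the inversion integrand with the constant \<open>exp (- t)\<close>
    subtracted from the characteristic function. The subtracted part inverts to
    \<open>exp (- t) * gauss_kernel e (x - y)\<close>, the mollified atom.\<close>
  define D where "D \<xi> = (exp (- t * (1 - cos_transform a \<xi>)) - exp (- t)) * cos (\<xi> \<bullet> (x - y)) * ?E \<xi>" for \<xi>
  have D_eq: "D = (\<lambda>\<xi>. exp (- t * (1 - cos_transform a \<xi>)) * cos (\<xi> \<bullet> (x - y)) * ?E \<xi> -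
      exp (- t) * (cos (\<xi> \<bullet> (x - y)) * ?E \<xi>))"
    by (simp add: D_def fun_eq_iff algebra_simps)
  have intD: "integrable lborel D"
    unfolding D_eq by (intro Bochner_Integration.integrable_diff integrable_mult_right int_full int_cosE)
  have "(\<integral>\<xi>. D \<xi> \<partial>lborel) = (\<integral>\<xi>. exp (- t * (1 - cos_transform a \<xi>)) * cos (\<xi> \<bullet> (x - y)) * ?E \<xi> \<partial>lborel)
      - exp (- t) * (\<integral>\<xi>. cos (\<xi> \<bullet> (x - y)) * ?E \<xi> \<partial>lborel)"
    unfolding D_eq
    by (subst Bochner_Integration.integral_diff[OF int_full integrable_mult_right[OF int_cosE]]) simp
  then have "(\<integral>z. gauss_kernel e (z - y) \<partial>P) = exp (- t) * gauss_kernel e (x - y) + ?c * (\<integral>\<xi>. D \<xi> \<partial>lborel)"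
    unfolding 1 repr[of "x - y"] by (simp add: field_simps)
  also have "\<dots> \<le> exp (- t) * gauss_kernel e (x - y) + ?c * norm (\<integral>\<xi>. D \<xi> \<partial>lborel)"
    by (intro add_left_mono mult_left_mono) auto
  finally have "ennreal (\<integral>z. gauss_kernel e (z - y) \<partial>P) \<le>
      ennreal (exp (- t) * gauss_kernel e (x - y) + ?c * norm (\<integral>\<xi>. D \<xi> \<partial>lborel))"
    by (rule ennreal_leI)
  also have "\<dots> = ennreal (exp (- t)) * ennreal (gauss_kernel e (x - y)) + ennreal ?c * ennreal (norm (\<integral>\<xi>. D \<xi> \<partial>lborel))"
    using gauss_kernel_nonneg[OF e, of "x - y"]
    by (subst ennreal_plus) (auto intro!: arg_cong2[where f="(+)"] ennreal_mult simp del: times_divide_eq_left)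
  also have "ennreal (norm (\<integral>\<xi>. D \<xi> \<partial>lborel)) \<le> (\<integral>\<^sup>+\<xi>. norm (D \<xi>) \<partial>lborel)"
    using intD by (rule integral_norm_bound_ennreal)
  also have "\<dots> \<le> spectral_mass a t"
    unfolding spectral_mass_def
  proof (intro nn_integral_mono ennreal_leI)
    fix \<xi>
    \<comment> \<open>The transform may be negative. For negative \<open>s\<close> the claim is
      \<open>exp s + exp (- s) \<ge> 2\<close>.\<close>
    have ineq: "\<bar>exp s - 1\<bar> \<le> exp \<bar>s\<bar> - 1" for s :: real
    proof (cases "0 \<le> s")
      case False
      have "exp s + exp (- s) \<ge> 2"
        using exp_ge_add_one_self[of s] exp_ge_add_one_self[of "- s"] by linarith
      then show ?thesis using False by simp
    qed simp
    have "\<bar>exp (- t * (1 - cos_transform a \<xi>)) - exp (- t)\<bar> = exp (- t) * \<bar>exp (t * cos_transform a \<xi>) - 1\<bar>"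
    proof -
      have "exp (- t * (1 - cos_transform a \<xi>)) = exp (- t) * exp (t * cos_transform a \<xi>)"
        unfolding exp_add[symmetric] by (rule arg_cong[where f=exp]) (simp add: algebra_simps)
      then have "exp (- t * (1 - cos_transform a \<xi>)) - exp (- t) = exp (- t) * (exp (t * cos_transform a \<xi>) - 1)"
        by (simp add: right_diff_distrib)
      then show ?thesis by (simp only: abs_mult abs_exp_cancel)
    qed
    also have "\<dots> \<le> exp (- t) * (exp (t * \<bar>cos_transform a \<xi>\<bar>) - 1)"
      using ineq[of "t * cos_transform a \<xi>"] t by (simp add: abs_mult)
    finally have m: "\<bar>exp (- t * (1 - cos_transform a \<xi>)) - exp (- t)\<bar> \<le> exp (- t) * (exp (t * \<bar>cos_transform a \<xi>\<bar>) - 1)" .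
    have "norm (D \<xi>) = \<bar>exp (- t * (1 - cos_transform a \<xi>)) - exp (- t)\<bar> * (\<bar>cos (\<xi> \<bullet> (x - y))\<bar> * ?E \<xi>)"
      by (simp add: D_def abs_mult)
    \<comment> \<open>Estimating the cosine and the Gaussian factor by 1 makes the bound independent
      of the width \<open>e\<close>, hence stable in the limit.\<close>
    also have "\<dots> \<le> \<bar>exp (- t * (1 - cos_transform a \<xi>)) - exp (- t)\<bar> * 1"
      by (intro mult_left_mono mult_le_one) auto
    finally show "norm (D \<xi>) \<le> exp (- t) * (exp (t * \<bar>cos_transform a \<xi>\<bar>) - 1)"
      using m by simp
  qed
  finally have "ennreal (\<integral>z. gauss_kernel e (z - y) \<partial>P) \<le>
      ennreal (exp (- t)) * ennreal (gauss_kernel e (x - y)) + ennreal ?c * spectral_mass a t"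
    by (simp add: add_left_mono mult_left_mono)
  then show ?thesis
    using nn_integral_eq_integral[OF int_gk AE_I2[OF gauss_kernel_nonneg[OF e]]] by simp
qed

text \<open>Integrating the mollified density bound against \<open>f\<close> controls the
  expectation of the mollified \<open>f\<close> uniformly in the width; the atom contributes at most
  \<open>B * exp (- t)\<close> because the kernel has mass 1. The width is removed by Fatou's lemma,
  once in the mollifying variable and once under \<open>P\<close>, so no density of \<open>P\<close>
  has to be exhibited.\<close>

lemma expectation_le_spectral_mass:
  fixes a f :: "'a::euclidean_space \<Rightarrow> real"
  assumes P: "prob_space P" "sets P = sets borel" and t: "0 \<le> t"
    and am: "a \<in> borel_measurable borel"
    and char: "\<And>\<xi> y. (\<integral>z. cos (\<xi> \<bullet> (z - y)) \<partial>P) = exp (- t * (1 - cos_transform a \<xi>)) * cos (\<xi> \<bullet> (x - y))"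
    and f0: "\<And>y. 0 \<le> f y" and fB: "\<And>y. f y \<le> B" and fc: "continuous_on UNIV f"
  shows "(\<integral>\<^sup>+z. ennreal (f z) \<partial>P) \<le> ennreal (B * exp (- t)) +
    ennreal (1 / (2 * pi) ^ DIM('a)) * spectral_mass a t * (\<integral>\<^sup>+y. ennreal (f y) \<partial>lborel)"
    (is "_ \<le> ?R")
proof -
  interpret P: prob_space P by (rule P)
  interpret pair_sigma_finite P "lborel :: 'a measure" ..
  note [measurable_cong] = P(2)
  have [measurable]: "f \<in> borel_measurable borel"
    using fc by (rule borel_measurable_continuous_onI)
  have B0: "0 \<le> B" using f0[of 0] fB[of 0] by linarith
  define e where "e n = 1 / real (Suc n)" for n
  have e: "0 < e n" for n by (simp add: e_def)
  have e0: "e \<longlonglongrightarrow> 0"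
    unfolding e_def[abs_def] by (rule LIMSEQ_Suc[OF lim_1_over_n])
  let ?G = "\<lambda>w::'a. ennreal (gauss_kernel 1 w)"
  have step: "(\<integral>\<^sup>+z. \<integral>\<^sup>+w. ?G w * ennreal (f (z + e n *\<^sub>R w)) \<partial>lborel \<partial>P) \<le> ?R" for n
  proof -
    have "(\<integral>\<^sup>+z. \<integral>\<^sup>+w. ?G w * ennreal (f (z + e n *\<^sub>R w)) \<partial>lborel \<partial>P) =
        (\<integral>\<^sup>+z. \<integral>\<^sup>+y. ennreal (gauss_kernel (e n) (z - y)) * ennreal (f y) \<partial>lborel \<partial>P)"
      by (subst nn_integral_gauss_kernel_shift[OF e]) auto
    also have "\<dots> = (\<integral>\<^sup>+y. \<integral>\<^sup>+z. ennreal (gauss_kernel (e n) (z - y)) * ennreal (f y) \<partial>P \<partial>lborel)"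
      by (rule Fubini'[symmetric]) measurable
    also have "\<dots> = (\<integral>\<^sup>+y. (\<integral>\<^sup>+z. ennreal (gauss_kernel (e n) (z - y)) \<partial>P) * ennreal (f y) \<partial>lborel)"
      by (intro nn_integral_cong nn_integral_multc) measurable
    also have "\<dots> \<le> (\<integral>\<^sup>+y. (ennreal (exp (- t)) * ennreal (gauss_kernel (e n) (x - y)) +
        ennreal (1 / (2 * pi) ^ DIM('a)) * spectral_mass a t) * ennreal (f y) \<partial>lborel)"
      by (intro nn_integral_mono mult_right_mono gauss_kernel_expectation_le[OF P e t am char]) auto
    also have "\<dots> = (\<integral>\<^sup>+y. ennreal (exp (- t)) * (ennreal (gauss_kernel (e n) (x - y)) * ennreal (f y)) +
        (ennreal (1 / (2 * pi) ^ DIM('a)) * spectral_mass a t) * ennreal (f y) \<partial>lborel)"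
      by (intro nn_integral_cong) (simp add: distrib_right mult.assoc)
    also have "\<dots> = ennreal (exp (- t)) * (\<integral>\<^sup>+y. ennreal (gauss_kernel (e n) (x - y)) * ennreal (f y) \<partial>lborel) +
        ennreal (1 / (2 * pi) ^ DIM('a)) * spectral_mass a t * (\<integral>\<^sup>+y. ennreal (f y) \<partial>lborel)"
      by (subst nn_integral_add) (auto simp: nn_integral_cmult)
    also have "(\<integral>\<^sup>+y. ennreal (gauss_kernel (e n) (x - y)) * ennreal (f y) \<partial>lborel) =
        (\<integral>\<^sup>+w. ?G w * ennreal (f (x + e n *\<^sub>R w)) \<partial>lborel)"
      by (rule nn_integral_gauss_kernel_shift[OF e]) measurable
    also have "\<dots> \<le> (\<integral>\<^sup>+w. ?G w * ennreal B \<partial>lborel)"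
      by (intro nn_integral_mono mult_left_mono ennreal_leI fB) auto
    also have "\<dots> = ennreal B"
      by (subst nn_integral_multc) (auto simp: nn_integral_gauss_kernel)
    finally show ?thesis
      using B0 by (simp add: ennreal_mult mult.commute[of "ennreal B"] mult_left_mono)
  qed
  have inner: "ennreal (f z) \<le> liminf (\<lambda>n. \<integral>\<^sup>+w. ?G w * ennreal (f (z + e n *\<^sub>R w)) \<partial>lborel)" for z
  proof -
    have lim: "(\<lambda>n. ?G w * ennreal (f (z + e n *\<^sub>R w))) \<longlonglongrightarrow> ?G w * ennreal (f z)" for w
    proof -
      have "(\<lambda>n. z + e n *\<^sub>R w) \<longlonglongrightarrow> z + 0 *\<^sub>R w"
        by (rule tendsto_add[OF tendsto_const tendsto_scaleR[OF e0 tendsto_const]])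
      moreover have "isCont f (z + 0 *\<^sub>R w)"
        using fc by (simp add: continuous_on_eq_continuous_at)
      ultimately have "(\<lambda>n. f (z + e n *\<^sub>R w)) \<longlonglongrightarrow> f (z + 0 *\<^sub>R w)"
        by (rule isCont_tendsto_compose[rotated])
      then have "(\<lambda>n. ennreal (gauss_kernel 1 w * f (z + e n *\<^sub>R w))) \<longlonglongrightarrow> ennreal (gauss_kernel 1 w * f z)"
        by (intro tendsto_intros) simp
      then show ?thesis
        by (simp add: ennreal_mult f0 gauss_kernel_nonneg)
    qed
    have "ennreal (f z) = (\<integral>\<^sup>+w. ?G w * ennreal (f z) \<partial>lborel)"
      by (subst nn_integral_multc) (auto simp: nn_integral_gauss_kernel)
    also have "\<dots> = (\<integral>\<^sup>+w. liminf (\<lambda>n. ?G w * ennreal (f (z + e n *\<^sub>R w))) \<partial>lborel)"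
      by (intro nn_integral_cong lim_imp_Liminf[symmetric] lim) simp
    also have "\<dots> \<le> liminf (\<lambda>n. \<integral>\<^sup>+w. ?G w * ennreal (f (z + e n *\<^sub>R w)) \<partial>lborel)"
      by (rule nn_integral_liminf) measurable
    finally show ?thesis .
  qed
  have "(\<integral>\<^sup>+z. ennreal (f z) \<partial>P) \<le> (\<integral>\<^sup>+z. liminf (\<lambda>n. \<integral>\<^sup>+w. ?G w * ennreal (f (z + e n *\<^sub>R w)) \<partial>lborel) \<partial>P)"
    by (intro nn_integral_mono inner)
  also have "\<dots> \<le> liminf (\<lambda>n. \<integral>\<^sup>+z. \<integral>\<^sup>+w. ?G w * ennreal (f (z + e n *\<^sub>R w)) \<partial>lborel \<partial>P)"
    by (rule nn_integral_liminf) measurable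
  also have "\<dots> \<le> liminf (\<lambda>n::nat. ?R)"
    by (intro Liminf_mono always_eventually allI step)
  also have "\<dots> = ?R"
    by (rule Liminf_const) simp
  finally show ?thesis .
qed

section \<open>From one-sided difference quotients to exponentials\<close>

text \<open>A generator supplies right difference quotients only, but their error is uniform in
  \<open>t\<close>. The left quotient at \<open>s\<close> over a step \<open>h\<close> is the right
  quotient at \<open>s - h\<close>, and the two derivative terms differ little because the same
  estimate makes \<open>F\<close> locally Lipschitz. So \<open>F\<close> solves
  \<open>F' = c F\<close> on the half-line, and \<open>exp (- (c * t)) * F t\<close> is
  constant.\<close>

lemma exponential_of_uniform_right_derivative:
  fixes F :: "real \<Rightarrow> real"
  assumes step: "\<And>e. 0 < e \<Longrightarrow> \<exists>d>0. \<forall>t\<ge>0. \<forall>h. 0 < h \<and> h < d \<longrightarrow> \<bar>F (t + h) - F t - h * (c * F t)\<bar> \<le> e * h"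
    and bnd: "\<And>t. \<bar>F t\<bar> \<le> B" and t: "0 \<le> t"
  shows "F t = exp (c * t) * F 0"
proof -
  have B0: "0 \<le> B" using bnd[of 0] by linarith
  have deriv: "(F has_real_derivative c * F s) (at s within {0..})" if s: "0 \<le> s" for s
    unfolding has_field_derivative_iff tendsto_iff
  proof (intro allI impI)
    fix e :: real assume e: "0 < e"
    \<comment> \<open>Here \<open>1 + \<bar>c\<bar> * B\<close> is a Lipschitz constant of
      \<open>F\<close> for small steps. Replacing \<open>F y\<close> by \<open>F s\<close> costs at
      most \<open>K * h\<^sup>2\<close>, which is below \<open>e * h / 2\<close> once
      \<open>h < e / (2 * K)\<close>; the summand 1 keeps \<open>K\<close> positive.\<close>
    define K where "K = \<bar>c\<bar> * (1 + \<bar>c\<bar> * B) + 1"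
    have K: "K > 0" unfolding K_def using B0 by (auto intro: add_nonneg_pos)
    obtain d where d: "d > 0" "\<And>t h. 0 \<le> t \<Longrightarrow> 0 < h \<Longrightarrow> h < d \<Longrightarrow> \<bar>F (t + h) - F t - h * (c * F t)\<bar> \<le> (e / 2) * h"
      using step[of "e / 2"] e by auto
    obtain d' where d': "d' > 0" "\<And>t h. 0 \<le> t \<Longrightarrow> 0 < h \<Longrightarrow> h < d' \<Longrightarrow> \<bar>F (t + h) - F t - h * (c * F t)\<bar> \<le> 1 * h"
      using step[of 1] by auto
    have lip: "\<bar>F (t + h) - F t\<bar> \<le> (1 + \<bar>c\<bar> * B) * h" if "0 \<le> t" "0 < h" "h < d'" for t h
    proof -
      have "\<bar>F (t + h) - F t\<bar> \<le> 1 * h + \<bar>h * (c * F t)\<bar>"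
        using d'(2)[OF that] by linarith
      also have "\<bar>h * (c * F t)\<bar> \<le> h * (\<bar>c\<bar> * B)"
        using that bnd[of t] by (auto simp: abs_mult intro!: mult_left_mono)
      finally show ?thesis by (simp add: algebra_simps)
    qed
    define \<delta> where "\<delta> = min (min d d') (e / (2 * K))"
    have \<delta>: "\<delta> > 0" unfolding \<delta>_def using d d' e K by simp
    have main: "\<bar>F y - F s - (y - s) * (c * F s)\<bar> < e * \<bar>y - s\<bar>" if y: "0 \<le> y" "y \<noteq> s" "\<bar>y - s\<bar> < \<delta>" for y
    proof (cases "s < y")
      case True
      have "\<bar>F (s + (y - s)) - F s - (y - s) * (c * F s)\<bar> \<le> (e / 2) * (y - s)"
        using True y s by (intro d(2)) (auto simp: \<delta>_def)
      also have "\<dots> < e * (y - s)" using True e by simp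
      finally show ?thesis using True by simp
    next
      case False
      define h where "h = s - y"
      have h: "0 < h" "h < d" "h < d'" "h < e / (2 * K)" "s = y + h"
        using False y by (auto simp: h_def \<delta>_def)
      have 1: "\<bar>F s - F y - h * (c * F y)\<bar> \<le> (e / 2) * h"
        using d(2)[of y h] h y by simp
      have "\<bar>h * (c * F y) - h * (c * F s)\<bar> = h * (\<bar>c\<bar> * \<bar>F (y + h) - F y\<bar>)"
        using h by (simp add: abs_mult abs_minus_commute flip: right_diff_distrib)
      also have "\<dots> \<le> h * (\<bar>c\<bar> * ((1 + \<bar>c\<bar> * B) * h))"
        using h lip[of y h] y by (intro mult_left_mono) auto
      also have "\<dots> \<le> h * (K * h)"
        unfolding K_def using h by (intro mult_left_mono) (auto simp: algebra_simps)
      also have "\<dots> < h * (e / 2)"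
        using h K by (intro mult_strict_left_mono) (auto simp: field_simps)
      finally have 2: "\<bar>h * (c * F y) - h * (c * F s)\<bar> < h * (e / 2)" .
      have "\<bar>F y - F s - (y - s) * (c * F s)\<bar> = \<bar>F s - F y - h * (c * F s)\<bar>"
        unfolding h_def by (simp add: algebra_simps)
      also have "\<dots> < (e / 2) * h + h * (e / 2)" using 1 2 by linarith
      also have "\<dots> = e * \<bar>y - s\<bar>" using h by (simp add: algebra_simps)
      finally show ?thesis .
    qed
    have "\<forall>y\<in>{0..}. y \<noteq> s \<and> dist y s < \<delta> \<longrightarrow> dist ((F y - F s) / (y - s)) (c * F s) < e"
    proof (intro ballI impI)
      fix y assume y: "y \<in> {0..}" "y \<noteq> s \<and> dist y s < \<delta>"
      have eq: "(F y - F s) / (y - s) - c * F s = (F y - F s - (y - s) * (c * F s)) / (y - s)"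
        using y by (simp add: field_simps)
      show "dist ((F y - F s) / (y - s)) (c * F s) < e"
        unfolding dist_real_def eq using main[of y] y by (simp add: abs_divide dist_real_def divide_less_eq)
    qed
    then show "\<forall>\<^sub>F y in at s within {0..}. dist ((F y - F s) / (y - s)) (c * F s) < e"
      unfolding eventually_at using \<delta> by blast
  qed
  have "((\<lambda>s. exp (- (c * s)) * F s) has_real_derivative 0) (at s within {0..})" if "s \<in> {0..}" for s
  proof -
    have "((\<lambda>s. exp (- (c * s)) * F s) has_real_derivative
        exp (- (c * s)) * - c * F s + c * F s * exp (- (c * s))) (at s within {0..})"
      using that by (auto intro!: derivative_eq_intros deriv)
    then show ?thesis by (simp add: algebra_simps)
  qed
  from has_field_derivative_zero_constant[OF _ this]
  obtain C where C: "\<And>s. 0 \<le> s \<Longrightarrow> exp (- (c * s)) * F s = C"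
    by auto
  from C[of t] C[of 0] t have "exp (- (c * t)) * F t = F 0" by simp
  then show ?thesis
    by (simp add: exp_minus field_simps)
qed

section \<open>Transience of the jump process\<close>

lemma space_generated_algebra [simp]: "space (generated_algebra M T X) = space M"
  by (simp add: generated_algebra_def space_measure_of_conv)

lemma subalgebra_generated_algebra:
  assumes "\<And>r. r \<in> T \<Longrightarrow> X r \<in> borel_measurable M"
  shows "subalgebra M (generated_algebra M T X)"
proof -
  have "sets (generated_algebra M T X) = sigma_sets (space M) {X r -` A \<inter> space M | r A. r \<in> T \<and> A \<in> sets borel}"
    unfolding generated_algebra_def by (rule sets_measure_of) auto
  also have "\<dots> \<subseteq> sets M"
    using assms by (intro sets.sigma_sets_subset) (auto intro: measurable_sets)
  finally show ?thesis
    unfolding subalgebra_def by simp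
qed

lemma measurable_generated_algebra:
  assumes "r \<in> T"
  shows "X r \<in> borel_measurable (generated_algebra M T X)"
proof (rule measurableI)
  fix A :: "'b::topological_space set" assume A: "A \<in> sets borel"
  have "sets (generated_algebra M T X) = sigma_sets (space M) {X r -` A \<inter> space M | r A. r \<in> T \<and> A \<in> sets borel}"
    unfolding generated_algebra_def by (rule sets_measure_of) auto
  then show "X r -` A \<inter> space (generated_algebra M T X) \<in> sets (generated_algebra M T X)"
    using assms A unfolding space_generated_algebra by (auto intro!: sigma_sets.Basic)
qed simp

locale markov =
  fixes M :: "'a::euclidean_space \<Rightarrow> 'w measure" and X :: "real \<Rightarrow> 'w \<Rightarrow> 'a"
  assumes markov: "markov_process M X"
begin

lemma prob_space_M: "prob_space (M x)"
  using markov by (simp add: markov_process_def)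

lemma measurable_X: "0 \<le> t \<Longrightarrow> X t \<in> borel_measurable (M x)"
  using markov by (simp add: markov_process_def)

lemma transition_prob_kernel: "0 \<le> t \<Longrightarrow> transition_prob M X t \<in> borel \<rightarrow>\<^sub>M prob_algebra borel"
  using markov by (simp add: markov_process_def)

lemma transition_prob_kernel': "0 \<le> t \<Longrightarrow> transition_prob M X t \<in> borel \<rightarrow>\<^sub>M subprob_algebra borel"
  by (rule measurable_prob_algebraD[OF transition_prob_kernel])

lemma sets_transition_prob [simp]: "sets (transition_prob M X t x) = sets borel"
  by (simp add: transition_prob_def)

lemma prob_space_transition_prob: "0 \<le> t \<Longrightarrow> prob_space (transition_prob M X t x)"
  unfolding transition_prob_def by (intro prob_space.prob_space_distr prob_space_M measurable_X)

lemma integral_transition_prob: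
  fixes g :: "'a \<Rightarrow> real"
  assumes "0 \<le> t" "g \<in> borel_measurable borel"
  shows "(\<integral>z. g z \<partial>transition_prob M X t x) = (\<integral>\<omega>. g (X t \<omega>) \<partial>M x)"
  unfolding transition_prob_def using assms by (intro integral_distr measurable_X)

text \<open>Integrating a conditional probability over the whole space recovers the unconditional
  one, so the Markov property, stated relative to the past up to time \<open>s\<close>, turns into
  an identity between laws.\<close>

lemma Chapman_Kolmogorov:
  assumes s: "0 \<le> s" and t: "0 \<le> t"
  shows "transition_prob M X (s + t) x = transition_prob M X s x \<bind> transition_prob M X t"
proof (rule measure_eqI)
  have ne: "space (transition_prob M X s x) \<noteq> {}"
    by (simp add: transition_prob_def)
  have K: "transition_prob M X t \<in> transition_prob M X s x \<rightarrow>\<^sub>M subprob_algebra borel"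
    using transition_prob_kernel'[OF t] by (simp cong: measurable_cong_sets)
  show "sets (transition_prob M X (s + t) x) = sets (transition_prob M X s x \<bind> transition_prob M X t)"
    using sets_bind[OF sets_kernel[OF K] ne] by simp
  fix A assume "A \<in> sets (transition_prob M X (s + t) x)"
  then have A: "A \<in> sets borel" by simp
  interpret M: prob_space "M x" by (rule prob_space_M)
  let ?F = "generated_algebra (M x) {0..s} X"
  interpret finite_measure_subalgebra "M x" ?F
    by unfold_locales (intro subalgebra_generated_algebra, auto intro: measurable_X)
  have [measurable]: "X (s + t) \<in> borel_measurable (M x)" "X s \<in> borel_measurable (M x)"
    using s t by (auto intro: measurable_X)
  let ?B = "X (s + t) -` A \<inter> space (M x)"
  have B: "?B \<in> sets (M x)"
    using A by measurable
  have AE: "AE \<omega> in M x. real_cond_exp (M x) ?F (indicator ?B) \<omega> = measure (transition_prob M X t (X s \<omega>)) A"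
    using markov s t A unfolding markov_process_def by blast
  have intB: "integrable (M x) (indicator ?B :: 'w \<Rightarrow> real)"
    using B by (simp add: M.emeasure_finite less_top[symmetric])
  have m: "(\<lambda>y. emeasure (transition_prob M X t y) A) \<in> borel_measurable borel"
    using measurable_emeasure_kernel[OF transition_prob_kernel'[OF t] A] .
  have "(\<lambda>y. measure (transition_prob M X t y) A) \<in> borel_measurable borel"
    unfolding measure_def using m by measurable
  then have m': "(\<lambda>\<omega>. measure (transition_prob M X t (X s \<omega>)) A) \<in> borel_measurable (M x)"
    by measurable
  have le1: "measure (transition_prob M X t y) A \<le> 1" for y
    using prob_space.prob_le_1[OF prob_space_transition_prob[OF t]] .
  have int': "integrable (M x) (\<lambda>\<omega>. measure (transition_prob M X t (X s \<omega>)) A)"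
    using m' by (intro M.integrable_const_bound[of _ 1]) (auto simp: le1)
  have "emeasure (transition_prob M X (s + t) x) A = ennreal (measure (M x) ?B)"
    using A by (simp add: transition_prob_def emeasure_distr M.emeasure_eq_measure)
  also have "measure (M x) ?B = (\<integral>\<omega>. indicator ?B \<omega> \<partial>M x)"
    using B by simp
  also have "\<dots> = (\<integral>\<omega>. real_cond_exp (M x) ?F (indicator ?B) \<omega> \<partial>M x)"
    using real_cond_exp_int(2)[OF intB] by simp
  also have "\<dots> = (\<integral>\<omega>. measure (transition_prob M X t (X s \<omega>)) A \<partial>M x)"
    using AE m' by (intro integral_cong_AE) auto
  also have "ennreal \<dots> = (\<integral>\<^sup>+\<omega>. ennreal (measure (transition_prob M X t (X s \<omega>)) A) \<partial>M x)"
    using int' by (intro nn_integral_eq_integral[symmetric]) auto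
  also have "\<dots> = (\<integral>\<^sup>+\<omega>. emeasure (transition_prob M X t (X s \<omega>)) A \<partial>M x)"
    using prob_space.finite_measure[OF prob_space_transition_prob[OF t]]
    by (simp add: finite_measure.emeasure_eq_measure)
  also have "\<dots> = (\<integral>\<^sup>+y. emeasure (transition_prob M X t y) A \<partial>transition_prob M X s x)"
    unfolding transition_prob_def[of M X s] using m by (intro nn_integral_distr[symmetric]) auto
  also have "\<dots> = emeasure (transition_prob M X s x \<bind> transition_prob M X t) A"
    by (rule emeasure_bind[OF ne K A, symmetric])
  finally show "emeasure (transition_prob M X (s + t) x) A = emeasure (transition_prob M X s x \<bind> transition_prob M X t) A" .
qed

lemma borel_measurable_semigroup:
  fixes g :: "'a \<Rightarrow> real"
  assumes t: "0 \<le> t" and g: "g \<in> borel_measurable borel"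
  shows "(\<lambda>y. \<integral>\<omega>. g (X t \<omega>) \<partial>M y) \<in> borel_measurable borel"
proof -
  have "(\<lambda>y. \<integral>z. g z \<partial>transition_prob M X t y) \<in> borel_measurable borel"
    by (rule measurable_compose[OF transition_prob_kernel'[OF t] integral_measurable_subprob_algebra[OF g]])
  then show ?thesis
    by (simp add: integral_transition_prob[OF t g])
qed

lemma semigroup:
  fixes g :: "'a \<Rightarrow> real"
  assumes s: "0 \<le> s" and t: "0 \<le> t" and g: "g \<in> borel_measurable borel" and B: "\<And>y. \<bar>g y\<bar> \<le> B"
  shows "(\<integral>\<omega>. g (X (s + t) \<omega>) \<partial>M x) = (\<integral>\<omega>. \<integral>\<omega>'. g (X t \<omega>') \<partial>M (X s \<omega>) \<partial>M x)"
proof -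
  have "(\<integral>\<omega>. g (X (s + t) \<omega>) \<partial>M x) = (\<integral>z. g z \<partial>transition_prob M X (s + t) x)"
    using integral_transition_prob[of "s + t" g x] s t g by simp
  also have "\<dots> = (\<integral>y. \<integral>z. g z \<partial>transition_prob M X t y \<partial>transition_prob M X s x)"
    unfolding Chapman_Kolmogorov[OF s t]
  proof (rule integral_bind)
    show "g \<in> borel_measurable borel" by (rule g)
    show "transition_prob M X t \<in> transition_prob M X s x \<rightarrow>\<^sub>M subprob_algebra borel"
      using transition_prob_kernel'[OF t] by (simp cong: measurable_cong_sets)
    show "finite_measure (transition_prob M X s x)"
      by (rule prob_space.finite_measure[OF prob_space_transition_prob[OF s]])
    show "AE y in transition_prob M X s x. emeasure (transition_prob M X t y) (space (transition_prob M X t y)) \<le> ennreal 1"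
      using prob_space.emeasure_space_1[OF prob_space_transition_prob[OF t]] by simp
  qed (rule B)
  also have "\<dots> = (\<integral>y. (\<integral>\<omega>. g (X t \<omega>) \<partial>M y) \<partial>transition_prob M X s x)"
    by (simp add: integral_transition_prob[OF t g])
  also have "\<dots> = (\<integral>\<omega>. \<integral>\<omega>'. g (X t \<omega>') \<partial>M (X s \<omega>) \<partial>M x)"
    by (rule integral_transition_prob[OF s borel_measurable_semigroup[OF t g]])
  finally show ?thesis .
qed

text \<open>By Chapman-Kolmogorov the increment of \<open>F\<close> over \<open>[t, t + h]\<close>
  is the expectation, at the point \<open>X t\<close>, of the increment over \<open>[0, h]\<close>
  from a fixed start. Since the generator is a limit uniform in the starting point, the error is
  uniform in \<open>t\<close>.\<close>

lemma expectation_of_eigenfunction: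
  fixes g :: "'a \<Rightarrow> real"
  assumes gen: "has_generator M X L" and gc: "continuous_on UNIV g" and gB: "\<And>y. \<bar>g y\<bar> \<le> B"
    and eig: "\<And>y. L g y = c * g y" and t: "0 \<le> t"
  shows "(\<integral>\<omega>. g (X t \<omega>) \<partial>M x) = exp (c * t) * g x"
proof -
  interpret M: prob_space "M x" for x by (rule prob_space_M)
  have gm [measurable]: "g \<in> borel_measurable borel"
    using gc by (rule borel_measurable_continuous_onI)
  \<comment> \<open>Extended to negative times by its value at 0, \<open>F\<close> is bounded on the
    whole line.\<close>
  define F where "F t = (\<integral>\<omega>. g (X (max 0 t) \<omega>) \<partial>M x)" for t
  have int: "integrable (M y) (\<lambda>\<omega>. g (X t \<omega>))" if "0 \<le> t" for t y
    using measurable_X[OF that, of y] gB by (intro M.integrable_const_bound[of _ B]) auto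
  have bound: "\<bar>\<integral>\<omega>. g (X t \<omega>) \<partial>M y\<bar> \<le> B" if "0 \<le> t" for t y
  proof -
    have "\<bar>\<integral>\<omega>. g (X t \<omega>) \<partial>M y\<bar> \<le> (\<integral>\<omega>. \<bar>g (X t \<omega>)\<bar> \<partial>M y)"
      by (rule integral_abs_bound)
    also have "\<dots> \<le> (\<integral>\<omega>. B \<partial>M y)"
      using int[OF that, of y] gB by (intro integral_mono integrable_abs) auto
    finally show ?thesis by (simp add: M.prob_space)
  qed
  have "uniform_limit UNIV (\<lambda>t x. ((\<integral>\<omega>. g (X t \<omega>) \<partial>M x) - g x) / t) (L g) (at_right 0)"
    using gen gc gB unfolding has_generator_def bounded_iff by (auto simp: image_iff)
  note unif = uniform_limitD[OF this]
  have step: "\<exists>d>0. \<forall>t\<ge>0. \<forall>h. 0 < h \<and> h < d \<longrightarrow> \<bar>F (t + h) - F t - h * (c * F t)\<bar> \<le> e * h"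
    if e: "0 < e" for e
  proof -
    from unif[OF e] obtain d where d: "d > 0"
      "\<And>h y. 0 < h \<Longrightarrow> h < d \<Longrightarrow> dist (((\<integral>\<omega>. g (X h \<omega>) \<partial>M y) - g y) / h) (c * g y) < e"
      unfolding eventually_at_right_field eig by auto
    have "\<bar>F (t + h) - F t - h * (c * F t)\<bar> \<le> e * h" if t: "0 \<le> t" and h: "0 < h" "h < d" for t h
    proof -
      define G where "G y = (\<integral>\<omega>. g (X h \<omega>) \<partial>M y)" for y
      have [measurable]: "G \<in> borel_measurable borel"
        unfolding G_def[abs_def] using h by (intro borel_measurable_semigroup) auto
      have [measurable]: "X t \<in> borel_measurable (M x)" using t by (rule measurable_X)
      have intG: "integrable (M x) (\<lambda>\<omega>. G (X t \<omega>))"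
      proof (rule M.integrable_const_bound[of _ B])
        show "AE \<omega> in M x. norm (G (X t \<omega>)) \<le> B"
          using bound[of h] h by (simp add: G_def)
      qed measurable
      have ptw: "\<bar>G y - g y - h * (c * g y)\<bar> \<le> e * h" for y
      proof -
        have "(G y - g y) / h - c * g y = (G y - g y - h * (c * g y)) / h"
          using h by (simp add: field_simps)
        moreover have "\<bar>(G y - g y) / h - c * g y\<bar> < e"
          using d(2)[OF h, of y] by (simp add: dist_real_def G_def)
        ultimately show ?thesis using h by (simp add: abs_divide divide_less_eq)
      qed
      have "F (t + h) = (\<integral>\<omega>. G (X t \<omega>) \<partial>M x)"
        using semigroup[OF t _ gm gB, of h x] t h by (simp add: F_def G_def)
      moreover have "F t = (\<integral>\<omega>. g (X t \<omega>) \<partial>M x)"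
        using t by (simp add: F_def)
      ultimately have "F (t + h) - F t - h * (c * F t) = (\<integral>\<omega>. G (X t \<omega>) - g (X t \<omega>) - h * (c * g (X t \<omega>)) \<partial>M x)"
        using intG int[OF t, of x] by simp
      also have "\<bar>\<dots>\<bar> \<le> (\<integral>\<omega>. \<bar>G (X t \<omega>) - g (X t \<omega>) - h * (c * g (X t \<omega>))\<bar> \<partial>M x)"
        by (rule integral_abs_bound)
      also have "\<dots> \<le> (\<integral>\<omega>. e * h \<partial>M x)"
        using intG int[OF t, of x] ptw by (intro integral_mono integrable_abs) auto
      finally show ?thesis by (simp add: M.prob_space)
    qed
    then show ?thesis using d(1) by blast
  qed
  have "AE \<omega> in M x. X 0 \<omega> = x"
    using markov by (simp add: markov_process_def)
  then have "F 0 = (\<integral>\<omega>. g x \<partial>M x)"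
    unfolding F_def using measurable_X[of 0 x] by (intro integral_cong_AE) auto
  then have F0: "F 0 = g x"
    by (simp add: M.prob_space)
  have "F t = exp (c * t) * F 0"
    using step by (rule exponential_of_uniform_right_derivative[OF _ _ t]) (auto simp: F_def intro: bound)
  then have "F t = exp (c * t) * g x"
    unfolding F0 .
  then show "(\<integral>\<omega>. g (X t \<omega>) \<partial>M x) = exp (c * t) * g x"
    unfolding F_def max_absorb2[OF t] .
qed

end

text \<open>Put \<open>z = x - w\<close> and expand the cosine of
  \<open>\<xi> \<bullet> (x - y) - \<xi> \<bullet> w\<close>. Symmetry of \<open>a\<close> kills the
  sine term, and the total mass 1 produces the \<open>- 1\<close> in the eigenvalue.\<close>

lemma jump_operator_cos:
  fixes a :: "'a::euclidean_space \<Rightarrow> real"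
  assumes sym: "\<And>x. a (- x) = a x" and one: "has_bochner_integral lborel a 1"
  shows "jump_operator a (\<lambda>z. cos (\<xi> \<bullet> (z - y))) x = (cos_transform a \<xi> - 1) * cos (\<xi> \<bullet> (x - y))"
proof -
  have inta: "integrable lborel a" and [measurable]: "a \<in> borel_measurable borel"
    using one by (auto simp: has_bochner_integral_iff)
  have int1: "integrable lborel (\<lambda>w. a w * cos (\<xi> \<bullet> w))" "integrable lborel (\<lambda>w. a w * sin (\<xi> \<bullet> w))"
    by (rule Bochner_Integration.integrable_bound[OF inta], simp, simp add: abs_mult mult_left_le)+
  have sin0: "(LBINT w. a w * sin (\<xi> \<bullet> w)) = 0"
  proof -
    have "has_bochner_integral lborel (\<lambda>w. a w * sin (\<xi> \<bullet> w)) (LBINT w. a w * sin (\<xi> \<bullet> w))"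
      using int1(2) by (rule has_bochner_integral_integrable)
    from has_bochner_integral_lborel_affine[OF this, of "-1" 0]
    have "(LBINT w. - (a w * sin (\<xi> \<bullet> w))) = (LBINT w. a w * sin (\<xi> \<bullet> w))"
      by (simp add: has_bochner_integral_iff sym)
    then show ?thesis by simp
  qed
  have "has_bochner_integral lborel (\<lambda>w. cos (\<xi> \<bullet> (x - y)) * (a w * cos (\<xi> \<bullet> w)) +
      sin (\<xi> \<bullet> (x - y)) * (a w * sin (\<xi> \<bullet> w)) - cos (\<xi> \<bullet> (x - y)) * a w)
      (cos (\<xi> \<bullet> (x - y)) * cos_transform a \<xi> + sin (\<xi> \<bullet> (x - y)) * 0 - cos (\<xi> \<bullet> (x - y)) * 1)"
    using int1 inta one sin0
    by (intro has_bochner_integral_add has_bochner_integral_diff has_bochner_integral_mult_right)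
       (auto simp: has_bochner_integral_iff cos_transform_def)
  from has_bochner_integral_lborel_affine[OF this, of "-1" x]
  have "has_bochner_integral lborel (\<lambda>z. a (x - z) * (cos (\<xi> \<bullet> (x - y)) * cos (\<xi> \<bullet> (x - z)) +
      sin (\<xi> \<bullet> (x - y)) * sin (\<xi> \<bullet> (x - z)) - cos (\<xi> \<bullet> (x - y))))
      ((cos_transform a \<xi> - 1) * cos (\<xi> \<bullet> (x - y)))"
    by (simp add: algebra_simps)
  moreover have "cos (\<xi> \<bullet> (x - y)) * cos (\<xi> \<bullet> (x - z)) + sin (\<xi> \<bullet> (x - y)) * sin (\<xi> \<bullet> (x - z)) = cos (\<xi> \<bullet> (z - y))" for z
    unfolding cos_diff[symmetric] inner_diff_right[symmetric] by (simp add: algebra_simps)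
  ultimately show ?thesis
    by (simp add: jump_operator_def has_bochner_integral_iff)
qed

lemma integrable_cos_transform:
  fixes a :: "'a::euclidean_space \<Rightarrow> real"
  assumes inta: "integrable lborel a" and int: "integrable lborel (fourier_transform a)"
  shows "integrable lborel (cos_transform a)"
proof -
  have [measurable]: "a \<in> borel_measurable borel"
    using inta by auto
  have "Re (fourier_transform a \<xi>) = cos_transform a \<xi>" for \<xi>
  proof -
    have "integrable lborel (\<lambda>y. cis (- (\<xi> \<bullet> y)) * complex_of_real (a y))"
    proof (rule Bochner_Integration.integrable_bound[OF inta])
      have "(\<lambda>y. cis (- (\<xi> \<bullet> y))) \<in> borel_measurable borel"
        by (intro borel_measurable_continuous_onI continuous_intros)
      then show "(\<lambda>y. cis (- (\<xi> \<bullet> y)) * complex_of_real (a y)) \<in> borel_measurable lborel"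
        by measurable
    qed (simp add: norm_mult)
    then show ?thesis
      unfolding fourier_transform_def cos_transform_def
      by (subst integral_Re[symmetric]) (auto simp: mult.commute)
  qed
  then show ?thesis
    using integrable_Re[OF int] by simp
qed

text \<open>The absolute value stands inside the expectation, as Fubini's theorem for the Green
  measure requires. The bound \<open>expectation_le_spectral_mass\<close> is applied to
  \<open>|f|\<close>, and both of its terms are integrable in time.\<close>

lemma transient:
  fixes a f :: "'a::euclidean_space \<Rightarrow> real"
  assumes dim: "DIM('a) \<ge> 3"
    and sym: "\<And>x. a (- x) = a x" and nn: "\<And>x. 0 \<le> a x" and cont: "continuous_on UNIV a"
    and one: "has_bochner_integral lborel a 1"
    and int: "integrable lborel (fourier_transform a)"
    and X: "pure_jump_markov_process M X a"
    and fc: "continuous_on UNIV f" and fb: "bounded (range f)" and fi: "integrable lborel f"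
  shows "(\<integral>\<^sup>+t\<in>{0..}. (\<integral>\<^sup>+\<omega>. ennreal \<bar>f (X t \<omega>)\<bar> \<partial>M x) \<partial>lborel) < \<infinity>"
proof -
  interpret markov M X
    using X by unfold_locales (simp add: pure_jump_markov_process_def)
  have gen: "has_generator M X (jump_operator a)"
    using X by (simp add: pure_jump_markov_process_def)
  have am [measurable]: "a \<in> borel_measurable borel"
    using cont by (rule borel_measurable_continuous_onI)
  have fm [measurable]: "f \<in> borel_measurable borel"
    using fc by (rule borel_measurable_continuous_onI)
  have intc: "integrable lborel (cos_transform a)"
    using one int by (intro integrable_cos_transform) (auto simp: has_bochner_integral_iff)
  obtain B where B: "\<And>y. \<bar>f y\<bar> \<le> B"
    using fb by (auto simp: bounded_iff)
  have B0: "0 \<le> B" using B[of 0] by linarith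
  let ?c = "ennreal (1 / (2 * pi) ^ DIM('a))"
  let ?I = "\<integral>\<^sup>+y. ennreal \<bar>f y\<bar> \<partial>lborel"
  have le: "(\<integral>\<^sup>+\<omega>. ennreal \<bar>f (X t \<omega>)\<bar> \<partial>M x) \<le> ennreal (B * exp (- t)) + ?c * spectral_mass a t * ?I"
    if t: "0 \<le> t" for t
  proof -
    have "(\<integral>\<^sup>+\<omega>. ennreal \<bar>f (X t \<omega>)\<bar> \<partial>M x) = (\<integral>\<^sup>+z. ennreal \<bar>f z\<bar> \<partial>transition_prob M X t x)"
      unfolding transition_prob_def using measurable_X[OF t] by (subst nn_integral_distr) auto
    also have "\<dots> \<le> ennreal (B * exp (- t)) + ?c * spectral_mass a t * ?I"
    proof (rule expectation_le_spectral_mass[OF prob_space_transition_prob[OF t] _ t am])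
      fix \<xi> y
      have "(\<integral>z. cos (\<xi> \<bullet> (z - y)) \<partial>transition_prob M X t x) = (\<integral>\<omega>. cos (\<xi> \<bullet> (X t \<omega> - y)) \<partial>M x)"
        using t by (rule integral_transition_prob) measurable
      also have "\<dots> = exp ((cos_transform a \<xi> - 1) * t) * cos (\<xi> \<bullet> (x - y))"
      proof (rule expectation_of_eigenfunction[OF gen _ _ _ t, where B=1])
        show "continuous_on UNIV (\<lambda>z. cos (\<xi> \<bullet> (z - y)))"
          by (intro continuous_intros)
        show "jump_operator a (\<lambda>z. cos (\<xi> \<bullet> (z - y))) z = (cos_transform a \<xi> - 1) * cos (\<xi> \<bullet> (z - y))" for z
          using sym one by (rule jump_operator_cos)
      qed simp
      finally show "(\<integral>z. cos (\<xi> \<bullet> (z - y)) \<partial>transition_prob M X t x) =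
          exp (- t * (1 - cos_transform a \<xi>)) * cos (\<xi> \<bullet> (x - y))"
        by (simp add: algebra_simps)
    qed (auto simp: B intro!: continuous_intros fc)
    finally show ?thesis .
  qed
  have [measurable]: "spectral_mass a \<in> borel_measurable borel"
    unfolding spectral_mass_def[abs_def] by measurable
  have exp_int: "(\<integral>\<^sup>+t\<in>{0..}. ennreal (B * exp (- t)) \<partial>lborel) < \<infinity>"
  proof -
    have "((\<lambda>t::real. exp (- t)) \<longlongrightarrow> 0) at_top"
      by (intro filterlim_compose[OF exp_at_bot] filterlim_uminus_at_bot_at_top)
    then have "((\<lambda>t::real. - (B * exp (- t))) \<longlongrightarrow> - (B * 0)) at_top"
      by (intro tendsto_intros)
    then have "(\<integral>\<^sup>+t\<in>{0..}. ennreal (B * exp (- t)) \<partial>lborel) = ennreal (- (B * 0) - - (B * exp (- 0)))"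
      using B0 by (intro nn_integral_FTC_atLeast) (auto intro!: derivative_eq_intros)
    then show ?thesis by simp
  qed
  have "(\<integral>\<^sup>+t\<in>{0..}. (\<integral>\<^sup>+\<omega>. ennreal \<bar>f (X t \<omega>)\<bar> \<partial>M x) \<partial>lborel)
      \<le> (\<integral>\<^sup>+t. ennreal (B * exp (- t)) * indicator {0..} t + ?c * ?I * (spectral_mass a t * indicator {0..} t) \<partial>lborel)"
    using le by (intro nn_integral_mono) (auto simp: indicator_def ac_simps)
  also have "\<dots> = (\<integral>\<^sup>+t\<in>{0..}. ennreal (B * exp (- t)) \<partial>lborel) + ?c * ?I * (\<integral>\<^sup>+t\<in>{0..}. spectral_mass a t \<partial>lborel)"
    by (simp add: nn_integral_add nn_integral_cmult)
  also have "\<dots> < \<infinity>"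
    using exp_int nn_integral_spectral_mass[OF dim nn cont one intc] fi
    by (auto simp: integrable_iff_bounded ennreal_mult_less_top)
  finally show ?thesis .
qed

section \<open>Right-continuous processes and the Green measure\<close>

text \<open>If time is rounded to a grid, the process depends on time through countably many values
  and is jointly measurable. Right continuity recovers it as the limit over finer grids.\<close>

lemma borel_measurable_right_continuous:
  fixes Y :: "real \<Rightarrow> 'w \<Rightarrow> 'b::{metric_space}"
  assumes meas: "\<And>t. 0 \<le> t \<Longrightarrow> Y t \<in> borel_measurable N"
    and right: "\<And>\<omega> t. \<omega> \<in> space N \<Longrightarrow> 0 \<le> t \<Longrightarrow> ((\<lambda>s. Y s \<omega>) \<longlongrightarrow> Y t \<omega>) (at_right t)"
  shows "(\<lambda>(t, \<omega>). Y (max 0 t) \<omega>) \<in> borel_measurable (borel \<Otimes>\<^sub>M N)"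
proof -
  \<comment> \<open>The \<open>+ 1\<close> rounds strictly upwards, so that the grid times approach
    \<open>max 0 t\<close> from the right and never coincide with it.\<close>
  define r where "r n t = (real (nat \<lfloor>real (Suc n) * max 0 t\<rfloor>) + 1) / real (Suc n)" for n and t :: real
  show ?thesis
  proof (rule borel_measurable_LIMSEQ_metric[where f="\<lambda>n (t, \<omega>). Y (r n t) \<omega>"])
    fix n
    have "(\<lambda>p. Y ((real (nat \<lfloor>real (Suc n) * max 0 (fst p)\<rfloor>) + 1) / real (Suc n)) (snd p))
        \<in> borel_measurable (borel \<Otimes>\<^sub>M N)"
    proof (rule measurable_compose_countable[where f="\<lambda>i p. Y ((real i + 1) / real (Suc n)) (snd p)"
          and g="\<lambda>p. nat \<lfloor>real (Suc n) * max 0 (fst p)\<rfloor>"])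
      fix i :: nat
      have "Y ((real i + 1) / real (Suc n)) \<in> borel_measurable N"
        by (rule meas) simp
      then show "(\<lambda>p. Y ((real i + 1) / real (Suc n)) (snd p)) \<in> borel_measurable (borel \<Otimes>\<^sub>M N)"
        by measurable
    qed measurable
    then show "(\<lambda>(t, \<omega>). Y (r n t) \<omega>) \<in> borel_measurable (borel \<Otimes>\<^sub>M N)"
      by (simp add: r_def split_beta')
  next
    fix p :: "real \<times> 'w" assume "p \<in> space (borel \<Otimes>\<^sub>M N)"
    then obtain t \<omega> where p: "p = (t, \<omega>)" "\<omega> \<in> space N"
      by (auto simp: space_pair_measure)
    let ?t = "max 0 t"
    have fl: "real (nat \<lfloor>real (Suc n) * ?t\<rfloor>) = of_int \<lfloor>real (Suc n) * ?t\<rfloor>" for n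
      by simp
    have gt: "?t < r n t" for n
    proof -
      have "real (Suc n) * ?t < real (nat \<lfloor>real (Suc n) * ?t\<rfloor>) + 1"
        unfolding fl by linarith
      then show ?thesis
        unfolding r_def by (simp add: less_divide_eq mult.commute)
    qed
    have le: "r n t \<le> ?t + 1 / real (Suc n)" for n
    proof -
      have "real (nat \<lfloor>real (Suc n) * ?t\<rfloor>) + 1 \<le> real (Suc n) * ?t + 1"
        unfolding fl by linarith
      then have "r n t \<le> (real (Suc n) * ?t + 1) / real (Suc n)"
        unfolding r_def by (intro divide_right_mono) auto
      then show ?thesis
        by (simp add: add_divide_distrib)
    qed
    have "(\<lambda>n. ?t + 1 / real (Suc n)) \<longlonglongrightarrow> ?t + 0"
      by (intro tendsto_add tendsto_const LIMSEQ_Suc[OF lim_1_over_n])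
    then have upper: "(\<lambda>n. ?t + 1 / real (Suc n)) \<longlonglongrightarrow> ?t"
      by (simp only: add_0_right)
    have "(\<lambda>n. r n t) \<longlonglongrightarrow> ?t"
      by (rule tendsto_sandwich[OF _ _ tendsto_const upper])
         (rule always_eventually, rule allI, rule less_imp_le[OF gt] le)+
    moreover have "\<forall>\<^sub>F n in sequentially. r n t \<in> {?t<..} \<and> r n t \<noteq> ?t"
      using gt by (intro always_eventually allI) (simp only: greaterThan_iff, metis less_irrefl)
    ultimately have "filterlim (\<lambda>n. r n t) (at_right ?t) sequentially"
      by (simp only: filterlim_at)
    from filterlim_compose[OF right[OF p(2), of ?t] this]
    show "(\<lambda>n. case p of (t, \<omega>) \<Rightarrow> Y (r n t) \<omega>) \<longlonglongrightarrow> (case p of (t, \<omega>) \<Rightarrow> Y (max 0 t) \<omega>)"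
      by (simp add: p)
  qed
qed

lemma pure_jump_path_right:
  assumes "pure_jump_path p" "0 \<le> t"
  shows "(p \<longlongrightarrow> p t) (at_right t)"
  using assms unfolding pure_jump_path_def by (auto intro: tendsto_eventually)

text \<open>The Green measure is the image of \<open>dt \<otimes> P\<^sub>x\<close> under \<open>(t, \<omega>) \<mapsto> X\<^sub>t(\<omega>)\<close>.\<close>

lemma integral_green_measure:
  fixes f :: "'a::euclidean_space \<Rightarrow> real"
  assumes P: "prob_space (M x)"
    and X: "(\<lambda>(t, \<omega>). X (max 0 t) \<omega>) \<in> borel_measurable (borel \<Otimes>\<^sub>M M x)"
    and f: "f \<in> borel_measurable borel"
    and fin: "(\<integral>\<^sup>+t\<in>{0..}. (\<integral>\<^sup>+\<omega>. ennreal \<bar>f (X t \<omega>)\<bar> \<partial>M x) \<partial>lborel) < \<infinity>"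
  shows "set_integrable lborel {0..} (\<lambda>t. \<integral>\<omega>. f (X t \<omega>) \<partial>M x)"
    and "(\<integral>y. f y \<partial>green_measure M X x) = (LBINT t:{0..}. \<integral>\<omega>. f (X t \<omega>) \<partial>M x)"
proof -
  interpret Px: prob_space "M x" by (rule P)
  let ?\<rho> = "density lborel (indicator {0..} :: real \<Rightarrow> ennreal)"
  interpret \<rho>: sigma_finite_measure ?\<rho>
    by (subst sigma_finite_measure.sigma_finite_iff_density_finite[OF sigma_finite_lborel]) (auto simp: indicator_def)
  interpret pair_sigma_finite ?\<rho> "M x" ..
  let ?Y = "\<lambda>(t, \<omega>). X (max 0 t) \<omega>"
  have Y [measurable]: "?Y \<in> borel_measurable (?\<rho> \<Otimes>\<^sub>M M x)"
    using X by (simp cong: measurable_cong_sets sets_pair_measure_cong)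
  have X' [measurable]: "(\<lambda>p. X (max 0 (fst p)) (snd p)) \<in> borel_measurable (borel \<Otimes>\<^sub>M M x)"
    using X by (simp add: split_beta')
  have Xt: "X t \<in> borel_measurable (M x)" if "0 \<le> t" for t
    using measurable_compose[OF measurable_Pair1'[of t borel "M x"] X] that by (simp add: max_def)
  note [measurable] = f
  let ?D = "distr (?\<rho> \<Otimes>\<^sub>M M x) borel ?Y"
  have slice: "(\<integral>\<^sup>+p. g (?Y p) \<partial>(?\<rho> \<Otimes>\<^sub>M M x)) = (\<integral>\<^sup>+t\<in>{0..}. (\<integral>\<^sup>+\<omega>. g (X t \<omega>) \<partial>M x) \<partial>lborel)"
    if g [measurable]: "g \<in> borel_measurable borel" for g :: "'a \<Rightarrow> ennreal"
  proof -
    have "(\<integral>\<^sup>+p. g (?Y p) \<partial>(?\<rho> \<Otimes>\<^sub>M M x)) = (\<integral>\<^sup>+t. \<integral>\<^sup>+\<omega>. g (X (max 0 t) \<omega>) \<partial>M x \<partial>?\<rho>)"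
    proof -
      have "(\<lambda>p. g (?Y p)) \<in> borel_measurable (?\<rho> \<Otimes>\<^sub>M M x)"
        using Y g by (rule measurable_compose)
      from Px.nn_integral_fst[OF this] show ?thesis by simp
    qed
    also have "\<dots> = (\<integral>\<^sup>+t. indicator {0..} t * (\<integral>\<^sup>+\<omega>. g (X (max 0 t) \<omega>) \<partial>M x) \<partial>lborel)"
      by (subst nn_integral_density) measurable
    also have "\<dots> = (\<integral>\<^sup>+t\<in>{0..}. (\<integral>\<^sup>+\<omega>. g (X t \<omega>) \<partial>M x) \<partial>lborel)"
      by (intro nn_integral_cong) (auto simp: indicator_def max_def)
    finally show ?thesis .
  qed
  \<comment> \<open>The image of a measure is countably additive. Without this,
    \<open>measure_of\<close> would fall back to the zero measure.\<close>
  have "green_measure M X x = measure_of UNIV (sets borel) (emeasure ?D)"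
    unfolding green_measure_def
  proof (rule measure_of_eq)
    fix A :: "'a set" assume "A \<in> sigma_sets UNIV (sets borel)"
    then have A [measurable]: "A \<in> sets borel"
      using sets.sigma_sets_eq[of "borel :: 'a measure"] by simp
    have "emeasure ?D A = (\<integral>\<^sup>+y. indicator A y \<partial>?D)"
      by simp
    also have "\<dots> = (\<integral>\<^sup>+p. indicator A (?Y p) \<partial>(?\<rho> \<Otimes>\<^sub>M M x))"
      by (rule nn_integral_distr) measurable
    also have "\<dots> = (\<integral>\<^sup>+t\<in>{0..}. (\<integral>\<^sup>+\<omega>. indicator A (X t \<omega>) \<partial>M x) \<partial>lborel)"
      by (rule slice) measurable
    also have "\<dots> = (\<integral>\<^sup>+t\<in>{0..}. emeasure (transition_prob M X t x) A \<partial>lborel)"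
    proof (intro nn_integral_cong)
      fix t
      show "(\<integral>\<^sup>+\<omega>. indicator A (X t \<omega>) \<partial>M x) * indicator {0..} t = emeasure (transition_prob M X t x) A * indicator {0..} t"
      proof (cases "0 \<le> t")
        case True
        have "emeasure (transition_prob M X t x) A = (\<integral>\<^sup>+y. indicator A y \<partial>distr (M x) borel (X t))"
          by (simp add: transition_prob_def)
        also have "\<dots> = (\<integral>\<^sup>+\<omega>. indicator A (X t \<omega>) \<partial>M x)"
          using f A by (intro nn_integral_distr Xt True) simp
        finally show ?thesis by (simp only:)
      qed simp
    qed
    finally show "(\<integral>\<^sup>+t\<in>{0..}. emeasure (transition_prob M X t x) A \<partial>lborel) = emeasure ?D A" ..
  qed blast
  also have "\<dots> = measure_of (space ?D) (sets ?D) (emeasure ?D)"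
    by (simp only: space_distr sets_distr space_borel)
  also have "\<dots> = ?D"
    by (rule measure_of_of_measure)
  finally have green: "green_measure M X x = ?D" .
  have int: "integrable (?\<rho> \<Otimes>\<^sub>M M x) (\<lambda>p. f (?Y p))"
    unfolding integrable_iff_bounded using slice[of "\<lambda>y. ennreal \<bar>f y\<bar>"] fin by simp
  have m: "(\<lambda>t. \<integral>\<omega>. f (X (max 0 t) \<omega>) \<partial>M x) \<in> borel_measurable lborel"
    by measurable
  have eq: "indicator {0..} t *\<^sub>R (\<integral>\<omega>. f (X (max 0 t) \<omega>) \<partial>M x) = indicator {0..} t *\<^sub>R (\<integral>\<omega>. f (X t \<omega>) \<partial>M x)" for t :: real
    by (auto simp: indicator_def max_def)
  have \<rho>: "?\<rho> = density lborel (\<lambda>t. ennreal (indicator {0..} t))"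
    by (simp add: ennreal_indicator)
  have "integrable ?\<rho> (\<lambda>t. \<integral>\<omega>. f (X (max 0 t) \<omega>) \<partial>M x)"
    using integrable_fst'[OF int] by simp
  then have "integrable lborel (\<lambda>t. indicator {0..} t *\<^sub>R (\<integral>\<omega>. f (X (max 0 t) \<omega>) \<partial>M x))"
    unfolding \<rho> using m by (subst (asm) integrable_density) auto
  then show "set_integrable lborel {0..} (\<lambda>t. \<integral>\<omega>. f (X t \<omega>) \<partial>M x)"
    unfolding set_integrable_def eq .
  have "(\<integral>y. f y \<partial>green_measure M X x) = (\<integral>p. f (?Y p) \<partial>(?\<rho> \<Otimes>\<^sub>M M x))"
    unfolding green by (rule integral_distr) measurable
  also have "\<dots> = (\<integral>t. \<integral>\<omega>. f (X (max 0 t) \<omega>) \<partial>M x \<partial>?\<rho>)"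
    using integral_fst'[OF int] by simp
  also have "\<dots> = (\<integral>t. indicator {0..} t *\<^sub>R (\<integral>\<omega>. f (X (max 0 t) \<omega>) \<partial>M x) \<partial>lborel)"
    unfolding \<rho> using m by (subst integral_density) auto
  also have "\<dots> = (LBINT t:{0..}. \<integral>\<omega>. f (X t \<omega>) \<partial>M x)"
    unfolding set_lebesgue_integral_def eq ..
  finally show "(\<integral>y. f y \<partial>green_measure M X x) = (LBINT t:{0..}. \<integral>\<omega>. f (X t \<omega>) \<partial>M x)" .
qed

section \<open>Uniqueness of Laplace transforms\<close>

text \<open>On the unit interval the exponential series is dominated termwise by
  \<open>\<bar>t\<bar> ^ n / fact n\<close>, so it may be integrated term by term. Hence the moments
  determine the law.\<close>

lemma char_eq_moments:
  assumes "real_distribution P" and bnd: "AE x in P. 0 \<le> x \<and> x \<le> 1"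
  shows "char P t = (\<Sum>n. (\<i> * complex_of_real t) ^ n / fact n * complex_of_real (\<integral>x. x ^ n \<partial>P))"
proof -
  interpret P: real_distribution P by fact
  let ?f = "\<lambda>n x. (\<i> * complex_of_real t) ^ n / fact n * complex_of_real (x ^ n)"
  have intp: "integrable P (\<lambda>x. x ^ n)" for n
    using bnd by (intro P.integrable_const_bound[of _ 1]) (auto simp: power_le_one elim: eventually_mono)
  have int: "integrable P (?f n)" for n
    by (intro integrable_mult_right integrable_of_real intp)
  have norm_f: "norm (?f n x) = \<bar>t\<bar> ^ n / fact n * \<bar>x\<bar> ^ n" for n x
    by (simp add: norm_mult norm_power norm_divide power_abs)
  have summ: "summable (\<lambda>n. \<bar>t\<bar> ^ n / fact n)"
    using summable_exp[of "\<bar>t\<bar>"] by (simp add: field_simps)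
  have le: "norm (?f n x) \<le> \<bar>t\<bar> ^ n / fact n" if "0 \<le> x \<and> x \<le> 1" for n x
    unfolding norm_f using that by (intro mult_left_le) (auto simp: power_le_one)
  have 1: "char P t = (\<integral>x. (\<Sum>n. ?f n x) \<partial>P)"
    unfolding char_def
  proof (intro Bochner_Integration.integral_cong refl)
    fix x
    have "(\<lambda>n. (\<i> * complex_of_real (t * x)) ^ n /\<^sub>R fact n) sums exp (\<i> * complex_of_real (t * x))"
      by (rule exp_converges)
    also have "(\<lambda>n. (\<i> * complex_of_real (t * x)) ^ n /\<^sub>R fact n) = (\<lambda>n. ?f n x)"
      by (simp add: fun_eq_iff scaleR_conv_of_real power_mult_distrib field_simps)
    finally show "iexp (t * x) = (\<Sum>n. ?f n x)"
      by (simp add: sums_iff)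
  qed
  have 2: "(\<integral>x. (\<Sum>n. ?f n x) \<partial>P) = (\<Sum>n. \<integral>x. ?f n x \<partial>P)"
  proof (rule integral_suminf[OF int])
    show "AE x in P. summable (\<lambda>n. norm (?f n x))"
      using bnd
    proof eventually_elim
      case (elim x)
      show ?case
        by (rule summable_comparison_test'[OF summ]) (use le[OF elim] in simp)
    qed
    show "summable (\<lambda>n. \<integral>x. norm (?f n x) \<partial>P)"
    proof (rule summable_comparison_test'[OF summ])
      fix n :: nat
      have "AE x in P. norm (?f n x) \<le> \<bar>t\<bar> ^ n / fact n"
        using bnd by eventually_elim (rule le)
      then have "(\<integral>x. norm (?f n x) \<partial>P) \<le> (\<integral>x. \<bar>t\<bar> ^ n / fact n \<partial>P)"
        using int by (intro integral_mono_AE integrable_norm) (auto simp del: of_real_power times_divide_eq_left)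
      then show "norm (\<integral>x. norm (?f n x) \<partial>P) \<le> \<bar>t\<bar> ^ n / fact n"
        using P.prob_space by simp
    qed
  qed
  have "(\<integral>x. ?f n x \<partial>P) = (\<i> * complex_of_real t) ^ n / fact n * complex_of_real (\<integral>x. x ^ n \<partial>P)" for n
    using intp[of n] by (simp only: integral_mult_right_zero integral_complex_of_real)
  then show ?thesis
    unfolding 1 2 by (rule suminf_cong)
qed

text \<open>After the exponential change of variables \<open>y = e^{-x}\<close> the Laplace transforms at the
  positive integers are moments of measures on the unit interval.\<close>

lemma laplace_transform_unique:
  fixes \<mu> \<nu> :: "real measure"
  assumes sets: "sets \<mu> = sets borel" "sets \<nu> = sets borel"
    and nn: "AE x in \<mu>. 0 \<le> x" "AE x in \<nu>. 0 \<le> x"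
    and eq: "\<And>l. 0 < l \<Longrightarrow> (\<integral>\<^sup>+x. ennreal (exp (- l * x)) \<partial>\<mu>) = (\<integral>\<^sup>+x. ennreal (exp (- l * x)) \<partial>\<nu>)"
    and fin: "(\<integral>\<^sup>+x. ennreal (exp (- x)) \<partial>\<mu>) < \<infinity>"
  shows "\<mu> = \<nu>"
proof -
  define L where "L = enn2real (\<integral>\<^sup>+x. ennreal (exp (- x)) \<partial>\<mu>)"
  have L: "(\<integral>\<^sup>+x. ennreal (exp (- x)) \<partial>\<mu>) = ennreal L" "(\<integral>\<^sup>+x. ennreal (exp (- x)) \<partial>\<nu>) = ennreal L"
    unfolding L_def using fin eq[of 1] by auto
  show ?thesis
  proof (cases "L = 0")
    case True
    \<comment> \<open>If \<open>L = 0\<close>, both measures vanish, because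
      \<open>exp (- x)\<close> is positive. Otherwise division by \<open>L\<close> produces
      probability measures.\<close>
    have zero: "emeasure \<kappa> A = 0" if "(\<integral>\<^sup>+x. ennreal (exp (- x)) \<partial>\<kappa>) = 0" and s: "sets \<kappa> = sets borel" for \<kappa> and A :: "real set"
    proof -
      have "AE x in \<kappa>. ennreal (exp (- x)) = 0"
        using that by (subst (asm) nn_integral_0_iff_AE) (simp_all cong: measurable_cong_sets)
      then have "AE x in \<kappa>. False"
        by eventually_elim simp
      then have "space \<kappa> \<in> null_sets \<kappa>"
        by (simp add: AE_iff_null)
      then show ?thesis
        using emeasure_space[of \<kappa> A] by auto
    qed
    show ?thesis
      using zero[of \<mu>] zero[of \<nu>] L True sets by (intro measure_eqI) auto
  next
    case False
    then have L0: "0 < L" by (simp add: L_def less_le)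
    define T where "T \<kappa> = density \<kappa> (\<lambda>x. ennreal (exp (- x) / L))" for \<kappa> :: "real measure"
    define Q where "Q \<kappa> = distr (T \<kappa>) borel (\<lambda>x. exp (- x))" for \<kappa>
    have mT: "g \<in> T \<kappa> \<rightarrow>\<^sub>M borel" and m\<kappa>: "g \<in> \<kappa> \<rightarrow>\<^sub>M borel"
      if "sets \<kappa> = sets borel" "g \<in> borel \<rightarrow>\<^sub>M borel" for \<kappa> and g :: "real \<Rightarrow> 'c::topological_space"
    proof -
      have "sets (T \<kappa>) = sets borel" using that(1) by (simp only: T_def sets_density)
      then show "g \<in> T \<kappa> \<rightarrow>\<^sub>M borel" "g \<in> \<kappa> \<rightarrow>\<^sub>M borel"
        using that measurable_cong_sets[of _ borel borel borel] by blast+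
    qed
    \<comment> \<open>Weighting by \<open>exp (- x) / L\<close> and mapping by
      \<open>exp (- x)\<close> can both be undone, so it suffices to identify the images
      \<open>Q\<close>.\<close>
    have recover: "\<kappa> = density (distr (Q \<kappa>) borel (\<lambda>y. - ln y)) (\<lambda>x. ennreal (L * exp x))"
      if s: "sets \<kappa> = sets borel" for \<kappa>
    proof -
      have "distr (Q \<kappa>) borel (\<lambda>y. - ln y) = distr (T \<kappa>) borel ((\<lambda>y. - ln y) \<circ> (\<lambda>x. exp (- x)))"
        unfolding Q_def by (rule distr_distr[OF _ mT[OF s]]) measurable
      also have "(\<lambda>y. - ln y) \<circ> (\<lambda>x::real. exp (- x)) = (\<lambda>x. x)"
        by (simp add: fun_eq_iff)
      also have "distr (T \<kappa>) borel (\<lambda>x. x) = T \<kappa>"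
        by (rule distr_id2) (simp add: T_def s)
      finally have "density (distr (Q \<kappa>) borel (\<lambda>y. - ln y)) (\<lambda>x. ennreal (L * exp x)) =
          density (density \<kappa> (\<lambda>x. ennreal (exp (- x) / L))) (\<lambda>x. ennreal (L * exp x))"
        unfolding T_def by simp
      also have "\<dots> = density \<kappa> (\<lambda>x. ennreal (exp (- x) / L) * ennreal (L * exp x))"
        by (rule density_density_eq[OF m\<kappa>[OF s] m\<kappa>[OF s]]) measurable
      also have "(\<lambda>x. ennreal (exp (- x) / L) * ennreal (L * exp x)) = (\<lambda>x. 1)"
        using L0 by (auto simp: fun_eq_iff exp_minus field_simps simp flip: ennreal_mult)
      finally show ?thesis by (simp add: density_1)
    qed
    \<comment> \<open>The weight takes up one factor \<open>exp (- x)\<close>, hence the moment of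
      order \<open>n\<close> is the transform at \<open>n + 1\<close>, a positive argument even for
      \<open>n = 0\<close>.\<close>
    have Qint: "(\<integral>\<^sup>+y. ennreal (y ^ n) \<partial>Q \<kappa>) = ennreal (1 / L) * (\<integral>\<^sup>+x. ennreal (exp (- (real n + 1) * x)) \<partial>\<kappa>)"
      if s: "sets \<kappa> = sets borel" for \<kappa> n
    proof -
      have "(\<integral>\<^sup>+y. ennreal (y ^ n) \<partial>Q \<kappa>) = (\<integral>\<^sup>+x. ennreal (exp (- x) ^ n) \<partial>T \<kappa>)"
        unfolding Q_def by (rule nn_integral_distr[OF mT[OF s]]) measurable
      also have "\<dots> = (\<integral>\<^sup>+x. ennreal (exp (- x) / L) * ennreal (exp (- x) ^ n) \<partial>\<kappa>)"
        unfolding T_def by (rule nn_integral_density[OF m\<kappa>[OF s] m\<kappa>[OF s]]) measurable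
      also have "\<dots> = (\<integral>\<^sup>+x. ennreal (1 / L) * ennreal (exp (- (real n + 1) * x)) \<partial>\<kappa>)"
      proof (intro nn_integral_cong)
        fix x
        have "exp (- x) * exp (- x) ^ n = exp (- (real n + 1) * x)"
          by (simp add: exp_of_nat_mult[symmetric] exp_add[symmetric] algebra_simps)
        then have "exp (- x) / L * exp (- x) ^ n = 1 / L * exp (- (real n + 1) * x)"
          by simp
        then show "ennreal (exp (- x) / L) * ennreal (exp (- x) ^ n) = ennreal (1 / L) * ennreal (exp (- (real n + 1) * x))"
          using L0 by (simp flip: ennreal_mult)
      qed
      also have "\<dots> = ennreal (1 / L) * (\<integral>\<^sup>+x. ennreal (exp (- (real n + 1) * x)) \<partial>\<kappa>)"
        by (rule nn_integral_cmult[OF m\<kappa>[OF s]]) measurable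
      finally show ?thesis .
    qed
    have Qdist: "real_distribution (Q \<kappa>)" and Qbnd: "AE y in Q \<kappa>. 0 \<le> y \<and> y \<le> 1"
      if s: "sets \<kappa> = sets borel" and I: "(\<integral>\<^sup>+x. ennreal (exp (- x)) \<partial>\<kappa>) = ennreal L" and "AE x in \<kappa>. 0 \<le> x" for \<kappa>
    proof -
      have "emeasure (Q \<kappa>) (space (Q \<kappa>)) = (\<integral>\<^sup>+y. ennreal (y ^ 0) \<partial>Q \<kappa>)"
        by simp
      also have "\<dots> = ennreal (1 / L) * ennreal L"
        unfolding Qint[OF s] using I by simp
      also have "\<dots> = 1"
        using L0 by (simp flip: ennreal_mult)
      finally have "prob_space (Q \<kappa>)" by (rule prob_spaceI)
      then show "real_distribution (Q \<kappa>)"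
        by (simp add: real_distribution_def real_distribution_axioms_def Q_def)
      show "AE y in Q \<kappa>. 0 \<le> y \<and> y \<le> 1"
        unfolding Q_def T_def using that(3) by (subst AE_distr_iff) (auto simp: AE_density m\<kappa>[OF s] intro: mT[OF s, unfolded T_def] elim!: eventually_mono)
    qed
    have moments: "(\<integral>y. y ^ n \<partial>Q \<mu>) = (\<integral>y. y ^ n \<partial>Q \<nu>)" for n
    proof -
      have "(\<integral>y. y ^ n \<partial>Q \<kappa>) = enn2real (\<integral>\<^sup>+y. ennreal (y ^ n) \<partial>Q \<kappa>)"
        if "AE y in Q \<kappa>. 0 \<le> y \<and> y \<le> 1" for \<kappa>
        using that by (intro integral_eq_nn_integral) (auto simp: Q_def elim!: eventually_mono)
      then show ?thesis
        using Qbnd[OF sets(1) L(1) nn(1)] Qbnd[OF sets(2) L(2) nn(2)] eq[of "real n + 1"]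
        by (simp add: Qint sets)
    qed
    have "Q \<mu> = Q \<nu>"
    proof (rule Levy_uniqueness)
      show "real_distribution (Q \<mu>)" "real_distribution (Q \<nu>)"
        using Qdist sets L nn by auto
      show "char (Q \<mu>) = char (Q \<nu>)"
        using Qdist sets L nn Qbnd moments by (auto simp: fun_eq_iff char_eq_moments)
    qed
    then show ?thesis
      using recover[OF sets(1)] recover[OF sets(2)] by simp
  qed
qed

section \<open>The kernel of a subordinator\<close>

lemma nn_integral_exp_Ioc:
  assumes l: "0 < (l::real)" and x: "0 \<le> x"
  shows "(\<integral>\<^sup>+s. ennreal (exp (- l * s)) * indicator {0<..x} s \<partial>lborel) = ennreal ((1 - exp (- l * x)) / l)"
proof -
  have "(\<integral>\<^sup>+s. ennreal (exp (- l * s)) * indicator {0<..x} s \<partial>lborel) =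
      (\<integral>\<^sup>+s. ennreal (exp (- l * s)) * indicator {0..x} s \<partial>lborel)"
    using AE_lborel_singleton[of "0::real"] by (intro nn_integral_cong_AE) (auto simp: indicator_def)
  also have "\<dots> = ennreal (- exp (- l * x) / l - - exp (- l * 0) / l)"
    using l x by (intro nn_integral_FTC_Icc) (auto intro!: derivative_eq_intros)
  also have "- exp (- l * x) / l - - exp (- l * 0) / l = (1 - exp (- l * x)) / l"
    by (simp add: diff_divide_distrib)
  finally show ?thesis .
qed

lemma nn_integral_exp_Ioo:
  assumes l: "0 < (l::real)" and x: "0 \<le> x"
  shows "(\<integral>\<^sup>+s. ennreal (exp (- l * s)) * indicator {0<..<x} s \<partial>lborel) = ennreal ((1 - exp (- l * x)) / l)"
proof -
  have "(\<integral>\<^sup>+s. ennreal (exp (- l * s)) * indicator {0<..<x} s \<partial>lborel) =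
      (\<integral>\<^sup>+s. ennreal (exp (- l * s)) * indicator {0<..x} s \<partial>lborel)"
    using AE_lborel_singleton[of x] by (intro nn_integral_cong_AE) (auto simp: indicator_def)
  then show ?thesis
    using nn_integral_exp_Ioc[OF assms] by simp
qed

locale levy_measure =
  fixes \<sigma> :: "real measure"
  assumes levy: "infinite_levy_measure \<sigma>"
begin

lemma sets_levy [simp, measurable_cong]: "sets \<sigma> = sets borel"
  using levy by (simp add: infinite_levy_measure_def)

lemma emeasure_tail_finite:
  assumes t: "0 < t"
  shows "emeasure \<sigma> {t<..} < \<infinity>"
proof -
  have "ennreal (min 1 t) * emeasure \<sigma> {t<..} = (\<integral>\<^sup>+\<tau>. ennreal (min 1 t) * indicator {t<..} \<tau> \<partial>\<sigma>)"
    by (simp add: nn_integral_cmult)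
  also have "\<dots> \<le> (\<integral>\<^sup>+\<tau>\<in>{0<..}. ennreal (min 1 \<tau>) \<partial>\<sigma>)"
    using t by (intro nn_integral_mono) (auto simp: indicator_def intro!: ennreal_leI)
  also have "\<dots> < \<infinity>"
    using levy by (simp add: infinite_levy_measure_def)
  finally show ?thesis
    using t by (auto simp: ennreal_mult_less_top less_top[symmetric] ennreal_mult_eq_top_iff)
qed

lemma sigma_finite_levy: "sigma_finite_measure \<sigma>"
proof
  let ?A = "insert {..0::real} (range (\<lambda>n::nat. {1 / real (Suc n)<..}))"
  have cover: "x \<in> \<Union> ?A" for x :: real
  proof (cases "x \<le> 0")
    case False
    then obtain n where "1 / real (Suc n) < x"
      using nat_approx_posE[of x] by auto
    then show ?thesis by auto
  qed simp
  moreover have "emeasure \<sigma> a \<noteq> \<infinity>" if "a \<in> ?A" for a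
    using that levy emeasure_tail_finite by (auto simp: infinite_levy_measure_def less_top)
  moreover have "space \<sigma> = UNIV"
    using sets_eq_imp_space_eq[OF sets_levy] by simp
  ultimately have fin: "\<forall>a\<in>?A. emeasure \<sigma> a \<noteq> \<infinity>" and sp: "space \<sigma> = UNIV"
    by blast+
  have "countable ?A" by simp
  moreover have "?A \<subseteq> sets \<sigma>" by (auto simp del: of_nat_Suc)
  moreover have "\<Union> ?A = space \<sigma>" unfolding sp using cover by blast
  ultimately show "\<exists>A. countable A \<and> A \<subseteq> sets \<sigma> \<and> \<Union> A = space \<sigma> \<and> (\<forall>a\<in>A. emeasure \<sigma> a \<noteq> \<infinity>)"
    using fin by blast
qed

lemma borel_measurable_tail [measurable]: "(\<lambda>t. emeasure \<sigma> {t<..}) \<in> borel_measurable borel"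
proof -
  interpret sigma_finite_measure \<sigma> by (rule sigma_finite_levy)
  have "(\<lambda>t. \<integral>\<^sup>+\<tau>. indicator {p. fst p < snd p} (t, \<tau>) \<partial>\<sigma>) \<in> borel_measurable borel"
    by measurable
  moreover have "(\<integral>\<^sup>+\<tau>. indicator {p. fst p < snd p} (t, \<tau>) \<partial>\<sigma>) = emeasure \<sigma> {t<..}" for t
  proof -
    have "(\<integral>\<^sup>+\<tau>. indicator {p. fst p < snd p} (t, \<tau>) \<partial>\<sigma>) = (\<integral>\<^sup>+\<tau>. indicator {t<..} \<tau> \<partial>\<sigma>)"
      by (intro nn_integral_cong) (simp add: indicator_def)
    then show ?thesis by simp
  qed
  ultimately show ?thesis by simp
qed

lemma borel_measurable_kernel [measurable]: "kernel \<sigma> \<in> borel_measurable borel"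
  unfolding kernel_def[abs_def] measure_def by measurable

lemma kernel_nonneg: "0 \<le> kernel \<sigma> t"
  by (simp add: kernel_def)

lemma ennreal_kernel: "0 < t \<Longrightarrow> ennreal (kernel \<sigma> t) = emeasure \<sigma> {t<..}"
  using emeasure_tail_finite[of t] by (simp add: kernel_def emeasure_eq_ennreal_measure less_top)

text \<open>The integrand is at most \<open>l * \<tau>\<close> for small \<open>\<tau>\<close> and
  at most 1 otherwise, thus at most \<open>max 1 l * min 1 \<tau>\<close>. So the Bochner integral
  in \<open>laplace_exponent\<close> is a genuine one and not the default value 0.\<close>

lemma laplace_exponent_nn_integral:
  assumes l: "0 < l"
  shows "0 \<le> laplace_exponent \<sigma> l"
    and "ennreal (laplace_exponent \<sigma> l) = (\<integral>\<^sup>+\<tau>\<in>{0<..}. ennreal (1 - exp (- l * \<tau>)) \<partial>\<sigma>)"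
proof -
  let ?f = "\<lambda>\<tau>. indicator {0<..} \<tau> * (1 - exp (- l * \<tau>))"
  have le: "1 - exp (- l * \<tau>) \<le> max 1 l * min 1 \<tau>" if "0 < \<tau>" for \<tau>
  proof (cases "\<tau> \<le> 1")
    case True
    have "1 - exp (- l * \<tau>) \<le> l * \<tau>"
      using exp_ge_add_one_self[of "- l * \<tau>"] by simp
    also have "\<dots> \<le> max 1 l * \<tau>"
      using that by (intro mult_right_mono) auto
    finally show ?thesis using True by (simp add: min_def)
  next
    case False
    have "1 - exp (- l * \<tau>) \<le> 1" by simp
    also have "1 \<le> max 1 l * min 1 \<tau>" using False by (simp add: min_def)
    finally show ?thesis .
  qed
  have nn: "0 \<le> ?f \<tau>" for \<tau>
    using l by (auto simp: indicator_def)
  have eq: "(\<integral>\<^sup>+\<tau>. ennreal (?f \<tau>) \<partial>\<sigma>) = (\<integral>\<^sup>+\<tau>\<in>{0<..}. ennreal (1 - exp (- l * \<tau>)) \<partial>\<sigma>)"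
    by (intro nn_integral_cong) (auto simp: indicator_def)
  have "(\<integral>\<^sup>+\<tau>. ennreal (?f \<tau>) \<partial>\<sigma>) \<le> (\<integral>\<^sup>+\<tau>. ennreal (max 1 l) * (ennreal (min 1 \<tau>) * indicator {0<..} \<tau>) \<partial>\<sigma>)"
    using le l by (intro nn_integral_mono) (auto simp: indicator_def ennreal_mult[symmetric] intro!: ennreal_leI)
  also have "\<dots> = ennreal (max 1 l) * (\<integral>\<^sup>+\<tau>\<in>{0<..}. ennreal (min 1 \<tau>) \<partial>\<sigma>)"
    by (rule nn_integral_cmult) measurable
  also have "\<dots> < \<infinity>"
    using levy by (simp add: infinite_levy_measure_def ennreal_mult_less_top)
  finally have int: "integrable \<sigma> ?f"
    using nn by (intro integrableI_bounded) auto
  have lap: "laplace_exponent \<sigma> l = (\<integral>\<tau>. ?f \<tau> \<partial>\<sigma>)"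
    by (simp add: laplace_exponent_def set_lebesgue_integral_def)
  show "0 \<le> laplace_exponent \<sigma> l"
    unfolding lap by (rule integral_nonneg_AE) (use nn in auto)
  show "ennreal (laplace_exponent \<sigma> l) = (\<integral>\<^sup>+\<tau>\<in>{0<..}. ennreal (1 - exp (- l * \<tau>)) \<partial>\<sigma>)"
    unfolding lap using nn_integral_eq_integral[OF int] nn eq by simp
qed

text \<open>A vanishing exponent would force \<open>\<sigma>\<close> to give no mass to the positive
  half-line, whereas that mass is infinite. Positivity is what drives the paths of the subordinator
  to infinity.\<close>

lemma laplace_exponent_pos:
  assumes l: "0 < l"
  shows "0 < laplace_exponent \<sigma> l"
proof (rule ccontr)
  assume "\<not> ?thesis"
  then have "(\<integral>\<^sup>+\<tau>\<in>{0<..}. ennreal (1 - exp (- l * \<tau>)) \<partial>\<sigma>) = 0"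
    using laplace_exponent_nn_integral[OF l] by (simp add: ennreal_neg)
  then have "AE \<tau> in \<sigma>. ennreal (1 - exp (- l * \<tau>)) * indicator {0<..} \<tau> = 0"
    by (subst (asm) nn_integral_0_iff_AE) auto
  then have "AE \<tau> in \<sigma>. \<not> (\<tau> \<in> {0<..})"
  proof eventually_elim
    case (elim \<tau>)
    show ?case
    proof
      assume "\<tau> \<in> {0<..}"
      then have "0 < l * \<tau>" using l by simp
      then show False using elim \<open>\<tau> \<in> {0<..}\<close> by (simp add: ennreal_eq_0_iff)
    qed
  qed
  then have "emeasure \<sigma> {0<..} = 0"
    by (subst (asm) AE_iff_measurable[OF _ refl]) (auto simp: sets_eq_imp_space_eq[OF sets_levy] greaterThan_def)
  then show False
    using levy by (simp add: infinite_levy_measure_def)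
qed

text \<open>This is \<open>\<Phi>(l) = l K(l)\<close>, by Tonelli over the region
  \<open>0 < s < \<tau>\<close>: integration over \<open>\<tau>\<close> first gives the kernel, over
  \<open>s\<close> first the integrand of the exponent.\<close>

lemma nn_integral_exp_kernel:
  assumes l: "0 < l"
  shows "(\<integral>\<^sup>+s. ennreal (exp (- l * s)) * (ennreal (kernel \<sigma> s) * indicator {0<..} s) \<partial>lborel) =
         ennreal (laplace_exponent \<sigma> l / l)"
proof -
  interpret sigma_finite_measure \<sigma> by (rule sigma_finite_levy)
  interpret pair_sigma_finite "lborel :: real measure" \<sigma> ..
  let ?g = "\<lambda>s \<tau>. ennreal (exp (- l * s)) * indicator {0<..<\<tau>} s"
  have g_eq: "?g = (\<lambda>s \<tau>. ennreal (exp (- l * s)) * (indicator {0<..} s * indicator {p. fst p < snd p} (s, \<tau>)))"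
    by (auto simp: fun_eq_iff indicator_def)
  have meas: "(\<lambda>(s, \<tau>). ?g s \<tau>) \<in> borel_measurable (lborel \<Otimes>\<^sub>M \<sigma>)"
    unfolding g_eq by measurable
  have "ennreal (exp (- l * s)) * (ennreal (kernel \<sigma> s) * indicator {0<..} s) = (\<integral>\<^sup>+\<tau>. ?g s \<tau> \<partial>\<sigma>)" for s
  proof (cases "0 < s")
    case True
    have "(\<integral>\<^sup>+\<tau>. ?g s \<tau> \<partial>\<sigma>) = (\<integral>\<^sup>+\<tau>. ennreal (exp (- l * s)) * indicator {s<..} \<tau> \<partial>\<sigma>)"
      using True by (intro nn_integral_cong) (auto simp: indicator_def)
    also have "\<dots> = ennreal (exp (- l * s)) * emeasure \<sigma> {s<..}"
      by (simp add: nn_integral_cmult)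
    finally show ?thesis
      using True by (simp add: ennreal_kernel)
  qed simp
  then have "(\<integral>\<^sup>+s. ennreal (exp (- l * s)) * (ennreal (kernel \<sigma> s) * indicator {0<..} s) \<partial>lborel) =
      (\<integral>\<^sup>+s. \<integral>\<^sup>+\<tau>. ?g s \<tau> \<partial>\<sigma> \<partial>lborel)"
    by simp
  also have "\<dots> = (\<integral>\<^sup>+\<tau>. \<integral>\<^sup>+s. ?g s \<tau> \<partial>lborel \<partial>\<sigma>)"
    by (rule Fubini'[OF meas, symmetric])
  also have "\<dots> = (\<integral>\<^sup>+\<tau>. ennreal (1 / l) * (ennreal (1 - exp (- l * \<tau>)) * indicator {0<..} \<tau>) \<partial>\<sigma>)"
  proof (intro nn_integral_cong)
    fix \<tau>
    show "(\<integral>\<^sup>+s. ?g s \<tau> \<partial>lborel) = ennreal (1 / l) * (ennreal (1 - exp (- l * \<tau>)) * indicator {0<..} \<tau>)"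
    proof (cases "0 < \<tau>")
      case True
      then have "0 \<le> 1 - exp (- l * \<tau>)" using l by simp
      then have "ennreal ((1 - exp (- l * \<tau>)) / l) = ennreal (1 / l) * ennreal (1 - exp (- l * \<tau>))"
        using l by (simp flip: ennreal_mult)
      then show ?thesis
        using True nn_integral_exp_Ioo[OF l, of \<tau>] by simp
    qed simp
  qed
  also have "\<dots> = ennreal (1 / l) * (\<integral>\<^sup>+\<tau>\<in>{0<..}. ennreal (1 - exp (- l * \<tau>)) \<partial>\<sigma>)"
    by (rule nn_integral_cmult) measurable
  also have "\<dots> = ennreal (1 / l * laplace_exponent \<sigma> l)"
    unfolding laplace_exponent_nn_integral(2)[OF l, symmetric]
    using l laplace_exponent_nn_integral(1)[OF l] by (intro ennreal_mult[symmetric]) auto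
  also have "1 / l * laplace_exponent \<sigma> l = laplace_exponent \<sigma> l / l"
    by simp
  finally show ?thesis .
qed

end

locale admissible_levy_measure = levy_measure +
  assumes adm: "admissible_kernel \<sigma>"
begin

lemma integrable_kernel: "0 < T \<Longrightarrow> set_integrable lborel {0<..T} (kernel \<sigma>)"
  using adm by (simp add: admissible_kernel_def)

lemma nn_integral_kernel:
  "(\<integral>\<^sup>+s. ennreal (kernel \<sigma> s) * indicator {0<..T} s \<partial>lborel) = ennreal (kernel_primitive \<sigma> T)"
proof (cases "0 < T")
  case True
  have "(\<integral>\<^sup>+s. ennreal (kernel \<sigma> s) * indicator {0<..T} s \<partial>lborel) =
      (\<integral>\<^sup>+s. ennreal (indicator {0<..T} s *\<^sub>R kernel \<sigma> s) \<partial>lborel)"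
    by (intro nn_integral_cong) (auto simp: indicator_def)
  also have "\<dots> = ennreal (kernel_primitive \<sigma> T)"
    unfolding kernel_primitive_def set_lebesgue_integral_def
    using integrable_kernel[OF True] kernel_nonneg unfolding set_integrable_def
    by (intro nn_integral_eq_integral) auto
  finally show ?thesis .
qed (simp add: kernel_primitive_def set_lebesgue_integral_def)

lemma kernel_primitive_nonneg: "0 \<le> kernel_primitive \<sigma> t"
  unfolding kernel_primitive_def set_lebesgue_integral_def
  by (rule integral_nonneg_AE) (auto simp: kernel_nonneg)

lemma kernel_primitive_mono:
  assumes "s \<le> t"
  shows "kernel_primitive \<sigma> s \<le> kernel_primitive \<sigma> t"
proof -
  have "ennreal (kernel_primitive \<sigma> s) \<le> ennreal (kernel_primitive \<sigma> t)"
    unfolding nn_integral_kernel[symmetric] using assms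
    by (intro nn_integral_mono) (auto simp: indicator_def)
  then show ?thesis
    by (simp add: kernel_primitive_nonneg)
qed

lemma borel_measurable_kernel_primitive [measurable]: "kernel_primitive \<sigma> \<in> borel_measurable borel"
  by (rule borel_measurable_mono) (simp add: mono_def kernel_primitive_mono)

text \<open>The curve \<open>(t - c, t)\<close> converges along the filter of the slow variation
  condition in \<open>admissible_kernel\<close>, since \<open>(t - c) / t\<close> tends to
  1.\<close>

lemma kernel_primitive_shift:
  "((\<lambda>t. kernel_primitive \<sigma> (t - c) * inverse (kernel_primitive \<sigma> t)) \<longlongrightarrow> 1) at_top"
proof -
  have lim: "((\<lambda>(t, r). kernel_primitive \<sigma> t * inverse (kernel_primitive \<sigma> r)) \<longlongrightarrow> 1)
        (inf (at_top \<times>\<^sub>F at_top) (filtercomap (\<lambda>(t, r). t / r) (nhds 1)))"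
    using adm by (simp add: admissible_kernel_def)
  have sub: "filterlim (\<lambda>t::real. t - c) at_top at_top"
    using filterlim_tendsto_add_at_top[OF tendsto_const[of "- c"] filterlim_ident] by simp
  have "((\<lambda>t::real. 1 - c / t) \<longlongrightarrow> 1 - 0) at_top"
    by (intro tendsto_diff tendsto_const tendsto_divide_0[OF tendsto_const]
        filterlim_at_top_imp_at_infinity filterlim_ident)
  moreover have "\<forall>\<^sub>F t in at_top. 1 - c / t = (t - c) / t"
    using eventually_gt_at_top[of "0::real"] by eventually_elim (simp add: field_simps)
  ultimately have "((\<lambda>t::real. (t - c) / t) \<longlongrightarrow> 1) at_top"
    using Lim_transform_eventually by fastforce
  then have "filterlim (\<lambda>t. (t - c, t)) (inf (at_top \<times>\<^sub>F at_top) (filtercomap (\<lambda>(t, r). t / r) (nhds 1))) at_top"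
    unfolding filterlim_inf filterlim_filtercomap_iff
    by (intro conjI filterlim_Pair sub filterlim_ident) (simp add: comp_def)
  from filterlim_compose[OF lim this] show ?thesis
    by simp
qed

end

section \<open>The occupation measure of the inverse subordinator\<close>

locale admissible_subordinator = subordinator M S \<sigma>
  for M :: "'w measure" and S :: "real \<Rightarrow> 'w \<Rightarrow> real" and \<sigma> :: "real measure" +
  assumes admissible: "admissible_kernel \<sigma>"

sublocale admissible_subordinator \<subseteq> admissible_levy_measure \<sigma>
  by unfold_locales (rule levy_measure, rule admissible)

context admissible_subordinator
begin

lemma S_mono: "\<omega> \<in> space M \<Longrightarrow> 0 \<le> r \<Longrightarrow> r \<le> t \<Longrightarrow> S r \<omega> \<le> S t \<omega>"
  using increasing[of \<omega>] by (auto simp: mono_on_def)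

lemma S_nonneg: "\<omega> \<in> space M \<Longrightarrow> 0 \<le> t \<Longrightarrow> 0 \<le> S t \<omega>"
  using S_mono[of \<omega> 0 t] start_zero[of \<omega>] by simp

lemma S_right: "\<omega> \<in> space M \<Longrightarrow> 0 \<le> t \<Longrightarrow> ((\<lambda>s. S s \<omega>) \<longlongrightarrow> S t \<omega>) (at_right t)"
  using right_continuous[of \<omega> t] by (simp add: continuous_within)

lemma measurable_S_pair [measurable]: "(\<lambda>p. S (max 0 (fst p)) (snd p)) \<in> borel_measurable (borel \<Otimes>\<^sub>M M)"
  using borel_measurable_right_continuous[of S M] measurable_S S_right by (simp add: split_beta')

lemma nn_integral_exp_S:
  assumes "0 \<le> t" "0 \<le> l"
  shows "(\<integral>\<^sup>+\<omega>. ennreal (exp (- l * S t \<omega>)) \<partial>M) = ennreal (exp (- t * laplace_exponent \<sigma> l))"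
proof -
  have "integrable M (\<lambda>\<omega>. exp (- l * S t \<omega>))"
    using measurable_S[OF assms(1)] assms S_nonneg by (intro integrable_const_bound[of _ 1]) auto
  then show ?thesis
    using laplace_transform[OF assms] by (subst nn_integral_eq_integral) auto
qed

text \<open>For \<open>s > 0\<close> this is \<open>P(S \<tau> \<ge> s)\<close>. The cut at 0 makes
  it a density carried by the positive half-line, as the uniqueness theorem for Laplace transforms
  requires.\<close>

definition survival :: "real \<Rightarrow> real \<Rightarrow> ennreal" where
  "survival \<tau> s = (\<integral>\<^sup>+\<omega>. indicator {0<..S \<tau> \<omega>} s \<partial>M)"

definition positive_kernel :: "real \<Rightarrow> ennreal" where
  "positive_kernel u = ennreal (kernel \<sigma> u) * indicator {0<..} u"

lemma borel_measurable_positive_kernel [measurable]: "positive_kernel \<in> borel_measurable borel"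
  unfolding positive_kernel_def[abs_def] by measurable

text \<open>The integral of \<open>E[k(s - S r)]\<close> over \<open>r\<close> in
  \<open>[0, \<tau>]\<close>, that is, the kernel convolved with the potential measure of
  \<open>S\<close> up to time \<open>\<tau>\<close>. The \<open>max 0\<close> confines the process
  to the times at which it is controlled.\<close>

definition potential :: "real \<Rightarrow> real \<Rightarrow> ennreal" where
  "potential \<tau> s = (\<integral>\<^sup>+p. positive_kernel (s - S (max 0 (fst p)) (snd p)) * indicator {0..\<tau>} (fst p) \<partial>(lborel \<Otimes>\<^sub>M M))"

lemma measurable_survival_pair:
  assumes "0 \<le> \<tau>"
  shows "(\<lambda>(s, \<omega>). indicator {0<..S \<tau> \<omega>} s :: ennreal) \<in> borel_measurable (borel \<Otimes>\<^sub>M M)"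
proof -
  note [measurable] = measurable_S[OF assms]
  have "(\<lambda>p. if 0 < fst p \<and> fst p \<le> S \<tau> (snd p) then 1 else 0 :: ennreal) \<in> borel_measurable (borel \<Otimes>\<^sub>M M)"
    by measurable
  also have "(\<lambda>p. if 0 < fst p \<and> fst p \<le> S \<tau> (snd p) then 1 else 0 :: ennreal) = (\<lambda>(s, \<omega>). indicator {0<..S \<tau> \<omega>} s)"
    by (auto simp: fun_eq_iff indicator_def)
  finally show ?thesis .
qed

lemma borel_measurable_survival:
  assumes "0 \<le> \<tau>"
  shows "survival \<tau> \<in> borel_measurable borel"
  unfolding survival_def[abs_def] using measurable_survival_pair[OF assms]
  by (rule borel_measurable_nn_integral)

lemma sigma_finite_lborel_M: "sigma_finite_measure ((lborel :: real measure) \<Otimes>\<^sub>M M)"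
proof -
  interpret pair_sigma_finite "lborel :: real measure" M ..
  show ?thesis by (rule P.sigma_finite_measure_axioms)
qed

lemma measurable_potential_pair:
  "(\<lambda>(s, p). positive_kernel (s - S (max 0 (fst p)) (snd p)) * indicator {0..\<tau>} (fst p))
     \<in> borel_measurable (lborel \<Otimes>\<^sub>M (lborel \<Otimes>\<^sub>M M))"
proof -
  have [measurable]: "(\<lambda>p. S (max 0 (fst p)) (snd p)) \<in> borel_measurable (lborel \<Otimes>\<^sub>M M)"
    using measurable_S_pair by (simp cong: measurable_cong_sets sets_pair_measure_cong)
  have [measurable]: "(\<lambda>q. S (max 0 (fst (snd q))) (snd (snd q))) \<in> borel_measurable (lborel \<Otimes>\<^sub>M (lborel \<Otimes>\<^sub>M M))"
    by (rule measurable_compose[OF measurable_snd]) measurable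
  show ?thesis
    unfolding split_beta' by measurable
qed

lemma borel_measurable_potential: "potential \<tau> \<in> borel_measurable borel"
proof -
  interpret sigma_finite_measure "(lborel :: real measure) \<Otimes>\<^sub>M M" by (rule sigma_finite_lborel_M)
  have "potential \<tau> \<in> borel_measurable lborel"
    unfolding potential_def[abs_def] using measurable_potential_pair
    by (rule borel_measurable_nn_integral)
  then show ?thesis by simp
qed

text \<open>Tonelli turns the left side into the expectation of the integral of
  \<open>exp (- l * s)\<close> over \<open>(0, S \<tau>]\<close>.\<close>

lemma laplace_survival:
  assumes \<tau>: "0 \<le> \<tau>" and l: "0 < l"
  shows "(\<integral>\<^sup>+s. ennreal (exp (- l * s)) * survival \<tau> s \<partial>lborel) =
         ennreal ((1 - exp (- \<tau> * laplace_exponent \<sigma> l)) / l)"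
proof -
  interpret pair_sigma_finite "lborel :: real measure" M ..
  note [measurable] = measurable_survival_pair[OF \<tau>] measurable_S[OF \<tau>]
  have m1: "(\<lambda>\<omega>. indicator {0<..S \<tau> \<omega>} s :: ennreal) \<in> borel_measurable M" for s
    using measurable_compose[OF measurable_Pair1'[of s borel M] measurable_survival_pair[OF \<tau>]] by simp
  have m2: "(\<lambda>(s, \<omega>). ennreal (exp (- l * s)) * indicator {0<..S \<tau> \<omega>} s) \<in> borel_measurable (lborel \<Otimes>\<^sub>M M)"
  proof -
    have [measurable]: "(\<lambda>p. indicator {0<..S \<tau> (snd p)} (fst p) :: ennreal) \<in> borel_measurable (lborel \<Otimes>\<^sub>M M)"
      using measurable_survival_pair[OF \<tau>] by (simp add: split_beta' cong: measurable_cong_sets sets_pair_measure_cong)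
    show ?thesis unfolding split_beta' by measurable
  qed
  have "(\<integral>\<^sup>+s. ennreal (exp (- l * s)) * survival \<tau> s \<partial>lborel) =
      (\<integral>\<^sup>+s. \<integral>\<^sup>+\<omega>. ennreal (exp (- l * s)) * indicator {0<..S \<tau> \<omega>} s \<partial>M \<partial>lborel)"
    unfolding survival_def by (intro nn_integral_cong nn_integral_cmult[symmetric] m1)
  also have "\<dots> = (\<integral>\<^sup>+\<omega>. \<integral>\<^sup>+s. ennreal (exp (- l * s)) * indicator {0<..S \<tau> \<omega>} s \<partial>lborel \<partial>M)"
    by (rule Fubini'[OF m2, symmetric])
  also have "\<dots> = (\<integral>\<^sup>+\<omega>. ennreal ((1 - exp (- l * S \<tau> \<omega>)) / l) \<partial>M)"
    using l \<tau> S_nonneg by (intro nn_integral_cong nn_integral_exp_Ioc) auto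
  also have "\<dots> = ennreal (\<integral>\<omega>. (1 - exp (- l * S \<tau> \<omega>)) / l \<partial>M)"
  proof (rule nn_integral_eq_integral)
    show "AE \<omega> in M. 0 \<le> (1 - exp (- l * S \<tau> \<omega>)) / l"
      using l \<tau> S_nonneg by auto
    show "integrable M (\<lambda>\<omega>. (1 - exp (- l * S \<tau> \<omega>)) / l)"
      using l \<tau> S_nonneg by (intro integrable_const_bound[of _ "1 / l"]) (auto simp: divide_right_mono)
  qed
  also have "(\<integral>\<omega>. (1 - exp (- l * S \<tau> \<omega>)) / l \<partial>M) = (1 - exp (- \<tau> * laplace_exponent \<sigma> l)) / l"
  proof -
    have "integrable M (\<lambda>\<omega>. exp (- l * S \<tau> \<omega>))"
      using l \<tau> S_nonneg by (intro integrable_const_bound[of _ 1]) auto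
    then show ?thesis
      using laplace_transform[of \<tau> l] l \<tau> prob_space by simp
  qed
  finally show ?thesis .
qed

text \<open>Tonelli and the translation \<open>s = S r + u\<close>. A general weight
  \<open>w\<close> covers both uses: the exponential for the Laplace transform, and the indicator of
  \<open>{..t}\<close> for the occupation density.\<close>

lemma nn_integral_potential:
  assumes [measurable]: "w \<in> borel_measurable borel"
  shows "(\<integral>\<^sup>+s. w s * potential \<tau> s \<partial>lborel) =
    (\<integral>\<^sup>+r. (\<integral>\<^sup>+\<omega>. (\<integral>\<^sup>+u. w (S (max 0 r) \<omega> + u) * positive_kernel u \<partial>lborel) \<partial>M) * indicator {0..\<tau>} r \<partial>lborel)"
proof -
  interpret N: sigma_finite_measure "(lborel :: real measure) \<Otimes>\<^sub>M M" by (rule sigma_finite_lborel_M)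
  interpret pair_sigma_finite "lborel :: real measure" "(lborel :: real measure) \<Otimes>\<^sub>M M" ..
  let ?Y = "\<lambda>p. S (max 0 (fst p)) (snd p)"
  have [measurable]: "?Y \<in> borel_measurable (lborel \<Otimes>\<^sub>M M)"
    using measurable_S_pair by (simp cong: measurable_cong_sets sets_pair_measure_cong)
  have [measurable]: "(\<lambda>q. S (max 0 (fst (snd q))) (snd (snd q))) \<in> borel_measurable (lborel \<Otimes>\<^sub>M (lborel \<Otimes>\<^sub>M M))"
    by (rule measurable_compose[OF measurable_snd]) measurable
  have m: "(\<lambda>(s, p). w s * (positive_kernel (s - ?Y p) * indicator {0..\<tau>} (fst p))) \<in> borel_measurable (lborel \<Otimes>\<^sub>M (lborel \<Otimes>\<^sub>M M))"
    unfolding split_beta' by measurable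
  have "(\<integral>\<^sup>+s. w s * potential \<tau> s \<partial>lborel) =
      (\<integral>\<^sup>+s. \<integral>\<^sup>+p. w s * (positive_kernel (s - ?Y p) * indicator {0..\<tau>} (fst p)) \<partial>(lborel \<Otimes>\<^sub>M M) \<partial>lborel)"
    unfolding potential_def by (intro nn_integral_cong nn_integral_cmult[symmetric]) measurable
  also have "\<dots> = (\<integral>\<^sup>+p. \<integral>\<^sup>+s. w s * (positive_kernel (s - ?Y p) * indicator {0..\<tau>} (fst p)) \<partial>lborel \<partial>(lborel \<Otimes>\<^sub>M M))"
    by (rule Fubini'[OF m, symmetric])
  also have "\<dots> = (\<integral>\<^sup>+p. (\<integral>\<^sup>+u. w (?Y p + u) * positive_kernel u \<partial>lborel) * indicator {0..\<tau>} (fst p) \<partial>(lborel \<Otimes>\<^sub>M M))"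
  proof (intro nn_integral_cong)
    fix p
    have "(\<integral>\<^sup>+s. w s * (positive_kernel (s - ?Y p) * indicator {0..\<tau>} (fst p)) \<partial>lborel) =
        (\<integral>\<^sup>+s. w s * positive_kernel (s - ?Y p) * indicator {0..\<tau>} (fst p) \<partial>lborel)"
      by (simp add: mult.assoc)
    also have "\<dots> = (\<integral>\<^sup>+s. w s * positive_kernel (s - ?Y p) \<partial>lborel) * indicator {0..\<tau>} (fst p)"
      by (rule nn_integral_multc) measurable
    also have "(\<integral>\<^sup>+s. w s * positive_kernel (s - ?Y p) \<partial>lborel) = (\<integral>\<^sup>+u. w (?Y p + u) * positive_kernel u \<partial>lborel)"
      by (subst nn_integral_real_affine[where c=1 and t="?Y p"]) auto
    finally show "(\<integral>\<^sup>+s. w s * (positive_kernel (s - ?Y p) * indicator {0..\<tau>} (fst p)) \<partial>lborel) =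
        (\<integral>\<^sup>+u. w (?Y p + u) * positive_kernel u \<partial>lborel) * indicator {0..\<tau>} (fst p)" .
  qed
  also have "\<dots> = (\<integral>\<^sup>+r. (\<integral>\<^sup>+\<omega>. (\<integral>\<^sup>+u. w (S (max 0 r) \<omega> + u) * positive_kernel u \<partial>lborel) * indicator {0..\<tau>} r \<partial>M) \<partial>lborel)"
  proof -
    have "(\<lambda>p. (\<integral>\<^sup>+u. w (?Y p + u) * positive_kernel u \<partial>lborel) * indicator {0..\<tau>} (fst p)) \<in> borel_measurable (lborel \<Otimes>\<^sub>M M)"
      by measurable
    from sigma_finite_measure.nn_integral_fst[OF prob_space_imp_sigma_finite[OF prob_space_axioms] this, symmetric]
    show ?thesis by simp
  qed
  also have "\<dots> = (\<integral>\<^sup>+r. (\<integral>\<^sup>+\<omega>. (\<integral>\<^sup>+u. w (S (max 0 r) \<omega> + u) * positive_kernel u \<partial>lborel) \<partial>M) * indicator {0..\<tau>} r \<partial>lborel)"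
  proof (intro nn_integral_cong nn_integral_multc)
    fix r
    have [measurable]: "S (max 0 r) \<in> borel_measurable M" by (rule measurable_S) simp
    show "(\<lambda>\<omega>. \<integral>\<^sup>+u. w (S (max 0 r) \<omega> + u) * positive_kernel u \<partial>lborel) \<in> borel_measurable M"
      by measurable
  qed
  finally show ?thesis .
qed

text \<open>After the translation the exponential weight factors into
  \<open>exp (- l * S r)\<close>, with expectation \<open>exp (- r * \<Phi>)\<close>, and the
  transform \<open>\<Phi> / l\<close> of the kernel. The product has the antiderivative
  \<open>- exp (- r * \<Phi>) / l\<close> in \<open>r\<close>.\<close>

lemma laplace_potential:
  assumes \<tau>: "0 \<le> \<tau>" and l: "0 < l"
  shows "(\<integral>\<^sup>+s. ennreal (exp (- l * s)) * potential \<tau> s \<partial>lborel) =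
         ennreal ((1 - exp (- \<tau> * laplace_exponent \<sigma> l)) / l)"
proof -
  let ?\<Phi> = "laplace_exponent \<sigma> l"
  have \<Phi>: "0 \<le> ?\<Phi>" by (rule laplace_exponent_nn_integral(1)[OF l])
  have inner: "(\<integral>\<^sup>+u. ennreal (exp (- l * (y + u))) * positive_kernel u \<partial>lborel) = ennreal (exp (- l * y)) * ennreal (?\<Phi> / l)" for y
  proof -
    have "(\<integral>\<^sup>+u. ennreal (exp (- l * (y + u))) * positive_kernel u \<partial>lborel) =
        (\<integral>\<^sup>+u. ennreal (exp (- l * y)) * (ennreal (exp (- l * u)) * positive_kernel u) \<partial>lborel)"
      by (intro nn_integral_cong) (simp add: ring_distribs exp_add exp_diff mult.assoc[symmetric] flip: ennreal_mult exp_add)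
    also have "\<dots> = ennreal (exp (- l * y)) * (\<integral>\<^sup>+u. ennreal (exp (- l * u)) * positive_kernel u \<partial>lborel)"
      by (rule nn_integral_cmult) measurable
    finally show ?thesis
      unfolding positive_kernel_def nn_integral_exp_kernel[OF l] .
  qed
  have "(\<integral>\<^sup>+s. ennreal (exp (- l * s)) * potential \<tau> s \<partial>lborel) =
      (\<integral>\<^sup>+r. (\<integral>\<^sup>+\<omega>. ennreal (exp (- l * S (max 0 r) \<omega>)) * ennreal (?\<Phi> / l) \<partial>M) * indicator {0..\<tau>} r \<partial>lborel)"
    by (subst nn_integral_potential) (measurable, simp only: inner)
  also have "\<dots> = (\<integral>\<^sup>+r. ennreal (?\<Phi> / l * exp (- r * ?\<Phi>)) * indicator {0..\<tau>} r \<partial>lborel)"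
  proof (intro nn_integral_cong)
    fix r :: real
    show "(\<integral>\<^sup>+\<omega>. ennreal (exp (- l * S (max 0 r) \<omega>)) * ennreal (?\<Phi> / l) \<partial>M) * indicator {0..\<tau>} r =
        ennreal (?\<Phi> / l * exp (- r * ?\<Phi>)) * indicator {0..\<tau>} r"
    proof (cases "0 \<le> r")
      case True
      have [measurable]: "S r \<in> borel_measurable M" using True by (rule measurable_S)
      have "(\<integral>\<^sup>+\<omega>. ennreal (exp (- l * S r \<omega>)) * ennreal (?\<Phi> / l) \<partial>M) = ennreal (exp (- r * ?\<Phi>)) * ennreal (?\<Phi> / l)"
        using True l by (subst nn_integral_multc) (measurable, subst nn_integral_exp_S, auto)
      also have "\<dots> = ennreal (?\<Phi> / l * exp (- r * ?\<Phi>))"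
        using \<Phi> l by (subst ennreal_mult) (auto simp: mult.commute)
      finally show ?thesis using True by (simp add: max_def)
    qed simp
  qed
  also have "\<dots> = ennreal (- exp (- \<tau> * ?\<Phi>) / l - - exp (- 0 * ?\<Phi>) / l)"
    using l \<tau> \<Phi> by (intro nn_integral_FTC_Icc) (auto intro!: derivative_eq_intros)
  also have "- exp (- \<tau> * ?\<Phi>) / l - - exp (- 0 * ?\<Phi>) / l = (1 - exp (- \<tau> * ?\<Phi>)) / l"
    by (simp add: diff_divide_distrib)
  finally show ?thesis .
qed

text \<open>This is the \<open>t\<close>-derivative of Dynkin's formula
  \<open>E[min (S\<^sub>\<tau>) t] = \<integral>\<^sub>0\<^sup>\<tau> E[N(t - S\<^sub>r)] dr\<close>; comparing Laplace transforms in \<open>t\<close> avoids the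
  generator of \<open>S\<close>.\<close>

lemma survival_eq_potential:
  assumes \<tau>: "0 \<le> \<tau>"
  shows "density lborel (survival \<tau>) = density lborel (potential \<tau>)"
proof (rule laplace_transform_unique)
  note [measurable] = borel_measurable_survival[OF \<tau>] borel_measurable_potential
  have "survival \<tau> s = 0" if "s \<le> 0" for s
    using that by (simp add: survival_def indicator_def)
  then have "0 \<le> s" if "0 < survival \<tau> s" for s
    using that by (metis less_irrefl linear)
  then show "AE x in density lborel (survival \<tau>). 0 \<le> x"
    by (subst AE_density) auto
  have "potential \<tau> s = 0" if "s \<le> 0" for s
  proof -
    have "potential \<tau> s = (\<integral>\<^sup>+p. 0 \<partial>((lborel :: real measure) \<Otimes>\<^sub>M M))"
      unfolding potential_def
    proof (intro nn_integral_cong)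
      fix p assume "p \<in> space ((lborel :: real measure) \<Otimes>\<^sub>M M)"
      then have "0 \<le> S (max 0 (fst p)) (snd p)"
        by (intro S_nonneg) (auto simp: space_pair_measure)
      then show "positive_kernel (s - S (max 0 (fst p)) (snd p)) * indicator {0..\<tau>} (fst p) = 0"
        using that by (simp add: positive_kernel_def indicator_def)
    qed
    then show ?thesis by simp
  qed
  then have "0 \<le> s" if "0 < potential \<tau> s" for s
    using that by (metis less_irrefl linear)
  then show "AE x in density lborel (potential \<tau>). 0 \<le> x"
    by (subst AE_density) auto
  show "(\<integral>\<^sup>+x. ennreal (exp (- l * x)) \<partial>density lborel (survival \<tau>)) = (\<integral>\<^sup>+x. ennreal (exp (- l * x)) \<partial>density lborel (potential \<tau>))"
    if l: "0 < l" for l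
    using laplace_survival[OF \<tau> l] laplace_potential[OF \<tau> l]
    by (simp add: nn_integral_density mult.commute)
  show "(\<integral>\<^sup>+x. ennreal (exp (- x)) \<partial>density lborel (survival \<tau>)) < \<infinity>"
    using laplace_survival[OF \<tau>, of 1]
    by (simp add: nn_integral_density mult.commute)
qed simp_all

text \<open>As \<open>kernel_primitive\<close> integrates over \<open>{0<..t}\<close>, it is 0 at
  nonpositive arguments, so only paths with \<open>S r < t\<close> contribute.\<close>

definition occupation_density :: "real \<Rightarrow> real \<Rightarrow> real" where
  "occupation_density t r = (\<integral>\<omega>. kernel_primitive \<sigma> (t - S (max 0 r) \<omega>) \<partial>M)"

lemma integrable_kernel_primitive_S:
  "integrable M (\<lambda>\<omega>. kernel_primitive \<sigma> (t - S (max 0 r) \<omega>))"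
proof (rule integrable_const_bound[of _ "kernel_primitive \<sigma> t"])
  have [measurable]: "S (max 0 r) \<in> borel_measurable M" by (rule measurable_S) simp
  show "(\<lambda>\<omega>. kernel_primitive \<sigma> (t - S (max 0 r) \<omega>)) \<in> borel_measurable M" by measurable
  show "AE \<omega> in M. norm (kernel_primitive \<sigma> (t - S (max 0 r) \<omega>)) \<le> kernel_primitive \<sigma> t"
    using S_nonneg by (auto simp: kernel_primitive_nonneg intro!: kernel_primitive_mono)
qed

lemma borel_measurable_occupation_density [measurable]: "occupation_density t \<in> borel_measurable borel"
  unfolding occupation_density_def[abs_def] by measurable

lemma occupation_density_bounds:
  "0 \<le> occupation_density t r" "occupation_density t r \<le> kernel_primitive \<sigma> t"
proof -
  show "0 \<le> occupation_density t r"
    unfolding occupation_density_def by (rule integral_nonneg_AE) (auto simp: kernel_primitive_nonneg)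
  have "occupation_density t r \<le> (\<integral>\<omega>. kernel_primitive \<sigma> t \<partial>M)"
    unfolding occupation_density_def using integrable_kernel_primitive_S S_nonneg
    by (intro integral_mono) (auto intro!: kernel_primitive_mono)
  then show "occupation_density t r \<le> kernel_primitive \<sigma> t"
    by (simp add: prob_space)
qed

text \<open>Evaluating the two equal measures on \<open>{..t}\<close> returns from Laplace
  transforms to a statement at fixed \<open>t\<close>.\<close>

lemma nn_integral_survival:
  assumes \<tau>: "0 \<le> \<tau>"
  shows "(\<integral>\<^sup>+s. survival \<tau> s * indicator {..t} s \<partial>lborel) =
         (\<integral>\<^sup>+r. ennreal (occupation_density t r) * indicator {0..\<tau>} r \<partial>lborel)"
proof -
  note [measurable] = borel_measurable_survival[OF \<tau>] borel_measurable_potential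
  have "(\<integral>\<^sup>+s. survival \<tau> s * indicator {..t} s \<partial>lborel) = emeasure (density lborel (survival \<tau>)) {..t}"
    by (simp add: emeasure_density)
  also have "\<dots> = emeasure (density lborel (potential \<tau>)) {..t}"
    by (simp only: survival_eq_potential[OF \<tau>])
  also have "\<dots> = (\<integral>\<^sup>+s. indicator {..t} s * potential \<tau> s \<partial>lborel)"
    by (simp add: emeasure_density mult.commute)
  also have "\<dots> = (\<integral>\<^sup>+r. (\<integral>\<^sup>+\<omega>. (\<integral>\<^sup>+u. indicator {..t} (S (max 0 r) \<omega> + u) * positive_kernel u \<partial>lborel) \<partial>M) * indicator {0..\<tau>} r \<partial>lborel)"
    by (rule nn_integral_potential) measurable
  also have "\<dots> = (\<integral>\<^sup>+r. (\<integral>\<^sup>+\<omega>. ennreal (kernel_primitive \<sigma> (t - S (max 0 r) \<omega>)) \<partial>M) * indicator {0..\<tau>} r \<partial>lborel)"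
  proof -
    have "(\<integral>\<^sup>+u. indicator {..t} (y + u) * positive_kernel u \<partial>lborel) = ennreal (kernel_primitive \<sigma> (t - y))" for y
      unfolding nn_integral_kernel[symmetric] positive_kernel_def
      by (intro nn_integral_cong) (auto simp: indicator_def)
    then show ?thesis by simp
  qed
  also have "\<dots> = (\<integral>\<^sup>+r. ennreal (occupation_density t r) * indicator {0..\<tau>} r \<partial>lborel)"
    unfolding occupation_density_def
    by (subst nn_integral_eq_integral[OF integrable_kernel_primitive_S]) (auto simp: kernel_primitive_nonneg)
  finally show ?thesis .
qed

text \<open>For each path \<open>S r\<close> is a constant shift, to which
  \<open>kernel_primitive_shift\<close> applies. Monotonicity of the primitive bounds the quotients
  by 1, so the limit passes under the expectation.\<close>

lemma occupation_density_limit: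
  "((\<lambda>t. occupation_density t r * inverse (kernel_primitive \<sigma> t)) \<longlongrightarrow> 1) at_top"
proof -
  have [measurable]: "S (max 0 r) \<in> borel_measurable M" by (rule measurable_S) simp
  have "((\<lambda>t. \<integral>\<omega>. kernel_primitive \<sigma> (t - S (max 0 r) \<omega>) * inverse (kernel_primitive \<sigma> t) \<partial>M) \<longlongrightarrow> (\<integral>\<omega>. 1 \<partial>M)) at_top"
  proof (rule integral_dominated_convergence_at_top[where w="\<lambda>_. 1"])
    show "\<forall>\<^sub>F t in at_top. AE \<omega> in M. norm (kernel_primitive \<sigma> (t - S (max 0 r) \<omega>) * inverse (kernel_primitive \<sigma> t)) \<le> 1"
    proof (rule always_eventually, rule allI, rule AE_I2)
      fix t \<omega> assume \<omega>: "\<omega> \<in> space M"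
      have "kernel_primitive \<sigma> (t - S (max 0 r) \<omega>) \<le> kernel_primitive \<sigma> t"
        using S_nonneg[OF \<omega>] by (intro kernel_primitive_mono) simp
      then show "norm (kernel_primitive \<sigma> (t - S (max 0 r) \<omega>) * inverse (kernel_primitive \<sigma> t)) \<le> 1"
        using kernel_primitive_nonneg[of t] kernel_primitive_nonneg[of "t - S (max 0 r) \<omega>"]
        by (cases "kernel_primitive \<sigma> t = 0") (auto simp: divide_inverse[symmetric] divide_le_eq_1)
    qed
    show "AE \<omega> in M. ((\<lambda>t. kernel_primitive \<sigma> (t - S (max 0 r) \<omega>) * inverse (kernel_primitive \<sigma> t)) \<longlongrightarrow> 1) at_top"
      by (simp add: kernel_primitive_shift)
  qed auto
  then show ?thesis
    by (simp add: occupation_density_def prob_space)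
qed

end

section \<open>First passage times and the density of their occupation measure\<close>

lemma inverse_subordinator_nonneg: "0 \<le> inverse_subordinator S t \<omega>"
  unfolding inverse_subordinator_def by (auto intro!: cInf_greatest)

context admissible_subordinator
begin

text \<open>Right continuity carries \<open>s \<le> S t\<close> from all \<open>t > \<tau>\<close>
  down to \<open>\<tau>\<close>, so the infimum is attained. The second alternative describes the
  paths that never reach \<open>s\<close>, where the default value 0 satisfies the left side; by
  monotonicity integer times detect them, which keeps the condition countable.\<close>

lemma inverse_subordinator_le_iff:
  assumes \<omega>: "\<omega> \<in> space M" and \<tau>: "0 \<le> \<tau>"
  shows "inverse_subordinator S s \<omega> \<le> \<tau> \<longleftrightarrow> s \<le> S \<tau> \<omega> \<or> (\<forall>n::nat. S (real n) \<omega> < s)"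
proof (cases "\<exists>r\<ge>0. s \<le> S r \<omega>")
  case True
  let ?A = "{r. 0 \<le> r \<and> s \<le> S r \<omega>}"
  have inv: "inverse_subordinator S s \<omega> = Inf ?A"
    using True by (simp add: inverse_subordinator_def)
  have ne: "?A \<noteq> {}" and bdd: "bdd_below ?A"
    using True by (auto intro!: bdd_belowI[of _ 0])
  obtain r where r: "0 \<le> r" "s \<le> S r \<omega>" using True by auto
  obtain n :: nat where "r \<le> real n" using real_arch_simple by blast
  then have n: "\<not> S (real n) \<omega> < s"
    using S_mono[OF \<omega> r(1), of "real n"] r by simp
  have "s \<le> S \<tau> \<omega>" if le: "Inf ?A \<le> \<tau>"
  proof (rule tendsto_lowerbound[OF S_right[OF \<omega> \<tau>]])
    have "s \<le> S t \<omega>" if "\<tau> < t" for t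
    proof -
      have "Inf ?A < t" using le that by simp
      then obtain r' where "r' \<in> ?A" "r' < t"
        using cInf_lessD[OF ne] by blast
      then show ?thesis
        using S_mono[OF \<omega>, of r' t] by auto
    qed
    then show "\<forall>\<^sub>F t in at_right \<tau>. s \<le> S t \<omega>"
      by (simp add: eventually_at_right_less eventually_at_filter)
  qed simp
  moreover have "Inf ?A \<le> \<tau>" if "s \<le> S \<tau> \<omega>"
    using that \<tau> bdd by (intro cInf_lower) auto
  ultimately show ?thesis
    using inv n by auto
next
  case False
  then have "inverse_subordinator S s \<omega> = 0"
    unfolding inverse_subordinator_def by (simp only: if_False)
  moreover have "\<forall>n::nat. S (real n) \<omega> < s"
    using False of_nat_0_le_iff not_le by blast
  ultimately show ?thesis using \<tau> by simp
qed

text \<open>The measure \<open>N\<close> is left free so that the result also covers the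
  sigma-algebra generated by \<open>S\<close>, to which the independence assumption refers.\<close>

lemma measurable_inverse_subordinator_pair:
  assumes sp: "space N = space M" and meas: "\<And>t. 0 \<le> t \<Longrightarrow> S t \<in> borel_measurable N"
  shows "(\<lambda>p. inverse_subordinator S (fst p) (snd p)) \<in> borel_measurable (borel \<Otimes>\<^sub>M N)"
  unfolding borel_measurable_iff_le
proof
  fix \<tau> :: real
  show "{p \<in> space (borel \<Otimes>\<^sub>M N). inverse_subordinator S (fst p) (snd p) \<le> \<tau>} \<in> sets (borel \<Otimes>\<^sub>M N)"
  proof (cases "0 \<le> \<tau>")
    case True
    have [measurable]: "S \<tau> \<in> borel_measurable N" "S (real n) \<in> borel_measurable N" for n
      using True by (auto intro: meas)
    have "{p \<in> space (borel \<Otimes>\<^sub>M N). inverse_subordinator S (fst p) (snd p) \<le> \<tau>} =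
        {p \<in> space (borel \<Otimes>\<^sub>M N). fst p \<le> S \<tau> (snd p) \<or> (\<forall>n::nat. S (real n) (snd p) < fst p)}"
      using inverse_subordinator_le_iff[OF _ True] by (auto simp: space_pair_measure sp)
    also have "\<dots> \<in> sets (borel \<Otimes>\<^sub>M N)"
      by measurable
    finally show ?thesis .
  next
    case False
    then have "\<not> inverse_subordinator S s \<omega> \<le> \<tau>" for s \<omega>
      using inverse_subordinator_nonneg[of S s \<omega>] by linarith
    then show ?thesis by simp
  qed
qed

text \<open>The infimum of \<open>exp (- S n)\<close> over the integers has expectation at most
  \<open>exp (- n * \<Phi>(1))\<close> for every \<open>n\<close>, and \<open>\<Phi>(1) > 0\<close>.
  So it vanishes almost surely, which means that the path is unbounded.\<close>

lemma AE_unbounded: "AE \<omega> in M. \<forall>s. \<exists>n::nat. s \<le> S (real n) \<omega>"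
proof -
  have [measurable]: "S (real n) \<in> borel_measurable M" for n
    by (rule measurable_S) simp
  let ?I = "\<lambda>\<omega>. INF n::nat. ennreal (exp (- 1 * S (real n) \<omega>))"
  have le: "(\<integral>\<^sup>+\<omega>. ?I \<omega> \<partial>M) \<le> ennreal (exp (- real n * laplace_exponent \<sigma> 1))" for n
  proof -
    have "(\<integral>\<^sup>+\<omega>. ?I \<omega> \<partial>M) \<le> (\<integral>\<^sup>+\<omega>. ennreal (exp (- 1 * S (real n) \<omega>)) \<partial>M)"
      by (intro nn_integral_mono INF_lower) simp
    also have "\<dots> = ennreal (exp (- real n * laplace_exponent \<sigma> 1))"
      by (rule nn_integral_exp_S) auto
    finally show ?thesis .
  qed
  have "(\<lambda>n. exp (- laplace_exponent \<sigma> 1) ^ n) \<longlonglongrightarrow> 0"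
    using laplace_exponent_pos[of 1] by (intro LIMSEQ_power_zero) simp
  then have "(\<lambda>n. ennreal (exp (- real n * laplace_exponent \<sigma> 1))) \<longlonglongrightarrow> ennreal 0"
    by (intro tendsto_ennrealI) (simp add: exp_of_nat_mult[symmetric])
  from LIMSEQ_le_const[OF this] le have "(\<integral>\<^sup>+\<omega>. ?I \<omega> \<partial>M) = 0"
    by fastforce
  moreover have "?I \<in> borel_measurable M" by measurable
  ultimately have "AE \<omega> in M. ?I \<omega> = 0"
    by (subst (asm) nn_integral_0_iff_AE) auto
  then show ?thesis
  proof eventually_elim
    case (elim \<omega>)
    show ?case
    proof
      fix s
      have "?I \<omega> < ennreal (exp (- s))"
        unfolding elim by simp
      then obtain n :: nat where "ennreal (exp (- 1 * S (real n) \<omega>)) < ennreal (exp (- s))"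
        unfolding INF_less_iff by auto
      then have "s \<le> S (real n) \<omega>"
        by (simp add: ennreal_less_iff)
      then show "\<exists>n::nat. s \<le> S (real n) \<omega>" ..
    qed
  qed
qed

definition occupation_measure :: "real \<Rightarrow> real measure" where
  "occupation_measure t = distr (density lborel (indicator {0..t}) \<Otimes>\<^sub>M M) borel
     (\<lambda>p. inverse_subordinator S (fst p) (snd p))"

lemma measurable_inverse_subordinator_M [measurable]:
  "(\<lambda>p. inverse_subordinator S (fst p) (snd p)) \<in> borel_measurable (borel \<Otimes>\<^sub>M M)"
  by (rule measurable_inverse_subordinator_pair) (auto intro: measurable_S)

lemma measurable_inverse_subordinator_density [measurable]:
  "(\<lambda>p. inverse_subordinator S (fst p) (snd p)) \<in> borel_measurable (density lborel (indicator A) \<Otimes>\<^sub>M M)"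
  using measurable_inverse_subordinator_M by (simp cong: measurable_cong_sets sets_pair_measure_cong)

lemma nn_integral_occupation_measure:
  assumes [measurable]: "g \<in> borel_measurable borel"
  shows "(\<integral>\<^sup>+r. g r \<partial>occupation_measure t) =
    (\<integral>\<^sup>+s. (\<integral>\<^sup>+\<omega>. g (inverse_subordinator S s \<omega>) \<partial>M) * indicator {0..t} s \<partial>lborel)"
proof -
  have m: "(\<lambda>p. g (inverse_subordinator S (fst p) (snd p))) \<in> borel_measurable (density lborel (indicator {0..t}) \<Otimes>\<^sub>M M)"
    by measurable
  have m': "(\<lambda>s. \<integral>\<^sup>+\<omega>. g (inverse_subordinator S s \<omega>) \<partial>M) \<in> borel_measurable borel"
  proof (rule borel_measurable_nn_integral)
    have "(\<lambda>p. g (inverse_subordinator S (fst p) (snd p))) \<in> borel_measurable (borel \<Otimes>\<^sub>M M)"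
      by measurable
    then show "(\<lambda>(s, \<omega>). g (inverse_subordinator S s \<omega>)) \<in> borel_measurable (borel \<Otimes>\<^sub>M M)"
      by (simp add: split_beta')
  qed
  have "(\<integral>\<^sup>+r. g r \<partial>occupation_measure t) =
      (\<integral>\<^sup>+p. g (inverse_subordinator S (fst p) (snd p)) \<partial>(density lborel (indicator {0..t}) \<Otimes>\<^sub>M M))"
    unfolding occupation_measure_def by (rule nn_integral_distr) measurable
  also have "\<dots> = (\<integral>\<^sup>+s. \<integral>\<^sup>+\<omega>. g (inverse_subordinator S s \<omega>) \<partial>M \<partial>density lborel (indicator {0..t}))"
    using nn_integral_fst[OF m] by simp
  also have "\<dots> = (\<integral>\<^sup>+s. (\<integral>\<^sup>+\<omega>. g (inverse_subordinator S s \<omega>) \<partial>M) * indicator {0..t} s \<partial>lborel)"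
    using m' by (subst nn_integral_density) (auto simp: mult.commute)
  finally show ?thesis .
qed

text \<open>Since \<open>E\<^sub>s \<le> \<tau>\<close> iff \<open>s \<le> S\<^sub>\<tau>\<close>, the distribution function of the occupation measure is
  \<open>\<integral>\<^sub>0\<^sup>t P(S\<^sub>\<tau> \<ge> s) ds\<close>.\<close>

lemma occupation_measure_eq_density:
  "occupation_measure t = density lborel (\<lambda>r. ennreal (indicator {0..} r * occupation_density t r))"
    (is "_ = ?D")
proof (rule measure_eqI_generator_eq[where \<Omega>=UNIV and E="range atMost" and A="\<lambda>i. {..real i}"])
  show "Int_stable (range atMost :: real set set)"
    by (auto simp: Int_stable_def)
  have atMost: "emeasure (occupation_measure t) {..\<tau>} = emeasure ?D {..\<tau>}"
    and fin: "emeasure (occupation_measure t) {..\<tau>} < \<infinity>" for \<tau>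
  proof -
    have eq: "emeasure (occupation_measure t) {..\<tau>} =
        (\<integral>\<^sup>+s. (\<integral>\<^sup>+\<omega>. indicator {..\<tau>} (inverse_subordinator S s \<omega>) \<partial>M) * indicator {0..t} s \<partial>lborel)"
      by (subst nn_integral_occupation_measure[symmetric]) (auto simp: occupation_measure_def)
    have "\<dots> \<le> (\<integral>\<^sup>+s. (\<integral>\<^sup>+\<omega>. 1 \<partial>M) * indicator {0..t} s \<partial>lborel)"
      by (intro nn_integral_mono mult_right_mono) (auto simp: indicator_def)
    also have "\<dots> < \<infinity>"
      by (simp add: emeasure_space_1 nn_integral_cmult_indicator emeasure_lborel_Icc_eq)
    finally show "emeasure (occupation_measure t) {..\<tau>} < \<infinity>"
      unfolding eq .
    show "emeasure (occupation_measure t) {..\<tau>} = emeasure ?D {..\<tau>}"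
    proof (cases "0 \<le> \<tau>")
      case True
      have "(\<integral>\<^sup>+\<omega>. indicator {..\<tau>} (inverse_subordinator S s \<omega>) \<partial>M) = survival \<tau> s" if "0 < s" for s
        unfolding survival_def
      proof (rule nn_integral_cong_AE)
        show "AE \<omega> in M. indicator {..\<tau>} (inverse_subordinator S s \<omega>) = (indicator {0<..S \<tau> \<omega>} s :: ennreal)"
          using AE_unbounded AE_space
        proof eventually_elim
          case (elim \<omega>)
          then have "inverse_subordinator S s \<omega> \<le> \<tau> \<longleftrightarrow> s \<le> S \<tau> \<omega>"
            using inverse_subordinator_le_iff[OF elim(2) True, of s] by (metis not_le)
          then show ?case using that by (simp add: indicator_def)
        qed
      qed
      \<comment> \<open>The point \<open>s = 0\<close> is left out: for \<open>t \<ge> 0\<close> the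
        left side is 1 there, while \<open>survival\<close> is 0. It is a Lebesgue null set.\<close>
      then have "(\<integral>\<^sup>+\<omega>. indicator {..\<tau>} (inverse_subordinator S s \<omega>) \<partial>M) * indicator {0..t} s = survival \<tau> s * indicator {..t} s"
        if "s \<noteq> 0" for s
        using that by (cases "0 < s") (auto simp: indicator_def survival_def)
      then have "emeasure (occupation_measure t) {..\<tau>} = (\<integral>\<^sup>+s. survival \<tau> s * indicator {..t} s \<partial>lborel)"
        unfolding eq using AE_lborel_singleton[of "0::real"] by (intro nn_integral_cong_AE) (auto elim!: eventually_mono)
      also have "\<dots> = (\<integral>\<^sup>+r. ennreal (occupation_density t r) * indicator {0..\<tau>} r \<partial>lborel)"
        by (rule nn_integral_survival[OF True])
      also have "\<dots> = emeasure ?D {..\<tau>}"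
        by (subst emeasure_density) (auto intro!: nn_integral_cong simp: indicator_def)
      finally show ?thesis .
    next
      case False
      then have "\<not> inverse_subordinator S s \<omega> \<le> \<tau>" for s \<omega>
        using inverse_subordinator_nonneg[of S s \<omega>] by linarith
      then have "emeasure (occupation_measure t) {..\<tau>} = 0"
        unfolding eq by (simp add: indicator_def)
      also have "0 = emeasure ?D {..\<tau>}"
        using False by (subst emeasure_density) (auto simp: indicator_def nn_integral_0_iff_AE)
      finally show ?thesis .
    qed
  qed
  show "emeasure (occupation_measure t) Z = emeasure ?D Z" if "Z \<in> range atMost" for Z
    using that atMost by auto
  show "emeasure (occupation_measure t) {..real i} \<noteq> \<infinity>" for i
    using fin[of "real i"] by simp
  have "sets borel = sigma_sets UNIV (range (atMost :: real \<Rightarrow> real set))"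
    by (subst borel_eq_atMost) simp
  then show "sets (occupation_measure t) = sigma_sets UNIV (range atMost)" "sets ?D = sigma_sets UNIV (range atMost)"
    by (simp_all add: occupation_measure_def)
  show "(\<Union>i. {..real i}) = UNIV"
    using real_arch_simple by auto
qed auto

lemma integral_inverse_subordinator:
  fixes u :: "real \<Rightarrow> real"
  assumes [measurable]: "u \<in> borel_measurable borel" and B: "\<And>r. \<bar>u r\<bar> \<le> B"
  shows "(LBINT s:{0..t}. \<integral>\<omega>. u (inverse_subordinator S s \<omega>) \<partial>M) = (LBINT r:{0..}. occupation_density t r * u r)"
proof -
  let ?L = "density lborel (indicator {0..t}) :: real measure"
  have finL: "finite_measure ?L"
    by (rule finite_measureI) (simp add: emeasure_density emeasure_lborel_Icc_eq)
  interpret L: finite_measure ?L by (rule finL)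
  interpret LM: pair_sigma_finite ?L M ..
  have m: "(\<lambda>p. u (inverse_subordinator S (fst p) (snd p))) \<in> borel_measurable (?L \<Otimes>\<^sub>M M)"
    by measurable
  have fin: "finite_measure (?L \<Otimes>\<^sub>M M)"
    using finite_measure_axioms finL by (intro finite_measure_pair_measure)
  have int: "integrable (?L \<Otimes>\<^sub>M M) (\<lambda>p. u (inverse_subordinator S (fst p) (snd p)))"
    by (rule finite_measure.integrable_const_bound[OF fin _ m, of B]) (simp add: B)
  have m': "(\<lambda>s. \<integral>\<omega>. u (inverse_subordinator S s \<omega>) \<partial>M) \<in> borel_measurable borel"
  proof (rule borel_measurable_lebesgue_integral)
    have "(\<lambda>p. u (inverse_subordinator S (fst p) (snd p))) \<in> borel_measurable (borel \<Otimes>\<^sub>M M)"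
      by measurable
    then show "(\<lambda>(s, \<omega>). u (inverse_subordinator S s \<omega>)) \<in> borel_measurable (borel \<Otimes>\<^sub>M M)"
      by (simp add: split_beta')
  qed
  have L: "?L = density lborel (\<lambda>s. ennreal (indicator {0..t} s))"
    by (simp add: ennreal_indicator)
  have "(LBINT s:{0..t}. \<integral>\<omega>. u (inverse_subordinator S s \<omega>) \<partial>M) = (\<integral>s. \<integral>\<omega>. u (inverse_subordinator S s \<omega>) \<partial>M \<partial>?L)"
    unfolding set_lebesgue_integral_def L using m' by (subst integral_density) auto
  also have "\<dots> = (\<integral>p. u (inverse_subordinator S (fst p) (snd p)) \<partial>(?L \<Otimes>\<^sub>M M))"
    using LM.integral_fst'[OF int] by simp
  also have "\<dots> = (\<integral>r. u r \<partial>occupation_measure t)"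
    unfolding occupation_measure_def by (rule integral_distr[symmetric]) measurable
  also have "\<dots> = (\<integral>r. (indicator {0..} r * occupation_density t r) *\<^sub>R u r \<partial>lborel)"
    unfolding occupation_measure_eq_density
    by (rule integral_density) (auto simp: occupation_density_bounds)
  finally show ?thesis
    by (simp add: set_lebesgue_integral_def mult.assoc)
qed

lemma cesaro_limit:
  fixes u :: "real \<Rightarrow> real"
  assumes [measurable]: "u \<in> borel_measurable borel" and B: "\<And>r. \<bar>u r\<bar> \<le> B"
    and int: "set_integrable lborel {0..} u"
  shows "((\<lambda>t. 1 / kernel_primitive \<sigma> t * (LBINT s:{0..t}. \<integral>\<omega>. u (inverse_subordinator S s \<omega>) \<partial>M))
      \<longlongrightarrow> (LBINT r:{0..}. u r)) at_top"
proof -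
  let ?g = "\<lambda>t r. (occupation_density t r * inverse (kernel_primitive \<sigma> t)) * (indicator {0..} r *\<^sub>R u r)"
  have "((\<lambda>t. \<integral>r. ?g t r \<partial>lborel) \<longlongrightarrow> (\<integral>r. indicator {0..} r *\<^sub>R u r \<partial>lborel)) at_top"
  proof (rule integral_dominated_convergence_at_top[where w="\<lambda>r. norm (indicator {0..} r *\<^sub>R u r)"])
    show "integrable lborel (\<lambda>r. norm (indicator {0..} r *\<^sub>R u r))"
      using int unfolding set_integrable_def by (rule integrable_norm)
    show "\<forall>\<^sub>F t in at_top. AE r in lborel. norm (?g t r) \<le> norm (indicator {0..} r *\<^sub>R u r)"
    proof (rule always_eventually, rule allI, rule AE_I2)
      fix t r
      \<comment> \<open>If the primitive is 0, as it is for \<open>t \<le> 0\<close>, its inverse is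
        0 by convention and the bound is trivial.\<close>
      have "\<bar>occupation_density t r * inverse (kernel_primitive \<sigma> t)\<bar> \<le> 1"
        using occupation_density_bounds[of t r] kernel_primitive_nonneg[of t]
        by (cases "kernel_primitive \<sigma> t = 0") (auto simp: divide_inverse[symmetric] divide_le_eq_1)
      from mult_right_mono[OF this, of "norm (indicator {0..} r *\<^sub>R u r)"]
      show "norm (?g t r) \<le> norm (indicator {0..} r *\<^sub>R u r)"
        by (simp add: abs_mult)
    qed
    show "AE r in lborel. ((\<lambda>t. ?g t r) \<longlongrightarrow> indicator {0..} r *\<^sub>R u r) at_top"
      using tendsto_mult[OF occupation_density_limit tendsto_const] by (intro AE_I2) fastforce
  qed measurable
  moreover have "(\<integral>r. ?g t r \<partial>lborel) = 1 / kernel_primitive \<sigma> t * (LBINT s:{0..t}. \<integral>\<omega>. u (inverse_subordinator S s \<omega>) \<partial>M)" for t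
  proof -
    have "(\<integral>r. ?g t r \<partial>lborel) = (\<integral>r. inverse (kernel_primitive \<sigma> t) * (indicator {0..} r *\<^sub>R (occupation_density t r * u r)) \<partial>lborel)"
      by (intro Bochner_Integration.integral_cong) (auto simp: indicator_def)
    then show ?thesis
      unfolding integral_inverse_subordinator[OF assms(1) B]
      by (simp add: set_lebesgue_integral_def divide_inverse)
  qed
  ultimately show ?thesis
    by (simp add: set_lebesgue_integral_def)
qed

end

section \<open>Subordination\<close>

text \<open>Independence, checked on rectangles, makes the joint law of the sample point, seen
  through \<open>G\<close> only, and of \<open>T\<close> a product measure; Fubini then evaluates
  the process at a frozen time.\<close>

lemma (in prob_space) expectation_at_independent_time:
  fixes f :: "'c::topological_space \<Rightarrow> real" and Y :: "real \<Rightarrow> 'a \<Rightarrow> 'c"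
  assumes GX: "subalgebra M G" and GS: "subalgebra M H"
    and ind: "indep_set (sets G) (sets H)"
    and Y: "(\<lambda>p. Y (max 0 (fst p)) (snd p)) \<in> borel_measurable (borel \<Otimes>\<^sub>M G)"
    and T: "T \<in> borel_measurable H" "\<And>\<omega>. 0 \<le> T \<omega>"
    and f: "f \<in> borel_measurable borel" "\<And>y. \<bar>f y\<bar> \<le> B"
  shows "(\<integral>\<omega>. f (Y (T \<omega>) \<omega>) \<partial>M) = (\<integral>\<omega>. \<integral>\<omega>'. f (Y (T \<omega>) \<omega>') \<partial>M \<partial>M)"
proof -
  have spG: "space G = space M" and setsG: "sets G \<subseteq> sets M" and spH: "space H = space M" and setsH: "sets H \<subseteq> sets M"
    using GX GS by (auto simp: subalgebra_def)
  \<comment> \<open>The identity into the coarser sigma-algebra \<open>G\<close> acts as the random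
    element "whole path of \<open>Y\<close>", so no path space has to be built.\<close>
  have idG: "(\<lambda>\<omega>. \<omega>) \<in> M \<rightarrow>\<^sub>M G"
    using setsG spG by (intro measurableI) auto
  have TM: "T \<in> borel_measurable M"
    using measurable_from_subalg[OF GS T(1)] .
  let ?Q = "distr M G (\<lambda>\<omega>. \<omega>)" and ?R = "distr M borel T"
  interpret Q: prob_space ?Q by (rule prob_space_distr[OF idG])
  interpret R: prob_space ?R by (rule prob_space_distr[OF TM])
  interpret QR: pair_prob_space ?Q ?R ..
  have pairM: "(\<lambda>\<omega>. (\<omega>, T \<omega>)) \<in> M \<rightarrow>\<^sub>M (G \<Otimes>\<^sub>M borel)"
    using idG TM by (rule measurable_Pair)
  have eq: "?Q \<Otimes>\<^sub>M ?R = distr M (G \<Otimes>\<^sub>M borel) (\<lambda>\<omega>. (\<omega>, T \<omega>))"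
  proof (rule pair_measure_eqI)
    show "sigma_finite_measure ?Q" "sigma_finite_measure ?R"
      by (rule Q.sigma_finite_measure_axioms R.sigma_finite_measure_axioms)+
    show "sets (?Q \<Otimes>\<^sub>M ?R) = sets (distr M (G \<Otimes>\<^sub>M borel) (\<lambda>\<omega>. (\<omega>, T \<omega>)))"
      by (simp cong: sets_pair_measure_cong)
    fix A C assume "A \<in> sets ?Q" "C \<in> sets ?R"
    then have A: "A \<in> sets G" and C: "C \<in> sets borel" by simp_all
    have TC: "T -` C \<inter> space M \<in> sets H"
      using measurable_sets[OF T(1) C] spH by simp
    have AM: "A \<subseteq> space M"
      using sets.sets_into_space[OF A] spG by simp
    have "emeasure ?Q A * emeasure ?R C = ennreal (prob A) * ennreal (prob (T -` C \<inter> space M))"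
      using A C AM idG TM by (simp add: emeasure_distr emeasure_eq_measure Int_absorb2)
    also have "\<dots> = ennreal (prob (A \<inter> (T -` C \<inter> space M)))"
      using ind A TC unfolding indep_sets2_eq by (simp add: ennreal_mult)
    also have "A \<inter> (T -` C \<inter> space M) = (\<lambda>\<omega>. (\<omega>, T \<omega>)) -` (A \<times> C) \<inter> space M"
      using AM by auto
    also have "ennreal (prob \<dots>) = emeasure (distr M (G \<Otimes>\<^sub>M borel) (\<lambda>\<omega>. (\<omega>, T \<omega>))) (A \<times> C)"
      using A C by (simp add: emeasure_distr[OF pairM] emeasure_eq_measure)
    finally show "emeasure ?Q A * emeasure ?R C = emeasure (distr M (G \<Otimes>\<^sub>M borel) (\<lambda>\<omega>. (\<omega>, T \<omega>))) (A \<times> C)" .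
  qed
  define g where "g = (\<lambda>p. f (Y (max 0 (snd p)) (fst p)))"
  have "(\<lambda>p. (snd p, fst p)) \<in> (G \<Otimes>\<^sub>M borel) \<rightarrow>\<^sub>M (borel \<Otimes>\<^sub>M G)"
    by measurable
  from measurable_compose[OF measurable_compose[OF this Y] f(1)]
  have g: "g \<in> borel_measurable (G \<Otimes>\<^sub>M borel)"
    by (simp add: g_def)
  then have g': "g \<in> borel_measurable (?Q \<Otimes>\<^sub>M ?R)"
    by (simp cong: measurable_cong_sets sets_pair_measure_cong)
  have int: "integrable (?Q \<Otimes>\<^sub>M ?R) (case_prod (\<lambda>x y. g (x, y)))"
    using g' f(2) by (intro QR.P.integrable_const_bound[of _ B]) (auto simp: g_def)
  have slice: "(\<lambda>\<omega>'. g (\<omega>', r)) \<in> borel_measurable G" for r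
    using measurable_compose[OF measurable_Pair2'[of r borel G] g] by simp
  have "(\<integral>\<omega>. f (Y (T \<omega>) \<omega>) \<partial>M) = (\<integral>\<omega>. g (\<omega>, T \<omega>) \<partial>M)"
    using T(2) by (simp add: g_def)
  also have "\<dots> = (\<integral>p. g p \<partial>distr M (G \<Otimes>\<^sub>M borel) (\<lambda>\<omega>. (\<omega>, T \<omega>)))"
    by (rule integral_distr[OF pairM g, symmetric])
  also have "\<dots> = (\<integral>p. g p \<partial>(?Q \<Otimes>\<^sub>M ?R))"
    by (simp only: eq)
  also have "\<dots> = (\<integral>r. \<integral>\<omega>'. g (\<omega>', r) \<partial>?Q \<partial>?R)"
    using QR.integral_snd[OF int] by (simp add: case_prod_beta')
  also have "\<dots> = (\<integral>r. \<integral>\<omega>'. g (\<omega>', r) \<partial>M \<partial>?R)"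
    by (simp add: integral_distr[OF idG slice])
  also have "\<dots> = (\<integral>\<omega>. \<integral>\<omega>'. g (\<omega>', T \<omega>) \<partial>M \<partial>M)"
  proof (rule integral_distr[OF TM])
    have gM: "g \<in> borel_measurable (M \<Otimes>\<^sub>M borel)"
      using measurable_compose[OF measurable_Pair[OF measurable_compose[OF measurable_fst idG] measurable_snd] g] by simp
    have "(\<lambda>p. (snd p, fst p)) \<in> (borel \<Otimes>\<^sub>M M) \<rightarrow>\<^sub>M (M \<Otimes>\<^sub>M borel)"
      by measurable
    from measurable_compose[OF this gM]
    have "(\<lambda>(r, \<omega>'). g (\<omega>', r)) \<in> borel_measurable (borel \<Otimes>\<^sub>M M)"
      by (simp add: split_beta')
    then show "(\<lambda>r. \<integral>\<omega>'. g (\<omega>', r) \<partial>M) \<in> borel_measurable borel"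
      by (rule borel_measurable_lebesgue_integral)
  qed
  also have "\<dots> = (\<integral>\<omega>. \<integral>\<omega>'. f (Y (T \<omega>) \<omega>') \<partial>M \<partial>M)"
    using T(2) by (simp add: g_def)
  finally show ?thesis .
qed

theorem theorem5p2:
  fixes a f :: "'a::euclidean_space \<Rightarrow> real"
    and M :: "'a \<Rightarrow> 'w measure"
    and X :: "real \<Rightarrow> 'w \<Rightarrow> 'a"
    and S :: "real \<Rightarrow> 'w \<Rightarrow> real"
    and \<sigma> :: "real measure"
  assumes "DIM('a) \<ge> 3"
    and "\<And>x. a (- x) = a x"
    and "\<And>x. a x \<ge> 0"
    and "continuous_on UNIV a"
    and "bounded (range a)"
    and "has_bochner_integral lborel a 1"
    and "integrable lborel (fourier_transform a)"
    and "integrable lborel (\<lambda>x. (norm x)\<^sup>2 * a x)"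
    and "pure_jump_markov_process M X a"
    and "\<And>x. subordinator (M x) S \<sigma>"
    and "\<And>x. independent_processes (M x) X S"
    and "admissible_kernel \<sigma>"
    and "continuous_on UNIV f"
    and "bounded (range f)"
    and "integrable lborel f"
  shows "\<forall>x. ((\<lambda>t. 1 / kernel_primitive \<sigma> t * (LBINT s:{0..t}. subordinated_solution M X S f s x))
                 \<longlongrightarrow> (\<integral>y. f y \<partial>green_measure M X x)) at_top"
proof
  fix x
  interpret markov M X
    using assms(9) by unfold_locales (simp add: pure_jump_markov_process_def)
  interpret admissible_subordinator "M x" S \<sigma>
    using assms(10,12) by (intro admissible_subordinator.intro admissible_subordinator_axioms.intro)
  let ?G = "generated_algebra (M x) {0..} X" and ?H = "generated_algebra (M x) {0..} S"
  obtain B where B: "\<And>y. \<bar>f y\<bar> \<le> B"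
    using assms(14) by (auto simp: bounded_iff)
  have f: "f \<in> borel_measurable borel"
    using assms(13) by (rule borel_measurable_continuous_onI)
  have subG: "subalgebra (M x) ?G" and subH: "subalgebra (M x) ?H"
    by (intro subalgebra_generated_algebra; auto intro: measurable_X measurable_S)+
  have right: "((\<lambda>s. X s \<omega>) \<longlongrightarrow> X t \<omega>) (at_right t)" if "\<omega> \<in> space (M x)" "0 \<le> t" for \<omega> t
    using assms(9) that by (intro pure_jump_path_right) (auto simp: pure_jump_markov_process_def)
  \<comment> \<open>Joint measurability is established relative to the sigma-algebra of
    \<open>X\<close> alone, since independence speaks about that one; the version for
    \<open>M x\<close> below serves the Green measure.\<close>
  have XG: "(\<lambda>p. X (max 0 (fst p)) (snd p)) \<in> borel_measurable (borel \<Otimes>\<^sub>M ?G)"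
    using borel_measurable_right_continuous[of X ?G] right
    by (simp add: measurable_generated_algebra split_beta')
  have XM: "(\<lambda>(t, \<omega>). X (max 0 t) \<omega>) \<in> borel_measurable (borel \<Otimes>\<^sub>M M x)"
    by (rule borel_measurable_right_continuous) (auto intro: measurable_X right)
  \<comment> \<open>Freezing negative times at 0 makes \<open>u\<close> Borel and bounded on the
    whole line. It is evaluated only at values of the inverse subordinator and integrated over
    \<open>{0..}\<close>, where the extension is invisible.\<close>
  define u where "u r = (\<integral>\<omega>. f (X (max 0 r) \<omega>) \<partial>M x)" for r
  have u_meas: "u \<in> borel_measurable borel"
    unfolding u_def[abs_def]
    by (rule borel_measurable_lebesgue_integral) (use measurable_compose[OF XM f] in \<open>simp add: split_beta'\<close>)
  have uB: "\<bar>u r\<bar> \<le> B" for r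
  proof -
    have "\<bar>u r\<bar> \<le> (\<integral>\<omega>. \<bar>f (X (max 0 r) \<omega>)\<bar> \<partial>M x)"
      unfolding u_def by (rule integral_abs_bound)
    also have "\<dots> \<le> (\<integral>\<omega>. B \<partial>M x)"
    proof (rule integral_mono)
      show "integrable (M x) (\<lambda>\<omega>. \<bar>f (X (max 0 r) \<omega>)\<bar>)"
        using measurable_compose[OF measurable_X[of "max 0 r" x] f] B
        by (intro integrable_abs integrable_const_bound[of _ B]) auto
    qed (auto simp: B)
    finally show ?thesis by (simp add: prob_space)
  qed
  have fin: "(\<integral>\<^sup>+t\<in>{0..}. (\<integral>\<^sup>+\<omega>. ennreal \<bar>f (X t \<omega>)\<bar> \<partial>M x) \<partial>lborel) < \<infinity>"
    using assms(1-4,6,7,9,13-15) by (rule transient)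
  note green = integral_green_measure[where M=M and X=X and x=x and f=f, OF prob_space_M XM f fin]
  have u_ge: "indicator {0..} r *\<^sub>R u r = indicator {0..} r *\<^sub>R (\<integral>\<omega>. f (X r \<omega>) \<partial>M x)" for r :: real
    by (auto simp: u_def indicator_def max_def)
  have u_int: "set_integrable lborel {0..} u"
    using green(1) unfolding set_integrable_def u_ge .
  have u_lim: "(LBINT r:{0..}. u r) = (\<integral>y. f y \<partial>green_measure M X x)"
    unfolding green(2) set_lebesgue_integral_def u_ge ..
  have sol: "subordinated_solution M X S f s x = (\<integral>\<omega>. u (inverse_subordinator S s \<omega>) \<partial>M x)" for s
  proof -
    have "(\<lambda>p. inverse_subordinator S (fst p) (snd p)) \<in> borel_measurable (borel \<Otimes>\<^sub>M ?H)"
      by (rule measurable_inverse_subordinator_pair) (auto intro: measurable_generated_algebra)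
    from measurable_compose[OF measurable_Pair1'[of s borel ?H] this]
    have "inverse_subordinator S s \<in> borel_measurable ?H"
      by simp
    then have "subordinated_solution M X S f s x =
        (\<integral>\<omega>. \<integral>\<omega>'. f (X (inverse_subordinator S s \<omega>) \<omega>') \<partial>M x \<partial>M x)"
      unfolding subordinated_solution_def using assms(11)[of x]
      by (intro expectation_at_independent_time[OF subG subH _ XG _ inverse_subordinator_nonneg f B])
         (auto simp: independent_processes_def)
    then show ?thesis
      by (simp add: u_def inverse_subordinator_nonneg)
  qed
  show "((\<lambda>t. 1 / kernel_primitive \<sigma> t * (LBINT s:{0..t}. subordinated_solution M X S f s x))
      \<longlongrightarrow> (\<integral>y. f y \<partial>green_measure M X x)) at_top"
    using cesaro_limit[OF u_meas uB u_int] unfolding u_lim sol .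
qed

end
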